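(* Let $k$ be an algebraically closed field of characteristic $p=2$, let $m\ge3$ be an odd integer, let $n\ge 2$, let $\lambda_0,\dots,\lambda_{n-2}\in k$ be pairwise different and nonzero, and let $X=C^m(\lambda_0,\dots,\lambda_{n-2})\subset\mathbf{P}^n$ be the generalized Fermat curve. Then $$\sigma(X)\ \ge\ \sum_{t=2}^{n-1}(-1)^t\sum_{0\le i_0<i_1<\cdots<i_{t-2}\le n-2}\sigma\bigl(C^m(\lambda_{i_0},\lambda_{i_1},\dots,\lambda_{i_{t-2}})\bigr).$$
   Context: For $t\ge 2$ and pairwise different nonzero $\mu_0,\dots,\mu_{t-2}\in k$, $C^m(\mu_0,\dots,\mu_{t-2})$ denotes the curve in $\mathbf{P}^t$ (homogeneous coordinates $y_0,\dots,y_t$) defined by the $t-1$ equations $\mu_j y_0^m+y_1^m+y_{j+2}^m=0$, $j=0,\dots,t-2$. The $p$-rank $\sigma(Y)$ of a projective curve $Y$ over $k$ is the dimension of the largest subspace of $H^1(Y,\mathcal{O}_Y)$ which is mapped bijectively to itself by the ($p$-linear) Frobenius map $F$. *)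

theory Defs
  imports "HOL-Algebra.AbelCoset" "HOL-Computational_Algebra.Polynomial"
    "Jordan_Normal_Form.VS_Connect"
begin

section \<open>Projective algebraic sets and their regular functions\<close>

text \<open>The field of constants \<open>k\<close> is the type \<open>'k\<close>.  A vector of \<open>k\<^sup>t\<^sup>+\<^sup>1\<close> is a function
  \<open>nat \<Rightarrow> 'k\<close> that vanishes beyond \<open>t\<close>, and a point of \<open>P\<^sup>t\<close> is the set of all its vectors of
  homogeneous coordinates.\<close>

type_synonym 'k point = "(nat \<Rightarrow> 'k) set"

definition proj_space :: "nat \<Rightarrow> 'k::field point set" where
  "proj_space t =
     {{(\<lambda>i. c * y i) | c. c \<noteq> 0} | y. (\<exists>i. y i \<noteq> 0) \<and> (\<forall>i>t. y i = 0)}"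

text \<open>Polynomial functions homogeneous of degree \<open>d\<close> in the variables \<open>y\<^sub>0, \<dots>, y\<^sub>t\<close>.\<close>

definition homog_poly :: "nat \<Rightarrow> nat \<Rightarrow> ((nat \<Rightarrow> 'k::field) \<Rightarrow> 'k) \<Rightarrow> bool" where
  "homog_poly t d g \<longleftrightarrow>
     (\<exists>E a. finite E \<and> (\<forall>e\<in>E. (\<Sum>i\<le>t. e i) = d) \<and>
        g = (\<lambda>y. \<Sum>e\<in>E. a e * (\<Prod>i\<le>t. y i ^ e i)))"

text \<open>Zariski-open subsets of a subset \<open>Y\<close> of \<open>P\<^sup>t\<close>.\<close>

definition proj_open :: "nat \<Rightarrow> 'k::field point set \<Rightarrow> 'k point set \<Rightarrow> bool" where
  "proj_open t Y U \<longleftrightarrow>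
     (\<exists>T. (\<forall>g\<in>T. \<exists>d. homog_poly t d g) \<and> U = {P \<in> Y. \<exists>g\<in>T. \<forall>y\<in>P. g y \<noteq> 0})"

text \<open>The sections of the structure sheaf of the reduced algebraic set \<open>Y\<close> over the open set \<open>U\<close>:
  functions that are locally quotients of forms of equal degree.  The values of \<open>f\<close> outside \<open>U\<close>
  are irrelevant.\<close>

definition regular_on ::
    "nat \<Rightarrow> 'k::field point set \<Rightarrow> 'k point set \<Rightarrow> ('k point \<Rightarrow> 'k) \<Rightarrow> bool" where
  "regular_on t Y U f \<longleftrightarrow>
     (\<forall>P\<in>U. \<exists>V d g h. proj_open t Y V \<and> P \<in> V \<and> V \<subseteq> U \<and>
        homog_poly t d g \<and> homog_poly t d h \<and>
        (\<forall>Q\<in>V. \<forall>y\<in>Q. h y \<noteq> 0 \<and> f Q = g y / h y))"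

section \<open>The first cohomology of the structure sheaf\<close>

text \<open>\<open>H\<^sup>1(Y, O\<^sub>Y)\<close> is the direct limit of the Cech groups over all open covers of \<open>Y\<close>.
  The covers \<open>(U\<^sub>x)\<close> indexed by the points of \<open>Y\<close>, with \<open>x \<in> U\<^sub>x\<close>, are cofinal,
  and one such cover refines another as soon as it is contained in it indexwise.
  So the limit is the quotient of the families \<open>(f\<^sub>x\<^sub>y)\<close> which are cocycles on
  some such cover by those which are coboundaries on some such cover.\<close>

definition point_cover ::
    "nat \<Rightarrow> 'k::field point set \<Rightarrow> ('k point \<Rightarrow> 'k point set) \<Rightarrow> bool" where
  "point_cover t Y U \<longleftrightarrow> (\<forall>x\<in>Y. proj_open t Y (U x) \<and> x \<in> U x)"

type_synonym 'k cochain = "'k point \<Rightarrow> 'k point \<Rightarrow> 'k point \<Rightarrow> 'k"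

definition cocycles :: "nat \<Rightarrow> 'k::field point set \<Rightarrow> 'k cochain set" where
  "cocycles t Y =
     {f. \<exists>U. point_cover t Y U \<and>
        (\<forall>x\<in>Y. \<forall>y\<in>Y. regular_on t Y (U x \<inter> U y) (f x y)) \<and>
        (\<forall>x\<in>Y. \<forall>y\<in>Y. \<forall>z\<in>Y. \<forall>P\<in>U x \<inter> U y \<inter> U z. f y z P - f x z P + f x y P = 0)}"

definition coboundaries :: "nat \<Rightarrow> 'k::field point set \<Rightarrow> 'k cochain set" where
  "coboundaries t Y =
     {f. \<exists>U h. point_cover t Y U \<and> (\<forall>x\<in>Y. regular_on t Y (U x) (h x)) \<and>
        (\<forall>x\<in>Y. \<forall>y\<in>Y. \<forall>P\<in>U x \<inter> U y. f x y P = h y P - h x P)}"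

definition cocycle_space :: "nat \<Rightarrow> 'k::field point set \<Rightarrow> ('k, 'k cochain) module" where
  "cocycle_space t Y =
     \<lparr>carrier = cocycles t Y, monoid.mult = undefined, one = undefined,
      zero = (\<lambda>x y P. 0), add = (\<lambda>f g x y P. f x y P + g x y P),
      smult = (\<lambda>c f x y P. c * f x y P)\<rparr>"

definition quotient_module ::
    "('a, 'b, 'c) module_scheme \<Rightarrow> 'b set \<Rightarrow> ('a, 'b set) module" where
  "quotient_module M N =
     \<lparr>carrier = a_rcosets\<^bsub>M\<^esub> N, monoid.mult = undefined, one = undefined,
      zero = N, add = set_add M,
      smult = (\<lambda>c X. \<Union>x\<in>X. N +>\<^bsub>M\<^esub> (c \<odot>\<^bsub>M\<^esub> x))\<rparr>"

definition H1 :: "nat \<Rightarrow> 'k::field point set \<Rightarrow> ('k, 'k cochain set) module" where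
  "H1 t Y = quotient_module (cocycle_space t Y) (coboundaries t Y)"

section \<open>The p-rank\<close>

definition frobenius_H1 ::
    "nat \<Rightarrow> 'k::field point set \<Rightarrow> 'k cochain set \<Rightarrow> 'k cochain set" where
  "frobenius_H1 t Y X =
     (\<Union>f\<in>X. coboundaries t Y +>\<^bsub>cocycle_space t Y\<^esub> (\<lambda>x y P. f x y P ^ CHAR('k)))"

text \<open>\<open>GREATEST\<close> refers to inclusion of sets.\<close>

definition p_rank :: "nat \<Rightarrow> 'k::field point set \<Rightarrow> nat" where
  "p_rank t Y =
     (let W = (GREATEST W. subspace class_ring W (H1 t Y) \<and> bij_betw (frobenius_H1 t Y) W W)
      in vectorspace.dim class_ring ((H1 t Y)\<lparr>carrier := W\<rparr>))"

section \<open>Generalized Fermat curves\<close>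

text \<open>For \<open>\<mu>s = [\<mu>\<^sub>0, \<dots>, \<mu>\<^sub>t\<^sub>-\<^sub>2]\<close> this is the curve \<open>C\<^sup>m(\<mu>\<^sub>0, \<dots>, \<mu>\<^sub>t\<^sub>-\<^sub>2)\<close> in \<open>P\<^sup>t\<close>,
  so \<open>t = length \<mu>s + 1\<close>.  If \<open>m\<close> is nonzero in \<open>k\<close> and the \<open>\<mu>\<^sub>j\<close> are nonzero and pairwise
  different, the scheme given by the equations is smooth, hence equal to this reduced
  algebraic set.\<close>

definition gen_fermat :: "nat \<Rightarrow> 'k::field list \<Rightarrow> 'k point set" where
  "gen_fermat m \<mu>s =
     {P \<in> proj_space (length \<mu>s + 1).
        \<forall>y\<in>P. \<forall>j<length \<mu>s. \<mu>s ! j * y 0 ^ m + y 1 ^ m + y (j + 2) ^ m = 0}"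

end

(*
For C = C^m(mu) put z = y_1/y_0 and w_q = y_(q+2)/y_0, so that w_q^m = -(mu_q + z^m).  The charts
y_0 \<noteq> 0 and y_1 \<noteq> 0 cover C, and the functions on their intersection have the basis z^j w^a with j an
integer and 0 \<le> a_q < m.  Those with j \<ge> 0 extend to the first chart, those with j \<le> -|a| to the second
one, so the monomials with -|a| < j < 0 are a basis of H^1(C, O).  Since m is prime to p, Frobenius
preserves the support of a, and its matrix in this basis depends only on the mu_q with q in the
support.  Hence \<sigma>(C) is the sum over all supports T of numbers \<sigma>(T) that do not depend on the curve in
which T occurs, with \<sigma>({}) = 0.  By inclusion-exclusion the alternating sum of the theorem equals
(-1)^(n-1) times the sum of \<sigma>(T) over the proper supports T, while \<sigma>(X) is the sum over all T.
*)
theory Submission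
  imports Defs "HOL-Library.Function_Algebras"
begin

section \<open>Commutative algebra leading to the Nullstellensatz\<close>

section \<open>The Nullstellensatz\<close>

text \<open>\<open>H1\<close> is a limit over all covers, so replacing it by a two-chart complex
  requires that H^1 vanishes on affine algebraic sets, and knowing the functions on a chart requires
  that they are polynomials. Both facts rest on the Nullstellensatz. Curves are plain sets of
  points, hence a relation between monomials is refuted by evaluating at enough points; these exist
  because a nonzero element has \<open>m\<close> distinct \<open>m\<close>-th roots when
  \<open>m\<close> is prime to the characteristic.

  To compare Frobenius on different curves, monomials are indexed by parameter indices instead of
  the coordinates of one curve. A single vector space with a single semilinear map then contains the
  cohomology of all the curves as invariant subspaces cut out by supports.

  The value \<sigma>({}) = 0 makes the count exact: the sum of the theorem starts at t = 2, so the
  empty set of parameters is missing from the inclusion-exclusion, and \<sigma>({}) gets another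
  coefficient than the remaining terms.\<close>

definition subring_set :: "'r::comm_ring_1 set \<Rightarrow> bool" where
  "subring_set P \<longleftrightarrow> 1 \<in> P \<and> (\<forall>a\<in>P. \<forall>b\<in>P. a - b \<in> P \<and> a * b \<in> P)"

text \<open>Ideals are relative to a subset \<open>P\<close> of one ring type: the induction on the
  number of variables runs through a chain of subrings of a single type of functions.\<close>

definition ideal_in :: "'r::comm_ring_1 set \<Rightarrow> 'r set \<Rightarrow> bool" where
  "ideal_in P I \<longleftrightarrow> I \<subseteq> P \<and> 0 \<in> I \<and> (\<forall>a\<in>I. \<forall>b\<in>I. a + b \<in> I) \<and> (\<forall>a\<in>P. \<forall>b\<in>I. a * b \<in> I)"

definition prime_in :: "'r::comm_ring_1 set \<Rightarrow> 'r set \<Rightarrow> bool" where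
  "prime_in P I \<longleftrightarrow> ideal_in P I \<and> 1 \<notin> I \<and> (\<forall>a\<in>P. \<forall>b\<in>P. a * b \<in> I \<longrightarrow> a \<in> I \<or> b \<in> I)"

lemma subring_setD:
  assumes "subring_set P"
  shows "1 \<in> P" "0 \<in> P" "a \<in> P \<Longrightarrow> b \<in> P \<Longrightarrow> a + b \<in> P" "a \<in> P \<Longrightarrow> b \<in> P \<Longrightarrow> a - b \<in> P"
    "a \<in> P \<Longrightarrow> b \<in> P \<Longrightarrow> a * b \<in> P" "a \<in> P \<Longrightarrow> - a \<in> P" "a \<in> P \<Longrightarrow> a ^ n \<in> P"
proof -
  show 1: "1 \<in> P" using assms unfolding subring_set_def by blast
  show m: "a \<in> P \<Longrightarrow> b \<in> P \<Longrightarrow> a - b \<in> P" for a b using assms unfolding subring_set_def by blast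
  show t: "a \<in> P \<Longrightarrow> b \<in> P \<Longrightarrow> a * b \<in> P" for a b using assms unfolding subring_set_def by blast
  show 0: "0 \<in> P" using m[OF 1 1] by simp
  show n: "a \<in> P \<Longrightarrow> - a \<in> P" for a using m[OF 0] by fastforce
  show "a \<in> P \<Longrightarrow> b \<in> P \<Longrightarrow> a + b \<in> P" using m[OF _ n] by fastforce
  show "a \<in> P \<Longrightarrow> a ^ n \<in> P" by (induction n) (auto intro: 1 t)
qed

lemma subring_set_sum: "subring_set P \<Longrightarrow> (\<And>i. i \<in> A \<Longrightarrow> f i \<in> P) \<Longrightarrow> sum f A \<in> P"
  by (induction A rule: infinite_finite_induct) (auto intro: subring_setD)

lemma ideal_in_sum: "ideal_in P I \<Longrightarrow> (\<And>i. i \<in> A \<Longrightarrow> f i \<in> I) \<Longrightarrow> sum f A \<in> I"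
  by (induction A rule: infinite_finite_induct) (auto simp: ideal_in_def)

lemma ideal_in_uminus:
  assumes "subring_set P" "ideal_in P I" "a \<in> I" shows "- a \<in> I"
proof -
  have "(- 1) * a \<in> I"
    using assms subring_setD(1,6)[OF assms(1)] unfolding ideal_in_def by blast
  then show ?thesis by simp
qed

lemma ideal_in_diff:
  assumes "subring_set P" "ideal_in P I" "a \<in> I" "b \<in> I" shows "a - b \<in> I"
  using ideal_in_uminus[OF assms(1,2,4)] assms(2,3) unfolding ideal_in_def
  by (metis uminus_add_conv_diff add.commute)

lemma prime_in_power:
  assumes "subring_set P" "prime_in P I" "a \<in> P" "a ^ n \<in> I"
  shows "a \<in> I"
  using assms(4)
proof (induction n)
  case 0
  then show ?case using assms(2) by (simp add: prime_in_def)
next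
  case (Suc n)
  then show ?case using assms(2,3) subring_setD(7)[OF assms(1,3)] unfolding prime_in_def by auto
qed

section \<open>Polynomials with coefficients in a subring\<close>

definition poly_over :: "'r::comm_ring_1 set \<Rightarrow> 'r poly set" where
  "poly_over P = {p. \<forall>i. coeff p i \<in> P}"

lemma subring_set_poly_over:
  assumes "subring_set P" shows "subring_set (poly_over P)"
  unfolding subring_set_def poly_over_def
  using subring_setD[OF assms]
  by (auto simp: coeff_mult intro!: subring_set_sum[OF assms])

lemma poly_over_smult: "subring_set P \<Longrightarrow> a \<in> P \<Longrightarrow> p \<in> poly_over P \<Longrightarrow> Polynomial.smult a p \<in> poly_over P"
  by (auto simp: poly_over_def subring_setD)

lemma poly_over_monom: "subring_set P \<Longrightarrow> a \<in> P \<Longrightarrow> monom a n \<in> poly_over P"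
  by (auto simp: poly_over_def subring_setD)

text \<open>Leading coefficients need not be invertible, so each division step multiplies
  \<open>f\<close> by that of \<open>g\<close>; \<open>K\<close> counts the steps. The bound on
  \<open>degree q\<close> serves to recognize a quotient whose degree lies below a minimal
  one.\<close>

lemma poly_over_pseudo_division:
  assumes P: "subring_set P" and f: "f \<in> poly_over P" and g: "g \<in> poly_over P" and "degree g = d" "d > 0"
  shows "\<exists>K. \<exists>q\<in>poly_over P. \<exists>r\<in>poly_over P. Polynomial.smult (coeff g d ^ K) f = g * q + r \<and>
    degree r < d \<and> degree q \<le> degree f - d"
  using f
proof (induction "degree f" arbitrary: f rule: less_induct)
  case less
  note PO = subring_set_poly_over[OF P]
  show ?case
  proof (cases "degree f < d")
    case True
    then show ?thesis
      using less.prems subring_setD(2)[OF PO] by (intro exI[of _ 0] bexI[of _ 0] bexI[of _ f]) auto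
  next
    case False
    define e where "e = degree f"
    define h where "h = monom (coeff f e) (e - d)"
    have h: "h \<in> poly_over P" using less.prems poly_over_monom[OF P] by (auto simp: h_def poly_over_def)
    define f' where "f' = Polynomial.smult (coeff g d) f - g * h"
    have f': "f' \<in> poly_over P" unfolding f'_def using less.prems h g
      by (intro subring_setD(4,5)[OF PO] poly_over_smult[OF P]) (auto simp: poly_over_def)
    have "degree f' < e"
    proof -
      have "coeff f' i = 0" if "i \<ge> e" for i
      proof (cases "i = e")
        case True
        have "coeff (g * h) e = coeff g d * coeff f e"
          using False by (subst mult.commute) (auto simp: h_def coeff_monom_mult e_def)
        then show ?thesis using True by (simp add: f'_def)
      next
        case False
        then have "i > e" using that by simp
        moreover have "coeff (g * h) i = 0"
          using \<open>\<not> degree f < d\<close> \<open>i > e\<close> assms(4) coeff_eq_0[of g "i - (e - d)"]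
          by (subst mult.commute) (auto simp: h_def coeff_monom_mult e_def)
        ultimately show ?thesis by (simp add: f'_def e_def coeff_eq_0)
      qed
      moreover have "e > 0" using False assms(5) by (simp add: e_def)
      ultimately show ?thesis using coeff_0_reflect_poly degree_less_if_less_eqI
        by (metis leading_coeff_0_iff not_le degree_0)
    qed
    from less.hyps[OF this[unfolded e_def] f'] obtain K q r where qr: "q \<in> poly_over P" "r \<in> poly_over P"
      "Polynomial.smult (coeff g d ^ K) f' = g * q + r" "degree r < d" "degree q \<le> degree f' - d"
      by blast
    have "Polynomial.smult (coeff g d ^ Suc K) f = Polynomial.smult (coeff g d ^ K) (f' + g * h)"
      by (simp add: f'_def mult.commute)
    also have "\<dots> = g * (q + Polynomial.smult (coeff g d ^ K) h) + r"
      using qr(3) by (simp add: smult_add_right algebra_simps)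
    finally have eq: "Polynomial.smult (coeff g d ^ Suc K) f = g * (q + Polynomial.smult (coeff g d ^ K) h) + r" .
    have "degree (Polynomial.smult (coeff g d ^ K) h) \<le> e - d"
      using degree_smult_le degree_monom_le order_trans unfolding h_def by blast
    moreover have "degree q \<le> e - d" using qr(5) \<open>degree f' < e\<close> by linarith
    ultimately have "degree (q + Polynomial.smult (coeff g d ^ K) h) \<le> degree f - d"
      using degree_add_le unfolding e_def by blast
    moreover have "q + Polynomial.smult (coeff g d ^ K) h \<in> poly_over P"
      using g by (intro subring_setD(3)[OF PO] qr poly_over_smult[OF P] subring_setD(7)[OF P] h) (simp add: poly_over_def)
    ultimately show ?thesis using eq qr(2,4) by blast
  qed
qed

text \<open>Dropping leading terms with coefficient in \<open>I\<close> changes nothing modulo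
  \<open>I\<close>, and ends at a polynomial whose degree is its degree over the quotient by
  \<open>I\<close>.\<close>

lemma poly_over_lead_coeff_notin_ideal:
  assumes P: "subring_set P" and I: "ideal_in Q I" and PQ: "P \<subseteq> Q" and f: "f \<in> poly_over P" and "\<exists>i. coeff f i \<notin> I"
  shows "\<exists>g\<in>poly_over P. degree g \<le> degree f \<and> lead_coeff g \<notin> I \<and> (\<forall>i. coeff (f - g) i \<in> I)"
  using f assms(5)
proof (induction "degree f" arbitrary: f rule: less_induct)
  case less
  have I0: "0 \<in> I" using I by (simp add: ideal_in_def)
  show ?case
  proof (cases "lead_coeff f \<in> I")
    case False
    then show ?thesis using less.prems I0 by (intro bexI[of _ f]) auto
  next
    case True
    define h where "h = f - monom (lead_coeff f) (degree f)"
    have h: "h \<in> poly_over P"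
      using less.prems(1) subring_setD(4)[OF P] subring_setD(2)[OF P] by (auto simp: h_def poly_over_def)
    obtain i where i: "coeff f i \<notin> I" using less.prems by blast
    then have "i < degree f" using True I0 coeff_eq_0 by (metis linorder_neqE_nat)
    then have ih: "coeff h i \<notin> I" using i by (simp add: h_def)
    have "degree h < degree f"
    proof -
      have "degree h \<le> degree f" unfolding h_def using degree_diff_le degree_monom_le by blast
      moreover have "coeff h (degree f) = 0" by (simp add: h_def)
      ultimately show ?thesis using ih I0 \<open>i < degree f\<close>
        by (metis coeff_0 le_neq_implies_less leading_coeff_0_iff)
    qed
    from less.hyps[OF this h] ih obtain g where g: "g \<in> poly_over P" "degree g \<le> degree h"
      "lead_coeff g \<notin> I" "\<forall>i. coeff (h - g) i \<in> I" by blast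
    have "coeff (f - g) i \<in> I" for i
    proof -
      have "coeff (f - g) i = coeff (h - g) i + (if i = degree f then lead_coeff f else 0)"
        by (simp add: h_def)
      then show ?thesis using g(4) True I I0 unfolding ideal_in_def by metis
    qed
    then show ?thesis using g \<open>degree h < degree f\<close> by (intro bexI[of _ g]) auto
  qed
qed

lemma map_poly_hom_mult:
  fixes \<phi> :: "'r::comm_ring_1 \<Rightarrow> 'k::comm_ring_1"
  assumes add: "\<And>a b. \<phi> (a + b) = \<phi> a + \<phi> b" and mult: "\<And>a b. \<phi> (a * b) = \<phi> a * \<phi> b" and 0: "\<phi> 0 = 0"
  shows "map_poly \<phi> (p * q) = map_poly \<phi> p * map_poly \<phi> q"
proof -
  have "\<phi> (sum f A) = (\<Sum>i\<in>A. \<phi> (f i))" for f and A :: "nat set"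
    by (induction A rule: infinite_finite_induct) (auto simp: add 0)
  then show ?thesis by (intro poly_eqI) (simp add: coeff_map_poly 0 coeff_mult mult)
qed

lemma map_poly_hom_add:
  fixes \<phi> :: "'r::comm_ring_1 \<Rightarrow> 'k::comm_ring_1"
  assumes add: "\<And>a b. \<phi> (a + b) = \<phi> a + \<phi> b" and 0: "\<phi> 0 = 0"
  shows "map_poly \<phi> (p + q) = map_poly \<phi> p + map_poly \<phi> q"
  by (intro poly_eqI) (simp add: coeff_map_poly add 0)

text \<open>For a finite field, one plus the product of all \<open>[:- a, 1:]\<close> has positive
  degree and takes only the value 1.\<close>

lemma infinite_alg_closed: "infinite (UNIV :: 'k::alg_closed_field set)"
proof
  assume fin: "finite (UNIV :: 'k set)"
  define p where "p = (\<Prod>a\<in>(UNIV :: 'k set). [:- a, 1:]) + 1"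
  have "degree (\<Prod>a\<in>(UNIV :: 'k set). [:- a, 1:]) = card (UNIV :: 'k set)"
    by (subst degree_prod_eq_sum_degree) auto
  moreover have "card (UNIV :: 'k set) > 0" using fin by (simp add: card_gt_0_iff)
  ultimately have "degree p > 0" unfolding p_def by (subst degree_add_eq_left) auto
  from alg_closed_imp_poly_has_root[OF this] obtain x where "poly p x = 0" by blast
  moreover have "poly p x = 1" using fin by (auto simp: p_def poly_prod)
  ultimately show False by simp
qed


text \<open>The step of the Nullstellensatz that adds one variable.  A point of the base over which the leading coefficient of a minimal equation of \<open>x\<close> and a
  multiple of \<open>s\<close> do not vanish lifts to a point where \<open>s\<close> does not vanish.\<close>

lemma prime_extension:
  fixes x :: "'r::comm_ring_1"
  assumes P: "subring_set P" and prime: "prime_in ((\<lambda>p. poly p x) ` poly_over P) I"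
    and s: "s \<in> poly_over P" "poly s x \<notin> I"
  shows "\<exists>u\<in>P - I. \<forall>\<phi> :: 'r \<Rightarrow> 'k::alg_closed_field.
    (\<forall>a b. \<phi> (a + b) = \<phi> a + \<phi> b) \<and> (\<forall>a b. \<phi> (a * b) = \<phi> a * \<phi> b) \<and>
      (\<forall>a\<in>P \<inter> I. \<phi> a = 0) \<and> \<phi> u \<noteq> 0 \<longrightarrow>
    (\<exists>c. (\<forall>p\<in>poly_over P. poly p x \<in> I \<longrightarrow> poly (map_poly \<phi> p) c = 0) \<and> poly (map_poly \<phi> s) c \<noteq> 0)"
proof -
  define Q where "Q = (\<lambda>p. poly p x) ` poly_over P"
  note PO = subring_set_poly_over[OF P]
  have Qring: "subring_set Q"
  proof -
    have "1 \<in> Q" unfolding Q_def by (intro image_eqI[of _ _ 1] subring_setD(1)[OF PO]) simp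
    moreover have "a - b \<in> Q \<and> a * b \<in> Q" if ab: "a \<in> Q" "b \<in> Q" for a b
    proof -
      from ab obtain p q where pq: "p \<in> poly_over P" "q \<in> poly_over P" "a = poly p x" "b = poly q x"
        unfolding Q_def by blast
      have "a - b = poly (p - q) x" "a * b = poly (p * q) x" using pq by simp_all
      then show ?thesis unfolding Q_def using subring_setD(4,5)[OF PO pq(1,2)] by blast
    qed
    ultimately show ?thesis unfolding subring_set_def by blast
  qed
  note QD = subring_setD[OF Qring]
  have prQ: "prime_in Q I" using prime unfolding Q_def .
  then have I: "ideal_in Q I" and one: "1 \<notin> I" unfolding prime_in_def by blast+
  have pr: "a \<in> I \<or> b \<in> I" if "a * b \<in> I" "a \<in> Q" "b \<in> Q" for a b using prQ that unfolding prime_in_def by blast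
  have I0: "0 \<in> I" and Iadd: "a \<in> I \<Longrightarrow> b \<in> I \<Longrightarrow> a + b \<in> I" and Imult: "c \<in> Q \<Longrightarrow> a \<in> I \<Longrightarrow> c * a \<in> I" for a b c
    using I unfolding ideal_in_def by auto
  have ev: "poly p x \<in> Q" if "p \<in> poly_over P" for p using that unfolding Q_def by blast
  have PQ: "P \<subseteq> Q"
  proof
    fix a assume "a \<in> P"
    then have "[:a:] \<in> poly_over P" using subring_setD(2)[OF P] by (auto simp: poly_over_def coeff_pCons split: nat.split)
    from ev[OF this] show "a \<in> Q" by simp
  qed
  have xQ: "x \<in> Q"
  proof -
    have "[:0, 1:] \<in> poly_over P" using subring_setD(1,2)[OF P] by (auto simp: poly_over_def coeff_pCons split: nat.split)
    from ev[OF this] show ?thesis by simp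
  qed
  have evI: "poly p x \<in> I" if "\<forall>i. coeff p i \<in> I" for p
    unfolding poly_altdef using that
    by (intro ideal_in_sum[OF I]) (metis Imult QD(7) xQ mult.commute)
  have lc: "lead_coeff g \<in> P" if "g \<in> poly_over P" for g using that by (simp add: poly_over_def)
  obtain i0 where i0: "coeff s i0 \<notin> I" using evI s(2) by blast
  have "\<exists>u\<in>P - I. \<forall>\<phi> :: 'r \<Rightarrow> 'k::alg_closed_field.
    (\<forall>a b. \<phi> (a + b) = \<phi> a + \<phi> b) \<longrightarrow> (\<forall>a b. \<phi> (a * b) = \<phi> a * \<phi> b) \<longrightarrow>
      (\<forall>a\<in>P \<inter> I. \<phi> a = 0) \<longrightarrow> \<phi> u \<noteq> 0 \<longrightarrow> \<phi> 0 = 0 \<longrightarrow>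
    (\<exists>c. (\<forall>p\<in>poly_over P. poly p x \<in> I \<longrightarrow> poly (map_poly \<phi> p) c = 0) \<and> poly (map_poly \<phi> s) c \<noteq> 0)"
  \<comment> \<open>The first case is \<open>x\<close> transcendental over \<open>P\<close> modulo
    \<open>I\<close>. The fibre is then a whole line, and \<open>u\<close> is a coefficient of
    \<open>s\<close> that keeps \<open>s\<close> nonzero after specialization.\<close>
  proof (cases "\<forall>p\<in>poly_over P. poly p x \<in> I \<longrightarrow> (\<forall>i. coeff p i \<in> I)")
    case True
    have sP: "coeff s i0 \<in> P" using s(1) by (simp add: poly_over_def)
    show ?thesis
    proof (intro bexI[of _ "coeff s i0"] allI impI)
      fix \<phi> :: "'r \<Rightarrow> 'k"
      assume phi: "\<forall>a\<in>P \<inter> I. \<phi> a = 0" "\<phi> (coeff s i0) \<noteq> 0" "\<phi> 0 = 0"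
      have "map_poly \<phi> s \<noteq> 0" using phi(2,3) by (metis coeff_map_poly coeff_0)
      then have "finite {c. poly (map_poly \<phi> s) c = 0}" by (rule poly_roots_finite)
      then have "{c. poly (map_poly \<phi> s) c = 0} \<noteq> UNIV" using infinite_alg_closed by metis
      then obtain c where c: "poly (map_poly \<phi> s) c \<noteq> 0" by blast
      have "map_poly \<phi> p = 0" if "p \<in> poly_over P" "poly p x \<in> I" for p
        using that True phi(1,3) by (intro poly_eqI) (auto simp: coeff_map_poly poly_over_def)
      with c show "\<exists>c. (\<forall>p\<in>poly_over P. poly p x \<in> I \<longrightarrow> poly (map_poly \<phi> p) c = 0) \<and> poly (map_poly \<phi> s) c \<noteq> 0"
        by (intro exI[of _ c]) auto
    qed (use sP i0 in auto)
  next
    case False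
    \<comment> \<open>Now \<open>x\<close> is algebraic. An element of \<open>F\<close> of least
      degree acts as minimal polynomial of \<open>x\<close> over the fraction field of
      \<open>P\<close> modulo \<open>I\<close>.\<close>
    define F where "F = {f \<in> poly_over P. poly f x \<in> I \<and> lead_coeff f \<notin> I}"
    obtain f1 where f1: "f1 \<in> poly_over P" "poly f1 x \<in> I" "\<exists>i. coeff f1 i \<notin> I" using False by blast
    have Flow: "\<exists>g\<in>F. degree g \<le> degree h" if h: "h \<in> poly_over P" "poly h x \<in> I" "\<exists>i. coeff h i \<notin> I" for h
    proof -
      obtain g where g: "g \<in> poly_over P" "degree g \<le> degree h" "lead_coeff g \<notin> I" "\<forall>i. coeff (h - g) i \<in> I"
        using poly_over_lead_coeff_notin_ideal[OF P I PQ h(1,3)] by blast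
      have "poly g x = poly h x - poly (h - g) x" by simp
      then have "poly g x \<in> I" using evI[OF g(4)] h(2) ideal_in_diff[OF Qring I] by metis
      then show ?thesis using g unfolding F_def by blast
    qed
    define d where "d = (LEAST n. \<exists>f\<in>F. degree f = n)"
    have "\<exists>f\<in>F. degree f = d" unfolding d_def
      by (rule LeastI_ex[of "\<lambda>n. \<exists>f\<in>F. degree f = n"]) (use Flow[OF f1] in blast)
    then obtain f where f: "f \<in> poly_over P" "poly f x \<in> I" "lead_coeff f \<notin> I" "degree f = d" unfolding F_def by blast
    have small: "\<forall>i. coeff h i \<in> I" if h: "h \<in> poly_over P" "poly h x \<in> I" "degree h < d" for h
    proof (rule ccontr)
      assume "\<not> (\<forall>i. coeff h i \<in> I)"
      then obtain g where g: "g \<in> F" "degree g \<le> degree h" using Flow[OF h(1,2)] by blast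
      have "d \<le> degree g" unfolding d_def using g(1) by (intro Least_le) blast
      then show False using g(2) h(3) by simp
    qed
    have d0: "d > 0"
    proof (rule ccontr)
      assume "\<not> d > 0"
      then obtain a where "f = [:a:]" using f(4) by (metis degree_eq_zeroE gr0I)
      then have "poly f x = lead_coeff f" by simp
      then show False using f by simp
    qed
    \<comment> \<open>\<open>S\<close> is the ideal generated by \<open>s\<close> and the relations
      of \<open>x\<close>. Over the fraction field it is the unit ideal, so the aim is an element of
      degree 0: a denominator-free Bezout identity \<open>a = b s\<close> modulo \<open>I\<close>
      with \<open>a \<notin> I\<close>.\<close>
    define S where "S = {g \<in> poly_over P. \<exists>b\<in>poly_over P. poly g x - poly b x * poly s x \<in> I}"
    have Slow: "\<exists>g\<in>S. degree g \<le> degree h \<and> lead_coeff g \<notin> I" if h: "h \<in> S" "\<exists>i. coeff h i \<notin> I" for h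
    proof -
      have hP: "h \<in> poly_over P" using h(1) unfolding S_def by blast
      obtain g where g: "g \<in> poly_over P" "degree g \<le> degree h" "lead_coeff g \<notin> I" "\<forall>i. coeff (h - g) i \<in> I"
        using poly_over_lead_coeff_notin_ideal[OF P I PQ hP h(2)] by blast
      obtain b where b: "b \<in> poly_over P" "poly h x - poly b x * poly s x \<in> I" using h(1) unfolding S_def by blast
      have "poly g x - poly b x * poly s x = (poly h x - poly b x * poly s x) - poly (h - g) x" by simp
      then have "poly g x - poly b x * poly s x \<in> I" using evI[OF g(4)] b(2) ideal_in_diff[OF Qring I] by metis
      then show ?thesis using g b(1) unfolding S_def by blast
    qed
    have sS: "s \<in> S" unfolding S_def using s(1) I0 subring_setD(1)[OF PO] by (auto intro!: bexI[of _ 1])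
    have fS: "f \<in> S" unfolding S_def using f(1,2) subring_setD(2)[OF PO] by (auto intro!: bexI[of _ 0])
    define e where "e = (LEAST n. \<exists>g\<in>S. lead_coeff g \<notin> I \<and> degree g = n)"
    have "\<exists>g\<in>S. lead_coeff g \<notin> I \<and> degree g = e" unfolding e_def
      by (rule LeastI_ex[of "\<lambda>n. \<exists>g\<in>S. lead_coeff g \<notin> I \<and> degree g = n"]) (use fS f(3) in blast)
    then obtain g where g: "g \<in> S" "lead_coeff g \<notin> I" "degree g = e" by blast
    have gP: "g \<in> poly_over P" using g(1) unfolding S_def by blast
    have "e \<le> d" unfolding e_def using fS f(3,4) by (intro Least_le) blast
    have Ssmall: "poly h x \<in> I" if h: "h \<in> S" "degree h < e" for h
    proof (rule evI, rule ccontr)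
      assume "\<not> (\<forall>i. coeff h i \<in> I)"
      then obtain g where g: "g \<in> S" "degree g \<le> degree h" "lead_coeff g \<notin> I" using Slow[OF h(1)] by blast
      have "e \<le> degree g" unfolding e_def using g by (intro Least_le) blast
      then show False using g(2) h(2) by simp
    qed
    have Sdiff: "Polynomial.smult a h - g * q \<in> S" if h: "h \<in> S" "a \<in> P" "q \<in> poly_over P" for a h q
    proof -
      obtain b where b: "b \<in> poly_over P" "poly h x - poly b x * poly s x \<in> I" using h(1) unfolding S_def by blast
      obtain b' where b': "b' \<in> poly_over P" "poly g x - poly b' x * poly s x \<in> I" using g(1) unfolding S_def by blast
      have "poly (Polynomial.smult a h - g * q) x - poly (Polynomial.smult a b - b' * q) x * poly s x =
        a * (poly h x - poly b x * poly s x) - poly q x * (poly g x - poly b' x * poly s x)"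
        by (simp add: algebra_simps)
      also have "\<dots> \<in> I" using h b b' PQ
          by (intro ideal_in_diff[OF Qring I, of "a * _" "poly q x * _"] Imult ev) auto
      finally show ?thesis using h b(1) b'(1) gP unfolding S_def
        by (auto intro!: bexI[of _ "Polynomial.smult a b - b' * q"] subring_setD[OF PO] poly_over_smult[OF P])
    qed
    \<comment> \<open>A remainder on division by \<open>g\<close> lies in \<open>S\<close> and has
      degree below \<open>e\<close>, so its value at \<open>x\<close> is in \<open>I\<close>.
      Dividing \<open>f\<close> thus puts \<open>g(x) q(x)\<close> into the prime \<open>I\<close>.
      If \<open>g(x)\<close> is in \<open>I\<close>, dividing \<open>s\<close> puts
      \<open>s(x)\<close> there; if \<open>q(x)\<close> is, minimality of \<open>d\<close> puts the
      coefficients of \<open>q\<close>, and then the leading coefficient of \<open>f\<close>,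
      there.\<close>
    have e0: "e = 0"
    proof (rule ccontr)
      assume "e \<noteq> 0"
      then have epos: "e > 0" by simp
      have lK: "coeff g e ^ K \<in> P" for K using lc[OF gP] g(3) subring_setD(7)[OF P] by blast
      have lKI: "coeff g e ^ K \<notin> I" for K
        using prime_in_power[OF Qring prQ, of "coeff g e"] lc[OF gP] g(2,3) PQ by blast
      obtain K q r where qr: "q \<in> poly_over P" "r \<in> poly_over P" "Polynomial.smult (coeff g e ^ K) f = g * q + r"
        "degree r < e" "degree q \<le> degree f - e" using poly_over_pseudo_division[OF P f(1) gP g(3) epos] by blast
      have "r = Polynomial.smult (coeff g e ^ K) f - g * q" using qr(3) by simp
      then have "poly r x \<in> I" using Sdiff[OF fS lK qr(1)] Ssmall qr(4) by metis
      moreover have "coeff g e ^ K * poly f x = poly g x * poly q x + poly r x"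
        using arg_cong[OF qr(3), of "\<lambda>p. poly p x"] by simp
      moreover have "coeff g e ^ K * poly f x \<in> I" using lK PQ f(2) by (intro Imult) auto
      ultimately have "poly g x * poly q x \<in> I" using ideal_in_diff[OF Qring I] by (metis add_diff_cancel_right')
      then consider "poly g x \<in> I" | "poly q x \<in> I" using pr ev[OF gP] ev[OF qr(1)] by blast
      then show False
      proof cases
        case 1
        obtain K q r where qr: "q \<in> poly_over P" "r \<in> poly_over P" "Polynomial.smult (coeff g e ^ K) s = g * q + r"
          "degree r < e" using poly_over_pseudo_division[OF P s(1) gP g(3) epos] by blast
        have "r = Polynomial.smult (coeff g e ^ K) s - g * q" using qr(3) by simp
        then have "poly r x \<in> I" using Sdiff[OF sS lK qr(1)] Ssmall qr(4) by metis
        moreover have "coeff g e ^ K * poly s x = poly q x * poly g x + poly r x"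
          using arg_cong[OF qr(3), of "\<lambda>p. poly p x"] by (simp add: mult.commute)
        ultimately have "coeff g e ^ K * poly s x \<in> I" using Iadd Imult ev[OF qr(1)] 1 by metis
        then show False using pr[of "coeff g e ^ K" "poly s x"] lK lKI PQ ev[OF s(1)] s(2) by blast
      next
        case 2
        have "degree q < d" using qr(5) f(4) epos d0 by linarith
        then have qI: "\<forall>i. coeff q i \<in> I" using small[OF qr(1) 2] by blast
        have "coeff (Polynomial.smult (coeff g e ^ K) f) d = coeff (g * q) d"
          using qr(3,4) \<open>e \<le> d\<close> by (simp add: coeff_eq_0)
        also have "\<dots> \<in> I" unfolding coeff_mult using qI gP PQ
          by (intro ideal_in_sum[OF I] Imult) (auto simp: poly_over_def)
        finally have "coeff g e ^ K * lead_coeff f \<in> I" using f(4) by simp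
        then show False using pr[of "coeff g e ^ K" "lead_coeff f"] lK lKI PQ lc[OF f(1)] f(3) by blast
      qed
    qed
    define a where "a = lead_coeff g"
    have ga: "g = [:a:]"
    proof -
      obtain a' where "g = [:a':]" using g(3) e0 degree_eq_zeroE by blast
      then show ?thesis by (simp add: a_def)
    qed
    have aP: "a \<in> P" "a \<notin> I" using lc[OF gP] g(2) unfolding a_def by auto
    obtain b where b: "b \<in> poly_over P" "a - poly b x * poly s x \<in> I" using g(1) unfolding S_def ga by auto
    \<comment> \<open>The factor \<open>lead_coeff f\<close> keeps the degree of \<open>f\<close>
      under \<open>\<phi>\<close>, so that it has a root \<open>c\<close>; the factor
      \<open>a\<close> keeps \<open>s\<close> nonzero at \<open>c\<close> by the Bezout
      identity.\<close>
    have u: "lead_coeff f * a \<in> P - I" using pr[of "lead_coeff f" a] lc[OF f(1)] f(3) aP PQ subring_setD(5)[OF P] by blast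
    show ?thesis
    proof (rule bexI[OF _ u], intro allI impI)
      fix \<phi> :: "'r \<Rightarrow> 'k"
      assume phi: "\<forall>a b. \<phi> (a + b) = \<phi> a + \<phi> b" "\<forall>a b. \<phi> (a * b) = \<phi> a * \<phi> b"
        "\<forall>a\<in>P \<inter> I. \<phi> a = 0" "\<phi> (lead_coeff f * a) \<noteq> 0" "\<phi> 0 = 0"
      define M where "M = map_poly \<phi>"
      have Mm: "M (p * q) = M p * M q" for p q unfolding M_def using phi by (intro map_poly_hom_mult) auto
      have Ma: "M (p + q) = M p + M q" for p q unfolding M_def using phi by (intro map_poly_hom_add) auto
      have Ms: "M (Polynomial.smult c p) = Polynomial.smult (\<phi> c) (M p)" for c p
        unfolding M_def using phi by (intro poly_eqI) (simp add: coeff_map_poly)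
      have fc: "\<phi> (lead_coeff f) \<noteq> 0" and ac: "\<phi> a \<noteq> 0" using phi(2,4) by auto
      have powc: "\<phi> (lead_coeff f ^ K) \<noteq> 0" for K
      proof (induction K)
        case 0
        \<comment> \<open>Since \<open>\<phi>\<close> is only assumed additive and multiplicative,
          \<open>\<phi> 1 \<noteq> 0\<close> is deduced from
          \<open>\<phi> a \<noteq> 0\<close>.\<close>
        have "\<phi> a = \<phi> 1 * \<phi> a" using phi(2) by (metis mult_1)
        then show ?case using ac by auto
      qed (use phi(2) fc in auto)
      have "coeff (M f) d \<noteq> 0" unfolding M_def using fc f(4) phi(5) by (simp add: coeff_map_poly)
      then have "degree (M f) > 0" using d0 le_degree by (metis less_le_trans)
      then obtain c where c: "poly (M f) c = 0" using alg_closed_imp_poly_has_root by blast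
      \<comment> \<open>Reduction modulo \<open>f\<close> leaves a relation of degree below
        \<open>d\<close>, whose coefficients lie in \<open>I\<close> and are killed by
        \<open>\<phi>\<close>.\<close>
      have van: "poly (M p) c = 0" if p: "p \<in> poly_over P" "poly p x \<in> I" for p
      proof -
        obtain K q r where qr: "q \<in> poly_over P" "r \<in> poly_over P" "Polynomial.smult (coeff f d ^ K) p = f * q + r"
          "degree r < d" using poly_over_pseudo_division[OF P p(1) f(1) f(4) d0] by blast
        have "poly r x = coeff f d ^ K * poly p x - poly q x * poly f x"
          using arg_cong[OF qr(3), of "\<lambda>p. poly p x"] by (simp add: mult.commute)
        also have "\<dots> \<in> I" using lc[OF f(1)] PQ f(2,4) QD(7) p(2)
          by (intro ideal_in_diff[OF Qring I] Imult ev qr(1)) auto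
        finally have "\<forall>i. coeff r i \<in> I" using small qr(2,4) by blast
        then have "M r = 0" unfolding M_def using qr(2) phi(3,5)
          by (intro poly_eqI) (auto simp: coeff_map_poly poly_over_def)
        then have "Polynomial.smult (\<phi> (coeff f d ^ K)) (M p) = M f * M q"
          using arg_cong[OF qr(3), of M] by (simp add: Ma Mm Ms)
        from arg_cong[OF this, of "\<lambda>p. poly p c"] have "\<phi> (coeff f d ^ K) * poly (M p) c = 0" using c by simp
        then show ?thesis using powc[of K] f(4) by simp
      qed
      have "poly ([:a:] - b * s) x \<in> I" using b(2) by simp
      moreover have "[:a:] - b * s \<in> poly_over P" using b(1) s(1) gP ga by (intro subring_setD(4,5)[OF PO]) auto
      ultimately have "poly (M ([:a:] - b * s)) c = 0" using van by blast
      moreover have "M ([:a:] - b * s) + M b * M s = M [:a:]"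
        using Ma[of "[:a:] - b * s" "b * s"] Mm[of b s] by simp
      moreover have "M [:a:] = [:\<phi> a:]" unfolding M_def using phi(5) by (simp add: map_poly_pCons)
      ultimately have "poly (M b) c * poly (M s) c = poly [:\<phi> a:] c"
        by (metis (no_types) add_0 poly_add poly_mult)
      then have "poly (M s) c \<noteq> 0" using ac by fastforce
      with van show "\<exists>c. (\<forall>p\<in>poly_over P. poly p x \<in> I \<longrightarrow> poly (map_poly \<phi> p) c = 0) \<and> poly (map_poly \<phi> s) c \<noteq> 0"
        unfolding M_def by blast
    qed
  qed
  moreover have "\<phi> 0 = 0" if "\<forall>a b. \<phi> (a + b) = \<phi> a + \<phi> b" for \<phi> :: "'r \<Rightarrow> 'k"
  proof -
    have "\<phi> 0 + \<phi> 0 = \<phi> 0 + 0" using that by (metis add_0_right)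
    then show ?thesis by (rule add_left_imp_eq)
  qed
  ultimately show ?thesis by (elim bexE, intro bexI[rotated]) (assumption, simp)
qed

text \<open>Functions stand in place of formal polynomials: all the rings \<open>polyfun N\<close>
  lie in one type, and a further variable means passing to a larger subset.\<close>

inductive_set polyfun :: "nat \<Rightarrow> ((nat \<Rightarrow> 'k::comm_ring_1) \<Rightarrow> 'k) set" for N where
  polyfun_const: "(\<lambda>_. c) \<in> polyfun N"
| polyfun_var: "i < N \<Longrightarrow> (\<lambda>y. y i) \<in> polyfun N"
| polyfun_add: "f \<in> polyfun N \<Longrightarrow> g \<in> polyfun N \<Longrightarrow> (\<lambda>y. f y + g y) \<in> polyfun N"
| polyfun_mult: "f \<in> polyfun N \<Longrightarrow> g \<in> polyfun N \<Longrightarrow> (\<lambda>y. f y * g y) \<in> polyfun N"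

lemma polyfun_uminus: "f \<in> polyfun N \<Longrightarrow> (\<lambda>y. - f y) \<in> polyfun N"
  using polyfun_mult[OF polyfun_const[of "- 1"]] by fastforce

lemma polyfun_diff: "f \<in> polyfun N \<Longrightarrow> g \<in> polyfun N \<Longrightarrow> (\<lambda>y. f y - g y) \<in> polyfun N"
  using polyfun_add[OF _ polyfun_uminus] by fastforce

lemma polyfun_power: "f \<in> polyfun N \<Longrightarrow> (\<lambda>y. f y ^ n) \<in> polyfun N"
  by (induction n) (auto intro: polyfun_const polyfun_mult)

lemma polyfun_sum: "(\<And>i. i \<in> A \<Longrightarrow> f i \<in> polyfun N) \<Longrightarrow> (\<lambda>y. \<Sum>i\<in>A. f i y) \<in> polyfun N"
  by (induction A rule: infinite_finite_induct) (auto intro: polyfun_const polyfun_add)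

lemma polyfun_prod: "(\<And>i. i \<in> A \<Longrightarrow> f i \<in> polyfun N) \<Longrightarrow> (\<lambda>y. \<Prod>i\<in>A. f i y) \<in> polyfun N"
  by (induction A rule: infinite_finite_induct) (auto intro: polyfun_const polyfun_mult)

lemmas polyfun_intros = polyfun.intros polyfun_uminus polyfun_diff polyfun_power polyfun_sum polyfun_prod

lemma polyfun_mono: "f \<in> polyfun N \<Longrightarrow> N \<le> N' \<Longrightarrow> f \<in> polyfun N'"
  by (induction rule: polyfun.induct) (auto intro: polyfun.intros)

lemma polyfun_cong: "f \<in> polyfun N \<Longrightarrow> (\<And>i. i < N \<Longrightarrow> y i = z i) \<Longrightarrow> f y = f z"
  by (induction rule: polyfun.induct) auto

lemma subring_set_polyfun: "subring_set (polyfun N :: ((nat \<Rightarrow> 'k::comm_ring_1) \<Rightarrow> 'k) set)"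
  unfolding subring_set_def
proof (intro conjI ballI)
  show "1 \<in> polyfun N" using polyfun_const[of 1] by (simp add: one_fun_def)
  show "f - g \<in> polyfun N" "f * g \<in> polyfun N" if "f \<in> polyfun N" "g \<in> polyfun N" for f g :: "(nat \<Rightarrow> 'k) \<Rightarrow> 'k"
    using polyfun_diff[OF that] polyfun_mult[OF that] by (simp_all add: fun_diff_def times_fun_def)
qed

lemma sum_fun_apply: "(\<Sum>i\<in>A. f i) y = (\<Sum>i\<in>A. (f i y :: 'k::comm_ring_1))"
  by (induction A rule: infinite_finite_induct) (auto simp: plus_fun_def zero_fun_def)

lemma power_fun_apply: "(f ^ n) y = (f y :: 'k::comm_ring_1) ^ n"
  by (induction n) (auto simp: times_fun_def one_fun_def)

lemma poly_fun_apply: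
  fixes p :: "('a \<Rightarrow> 'k::comm_ring_1) poly"
  shows "poly p x y = (\<Sum>i\<le>degree p. coeff p i y * x y ^ i)"
  by (simp add: poly_altdef sum_fun_apply times_fun_def power_fun_apply)

text \<open>This puts the passage from \<open>N\<close> to \<open>N + 1\<close> variables into the
  shape required by \<open>prime_extension\<close>, with the coordinate function of index
  \<open>N\<close> as \<open>x\<close>.\<close>

lemma polyfun_Suc_eq:
  "polyfun (Suc N) = (\<lambda>p. poly p (\<lambda>y. y N)) ` poly_over (polyfun N :: ((nat \<Rightarrow> 'k::comm_ring_1) \<Rightarrow> 'k) set)"
    (is "_ = ?e ` ?P")
proof (intro equalityI subsetI)
  note PO = subring_setD[OF subring_set_poly_over[OF subring_set_polyfun[of N]]]
  have const: "f \<in> ?e ` ?P" if "f \<in> polyfun N" for f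
    using that subring_setD(2)[OF subring_set_polyfun[of N]]
    by (intro image_eqI[of _ _ "[:f:]"]) (auto simp: poly_over_def coeff_pCons split: nat.split)
  fix f :: "(nat \<Rightarrow> 'k) \<Rightarrow> 'k"
  assume "f \<in> polyfun (Suc N)"
  then show "f \<in> ?e ` ?P"
  proof (induction rule: polyfun.induct)
    case (polyfun_const c)
    show ?case by (intro const polyfun.intros)
  next
    case (polyfun_var i)
    show ?case
    proof (cases "i = N")
      case True
      then show ?thesis using subring_setD(1,2)[OF subring_set_polyfun[of N]]
        by (intro image_eqI[of _ _ "[:0, 1:]"]) (auto simp: poly_over_def coeff_pCons split: nat.split)
    next
      case False
      then show ?thesis using polyfun_var by (intro const polyfun.intros) auto
    qed
  next
    case (polyfun_add f g)
    then obtain p q where "p \<in> ?P" "q \<in> ?P" "f = ?e p" "g = ?e q" by blast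
    then show ?case using PO(3) by (intro image_eqI[of _ _ "p + q"]) (auto simp: plus_fun_def)
  next
    case (polyfun_mult f g)
    then obtain p q where "p \<in> ?P" "q \<in> ?P" "f = ?e p" "g = ?e q" by blast
    then show ?case using PO(5) by (intro image_eqI[of _ _ "p * q"]) (auto simp: times_fun_def)
  qed
next
  fix f :: "(nat \<Rightarrow> 'k) \<Rightarrow> 'k"
  assume "f \<in> ?e ` ?P"
  then obtain p where p: "p \<in> ?P" "f = ?e p" by blast
  have "f = (\<lambda>y. \<Sum>i\<le>degree p. coeff p i y * y N ^ i)"
    unfolding p(2) by (intro ext) (simp add: poly_fun_apply)
  also have "\<dots> \<in> polyfun (Suc N)"
    using p(1) polyfun_mono[of _ N "Suc N"] by (intro polyfun_intros) (auto simp: poly_over_def)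
  finally show "f \<in> polyfun (Suc N)" .
qed

text \<open>The coefficients do not depend on coordinate \<open>N\<close>, so a point
  \<open>y\<close> of the base and a root \<open>c\<close> of the specialized polynomial combine to
  the point \<open>y(N := c)\<close>.\<close>

lemma poly_over_polyfun_eval:
  assumes "p \<in> poly_over (polyfun N)"
  shows "poly p (\<lambda>y. y N) (y(N := c)) = poly (map_poly (\<lambda>f. f y) p) (c :: 'k::comm_ring_1)"
proof -
  have "poly p (\<lambda>y. y N) (y(N := c)) = (\<Sum>i\<le>degree p. coeff p i (y(N := c)) * c ^ i)"
    by (simp add: poly_fun_apply)
  also have "\<dots> = (\<Sum>i\<le>degree p. coeff p i y * c ^ i)"
  proof (rule sum.cong[OF refl])
    fix i
    have "coeff p i (y(N := c)) = coeff p i y"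
      by (rule polyfun_cong[of _ N]) (use assms in \<open>auto simp: poly_over_def\<close>)
    then show "coeff p i (y(N := c)) * c ^ i = coeff p i y * c ^ i" by simp
  qed
  also have "\<dots> = (\<Sum>i\<le>degree p. coeff (map_poly (\<lambda>f. f y) p) i * c ^ i)"
    by (simp add: coeff_map_poly zero_fun_def)
  also have "\<dots> = poly (map_poly (\<lambda>f. f y) p) c"
    unfolding poly_altdef
    by (rule sum.mono_neutral_right) (auto simp: coeff_eq_0 intro!: degree_le simp: coeff_map_poly zero_fun_def)
  finally show ?thesis .
qed

text \<open>The extra function \<open>s\<close> makes the induction close: the element
  \<open>u\<close> supplied by \<open>prime_extension\<close> takes the role of \<open>s\<close> for
  the contraction of \<open>I\<close> to one variable fewer. Without variables there are only
  constants, so nothing but 0 lies in a proper ideal.\<close>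

lemma prime_polyfun_has_zero:
  fixes I :: "((nat \<Rightarrow> 'k::alg_closed_field) \<Rightarrow> 'k) set"
  assumes "prime_in (polyfun N) I" "s \<in> polyfun N" "s \<notin> I"
  shows "\<exists>y. (\<forall>i\<ge>N. y i = 0) \<and> (\<forall>h\<in>I. h y = 0) \<and> s y \<noteq> 0"
  using assms
proof (induction N arbitrary: I s)
  case 0
  have const: "f y = f z" if "f \<in> polyfun 0" for f :: "(nat \<Rightarrow> 'k) \<Rightarrow> 'k" and y z
    using polyfun_cong[OF that] by blast
  have I: "I \<subseteq> polyfun 0" "0 \<in> I" "1 \<notin> I" and m: "\<And>a b. a \<in> polyfun 0 \<Longrightarrow> b \<in> I \<Longrightarrow> a * b \<in> I"
    using "0.prems"(1) unfolding prime_in_def ideal_in_def by blast+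
  have "h (\<lambda>_. 0) = 0" if "h \<in> I" for h
  proof (rule ccontr)
    assume *: "h (\<lambda>_. 0) \<noteq> 0"
    have "(\<lambda>_. inverse (h (\<lambda>_. 0))) * h = 1"
      using * const[of h] I(1) that by (intro ext) (metis (no_types, lifting) left_inverse one_fun_def subsetD times_fun_def)
    then show False using m[OF polyfun_const that] I(3) by metis
  qed
  moreover have "s (\<lambda>_. 0) \<noteq> 0"
  proof
    assume *: "s (\<lambda>_. 0) = 0"
    have "s = 0" using const[OF "0.prems"(2), of _ "\<lambda>_. 0"] * by (intro ext) (simp add: zero_fun_def)
    then show False using I(2) "0.prems"(3) by blast
  qed
  ultimately show ?case by (intro exI[of _ "\<lambda>_. 0"]) auto
next
  case (Suc N)
  define x :: "(nat \<Rightarrow> 'k) \<Rightarrow> 'k" where "x = (\<lambda>y. y N)"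
  note Q = polyfun_Suc_eq[of N, where 'k='k, folded x_def]
  obtain p where p: "p \<in> poly_over (polyfun N)" "s = poly p x" using Suc.prems(2) unfolding Q by blast
  from prime_extension[OF subring_set_polyfun Suc.prems(1)[unfolded Q] p(1) Suc.prems(3)[unfolded p(2)], where 'k='k]
  obtain u where u: "u \<in> polyfun N - I" and ext: "\<And>\<phi> :: ((nat \<Rightarrow> 'k) \<Rightarrow> 'k) \<Rightarrow> 'k. (\<forall>a b. \<phi> (a + b) = \<phi> a + \<phi> b) \<and>
    (\<forall>a b. \<phi> (a * b) = \<phi> a * \<phi> b) \<and> (\<forall>a\<in>polyfun N \<inter> I. \<phi> a = 0) \<and> \<phi> u \<noteq> 0 \<Longrightarrow>
    (\<exists>c. (\<forall>p\<in>poly_over (polyfun N). poly p x \<in> I \<longrightarrow> poly (map_poly \<phi> p) c = 0) \<and> poly (map_poly \<phi> p) c \<noteq> 0)"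
    by blast
  have "prime_in (polyfun N) (I \<inter> polyfun N)"
  proof -
    have sub: "f \<in> polyfun (Suc N)" if "f \<in> polyfun N" for f :: "(nat \<Rightarrow> 'k) \<Rightarrow> 'k"
      using polyfun_mono[OF that, of "Suc N"] by simp
    show ?thesis
      using Suc.prems(1) subring_setD(2,3,5)[OF subring_set_polyfun[of N, where 'k='k]]
      unfolding prime_in_def ideal_in_def by (simp add: sub)
  qed
  from Suc.IH[OF this, of u] u obtain y where y: "\<forall>i\<ge>N. y i = 0" "\<forall>h\<in>I \<inter> polyfun N. h y = 0" "u y \<noteq> 0" by blast
  obtain c where c: "\<forall>p\<in>poly_over (polyfun N). poly p x \<in> I \<longrightarrow> poly (map_poly (\<lambda>f. f y) p) c = 0"
    "poly (map_poly (\<lambda>f. f y) p) c \<noteq> 0"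
    using ext[of "\<lambda>f. f y"] y by (auto simp: plus_fun_def times_fun_def)
  have "h (y(N := c)) = 0" if h: "h \<in> I" for h
  proof -
    have "h \<in> polyfun (Suc N)" using Suc.prems(1) h unfolding prime_in_def ideal_in_def by blast
    then obtain q where q: "q \<in> poly_over (polyfun N)" "h = poly q x" unfolding Q by blast
    then show ?thesis using poly_over_polyfun_eval[OF q(1), folded x_def] c(1) h by auto
  qed
  moreover have "s (y(N := c)) \<noteq> 0" using poly_over_polyfun_eval[OF p(1), folded x_def] c(2) p(2) by auto
  moreover have "\<forall>i\<ge>Suc N. (y(N := c)) i = 0" using y(1) by auto
  ultimately show ?case by blast
qed

text \<open>An ideal that is maximal among those containing \<open>J\<close> and missing all powers
  of \<open>s\<close> is prime: if \<open>a\<close> and \<open>b\<close> are outside, adjoining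
  either one captures a power of \<open>s\<close>, and the product of these powers would lie in the
  ideal as soon as \<open>a * b\<close> does.\<close>

lemma ex_prime_avoiding_powers:
  assumes P: "subring_set P" and J: "ideal_in P J" and s: "s \<in> P" "\<forall>n. s ^ n \<notin> J"
  shows "\<exists>I. prime_in P I \<and> J \<subseteq> I \<and> s \<notin> I"
proof -
  note PD = subring_setD[OF P]
  define \<A> where "\<A> = {I. ideal_in P I \<and> J \<subseteq> I \<and> (\<forall>n. s ^ n \<notin> I)}"
  have "J \<in> \<A>" using J s unfolding \<A>_def by blast
  have "\<exists>M\<in>\<A>. \<forall>X\<in>\<A>. M \<subseteq> X \<longrightarrow> X = M"
  proof (rule subset_Zorn)
    fix C assume C: "subset.chain \<A> C"
    show "\<exists>U\<in>\<A>. \<forall>X\<in>C. X \<subseteq> U"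
    proof (cases "C = {}")
      case True
      then show ?thesis using \<open>J \<in> \<A>\<close> by blast
    next
      case False
      have CA: "X \<in> \<A>" if "X \<in> C" for X using C that unfolding subset.chain_def by blast
      have CI: "ideal_in P X" if "X \<in> C" for X using CA[OF that] unfolding \<A>_def by blast
      have lin: "X \<subseteq> Y \<or> Y \<subseteq> X" if "X \<in> C" "Y \<in> C" for X Y using C that unfolding subset.chain_def by blast
      have "ideal_in P (\<Union> C)"
        unfolding ideal_in_def
      proof (intro conjI ballI)
        show "\<Union> C \<subseteq> P" "0 \<in> \<Union> C" using CI False unfolding ideal_in_def by blast+
        show "a * b \<in> \<Union> C" if "a \<in> P" "b \<in> \<Union> C" for a b using that CI unfolding ideal_in_def by blast
        show "a + b \<in> \<Union> C" if ab: "a \<in> \<Union> C" "b \<in> \<Union> C" for a b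
        proof -
          obtain X Y where "X \<in> C" "Y \<in> C" "a \<in> X" "b \<in> Y" using ab by blast
          with lin[of X Y] CI show ?thesis unfolding ideal_in_def by blast
        qed
      qed
      then have "\<Union> C \<in> \<A>" using False CA unfolding \<A>_def by blast
      then show ?thesis by blast
    qed
  qed
  then obtain I where I: "I \<in> \<A>" and max: "\<And>X. X \<in> \<A> \<Longrightarrow> I \<subseteq> X \<Longrightarrow> X = I" by blast
  have Ii: "ideal_in P I" and JI: "J \<subseteq> I" and sI: "s ^ n \<notin> I" for n using I unfolding \<A>_def by auto
  have IP: "I \<subseteq> P" and I0: "0 \<in> I" and Ia: "a \<in> I \<Longrightarrow> b \<in> I \<Longrightarrow> a + b \<in> I"
    and Im: "c \<in> P \<Longrightarrow> a \<in> I \<Longrightarrow> c * a \<in> I" for a b c using Ii unfolding ideal_in_def by auto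
  have big: "\<exists>n. \<exists>i\<in>I. \<exists>r\<in>P. s ^ n = i + r * a" if a: "a \<in> P" "a \<notin> I" for a
  proof -
    define X where "X = {i + r * a | i r. i \<in> I \<and> r \<in> P}"
    have "I \<subseteq> X" unfolding X_def using PD(2) by force
    have "a \<in> X" unfolding X_def using I0 PD(1) by force
    have "ideal_in P X"
      unfolding ideal_in_def
    proof (intro conjI ballI)
      show "X \<subseteq> P" unfolding X_def using IP a PD(3,5) by blast
      show "0 \<in> X" using \<open>I \<subseteq> X\<close> I0 by blast
    next
      fix b c assume "b \<in> X" "c \<in> X"
      then obtain i r i' r' where "b = i + r * a" "c = i' + r' * a" "i \<in> I" "r \<in> P" "i' \<in> I" "r' \<in> P"
        unfolding X_def by blast
      moreover from this have "b + c = (i + i') + (r + r') * a" by (simp add: algebra_simps)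
      ultimately show "b + c \<in> X" unfolding X_def using Ia PD(3) by blast
    next
      fix b c assume "b \<in> P" "c \<in> X"
      then obtain i r where "c = i + r * a" "i \<in> I" "r \<in> P" unfolding X_def by blast
      moreover from this have "b * c = b * i + (b * r) * a" by (simp add: algebra_simps)
      ultimately show "b * c \<in> X" unfolding X_def using Im PD(5) \<open>b \<in> P\<close> by blast
    qed
    then have "\<not> (\<forall>n. s ^ n \<notin> X)"
      using max[of X] \<open>I \<subseteq> X\<close> \<open>a \<in> X\<close> a(2) JI unfolding \<A>_def by blast
    then show ?thesis unfolding X_def by blast
  qed
  have "a \<in> I \<or> b \<in> I" if ab: "a \<in> P" "b \<in> P" "a * b \<in> I" for a b
  proof (rule ccontr)
    assume "\<not> (a \<in> I \<or> b \<in> I)"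
    then obtain n i r n' i' r' where *: "i \<in> I" "r \<in> P" "s ^ n = i + r * a" "i' \<in> I" "r' \<in> P" "s ^ n' = i' + r' * b"
      using big[OF ab(1)] big[OF ab(2)] by blast
    have "s ^ (n + n') = (i' + r' * b) * i + (r * a) * i' + (r * r') * (a * b)"
      unfolding power_add *(3,6) by (simp add: algebra_simps)
    moreover have "i' + r' * b \<in> P" "r * a \<in> P" "r * r' \<in> P" using * ab IP PD(3,5) by blast+
    ultimately have "s ^ (n + n') \<in> I" using Ia Im * ab(3) by metis
    then show False using sI by blast
  qed
  then have "prime_in P I" using Ii sI[of 0] unfolding prime_in_def by simp
  then show ?thesis using JI sI[of 1] by auto
qed

text \<open>If no power of \<open>s\<close> lies in \<open>J\<close>, some prime containing
  \<open>J\<close> avoids \<open>s\<close>, and it has a zero at which \<open>s\<close> does not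
  vanish.\<close>

theorem nullstellensatz:
  fixes J :: "((nat \<Rightarrow> 'k::alg_closed_field) \<Rightarrow> 'k) set"
  assumes J: "ideal_in (polyfun N) J" and s: "s \<in> polyfun N"
    and van: "\<And>y. (\<forall>i\<ge>N. y i = 0) \<Longrightarrow> (\<forall>h\<in>J. h y = 0) \<Longrightarrow> s y = 0"
  shows "\<exists>M. (\<lambda>y. s y ^ M) \<in> J"
proof (rule ccontr)
  assume "\<nexists>M. (\<lambda>y. s y ^ M) \<in> J"
  moreover have "s ^ n = (\<lambda>y. s y ^ n)" for n by (intro ext power_fun_apply)
  ultimately have "\<forall>n. s ^ n \<notin> J" by simp
  then obtain I where "prime_in (polyfun N) I" "J \<subseteq> I" "s \<notin> I"
    using ex_prime_avoiding_powers[OF subring_set_polyfun J s] by blast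
  then show False using prime_polyfun_has_zero[of N I s] s van by blast
qed

section \<open>Regular functions and Cech cocycles on affine sets\<close>

section \<open>Affine algebraic sets\<close>

definition zero_locus :: "nat \<Rightarrow> ((nat \<Rightarrow> 'k::field) \<Rightarrow> 'k) set \<Rightarrow> (nat \<Rightarrow> 'k) set" where
  "zero_locus N E = {y. (\<forall>i\<ge>N. y i = 0) \<and> (\<forall>e\<in>E. e y = 0)}"

text \<open>The clause \<open>z \<in> U\<close> makes openness of \<open>U\<close> in
  \<open>C\<close> part of regularity; in particular
  \<open>aff_regular N C V (\<lambda>_. 0)\<close> expresses that \<open>V\<close> is open.\<close>

definition aff_regular :: "nat \<Rightarrow> (nat \<Rightarrow> 'k::field) set \<Rightarrow> (nat \<Rightarrow> 'k) set \<Rightarrow> ((nat \<Rightarrow> 'k) \<Rightarrow> 'k) \<Rightarrow> bool" where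
  "aff_regular N C U f \<longleftrightarrow> U \<subseteq> C \<and> (\<forall>y\<in>U. \<exists>g\<in>polyfun N. \<exists>h\<in>polyfun N.
     h y \<noteq> 0 \<and> (\<forall>z\<in>C. h z \<noteq> 0 \<longrightarrow> z \<in> U \<and> f z = g z / h z))"

lemma aff_regularE:
  assumes "aff_regular N C U f" "y \<in> U"
  obtains g h where "g \<in> polyfun N" "h \<in> polyfun N" "h y \<noteq> 0"
    "\<And>z. z \<in> C \<Longrightarrow> h z \<noteq> 0 \<Longrightarrow> z \<in> U \<and> f z = g z / h z"
proof -
  have "\<exists>g\<in>polyfun N. \<exists>h\<in>polyfun N. h y \<noteq> 0 \<and> (\<forall>z\<in>C. h z \<noteq> 0 \<longrightarrow> z \<in> U \<and> f z = g z / h z)"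
    using assms unfolding aff_regular_def by simp
  then show ?thesis using that by (elim bexE conjE) simp
qed

lemma aff_regular_cong:
  assumes "aff_regular N C U f" "\<And>y. y \<in> U \<Longrightarrow> f y = g y"
  shows "aff_regular N C U g"
  using assms unfolding aff_regular_def by metis

lemma aff_regular_local:
  assumes "\<And>y. y \<in> U \<Longrightarrow> \<exists>W f'. aff_regular N C W f' \<and> y \<in> W \<and> W \<subseteq> U \<and> (\<forall>z\<in>W. f z = f' z)"
  shows "aff_regular N C U f"
  unfolding aff_regular_def
proof (intro conjI ballI)
  show "U \<subseteq> C" using assms unfolding aff_regular_def by blast
  fix y assume "y \<in> U"
  then obtain W f' where W: "aff_regular N C W f'" "y \<in> W" "W \<subseteq> U" "\<forall>z\<in>W. f z = f' z" using assms by blast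
  show "\<exists>g\<in>polyfun N. \<exists>h\<in>polyfun N. h y \<noteq> 0 \<and> (\<forall>z\<in>C. h z \<noteq> 0 \<longrightarrow> z \<in> U \<and> f z = g z / h z)"
    by (rule aff_regularE[OF W(1,2)]) (use W(3,4) in \<open>metis subsetD\<close>)
qed

lemma aff_regular_add:
  assumes "aff_regular N C U f" "aff_regular N C V g"
  shows "aff_regular N C (U \<inter> V) (\<lambda>y. f y + g y)"
  unfolding aff_regular_def
proof (intro conjI ballI)
  show "U \<inter> V \<subseteq> C" using assms unfolding aff_regular_def by blast
  fix y assume y: "y \<in> U \<inter> V"
  obtain a h where 1: "a \<in> polyfun N" "h \<in> polyfun N" "h y \<noteq> 0" "\<And>z. z \<in> C \<Longrightarrow> h z \<noteq> 0 \<Longrightarrow> z \<in> U \<and> f z = a z / h z"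
    using y by (blast intro: aff_regularE[OF assms(1)])
  obtain b k where 2: "b \<in> polyfun N" "k \<in> polyfun N" "k y \<noteq> 0" "\<And>z. z \<in> C \<Longrightarrow> k z \<noteq> 0 \<Longrightarrow> z \<in> V \<and> g z = b z / k z"
    using y by (blast intro: aff_regularE[OF assms(2)])
  show "\<exists>c\<in>polyfun N. \<exists>l\<in>polyfun N. l y \<noteq> 0 \<and> (\<forall>z\<in>C. l z \<noteq> 0 \<longrightarrow> z \<in> U \<inter> V \<and> f z + g z = c z / l z)"
    using 1 2 by (intro bexI[of _ "\<lambda>z. a z * k z + b z * h z"] bexI[of _ "\<lambda>z. h z * k z"] polyfun_intros)
      (auto simp: add_frac_eq)
qed

lemma aff_regular_mult:
  assumes "aff_regular N C U f" "aff_regular N C V g"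
  shows "aff_regular N C (U \<inter> V) (\<lambda>y. f y * g y)"
  unfolding aff_regular_def
proof (intro conjI ballI)
  show "U \<inter> V \<subseteq> C" using assms unfolding aff_regular_def by blast
  fix y assume y: "y \<in> U \<inter> V"
  obtain a h where 1: "a \<in> polyfun N" "h \<in> polyfun N" "h y \<noteq> 0" "\<And>z. z \<in> C \<Longrightarrow> h z \<noteq> 0 \<Longrightarrow> z \<in> U \<and> f z = a z / h z"
    using y by (blast intro: aff_regularE[OF assms(1)])
  obtain b k where 2: "b \<in> polyfun N" "k \<in> polyfun N" "k y \<noteq> 0" "\<And>z. z \<in> C \<Longrightarrow> k z \<noteq> 0 \<Longrightarrow> z \<in> V \<and> g z = b z / k z"
    using y by (blast intro: aff_regularE[OF assms(2)])
  show "\<exists>c\<in>polyfun N. \<exists>l\<in>polyfun N. l y \<noteq> 0 \<and> (\<forall>z\<in>C. l z \<noteq> 0 \<longrightarrow> z \<in> U \<inter> V \<and> f z * g z = c z / l z)"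
    using 1 2 by (intro bexI[of _ "\<lambda>z. a z * b z"] bexI[of _ "\<lambda>z. h z * k z"] polyfun_intros) auto
qed

lemma aff_regular_polyfun: "p \<in> polyfun N \<Longrightarrow> aff_regular N C C p"
  unfolding aff_regular_def
  by (intro conjI ballI subset_refl, rule bexI[of _ p], rule bexI[of _ "\<lambda>_. 1"]) (auto intro: polyfun_const)

lemma aff_regular_inverse: "p \<in> polyfun N \<Longrightarrow> aff_regular N C {y \<in> C. p y \<noteq> 0} (\<lambda>y. 1 / p y)"
  unfolding aff_regular_def
  by (intro conjI ballI, blast, rule bexI[of _ "\<lambda>_. 1"], rule bexI[of _ p]) (auto intro: polyfun_const)

lemma aff_regular_uminus: "aff_regular N C U f \<Longrightarrow> aff_regular N C U (\<lambda>y. - f y)"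
  using aff_regular_mult[OF aff_regular_polyfun[OF polyfun_const[of "- 1"]], where C = C and V = U and g = f and N = N]
  by (simp add: aff_regular_def Int_absorb1)

lemma aff_regular_diff:
  "aff_regular N C U f \<Longrightarrow> aff_regular N C V g \<Longrightarrow> aff_regular N C (U \<inter> V) (\<lambda>y. f y - g y)"
  using aff_regular_add[OF _ aff_regular_uminus] by fastforce

text \<open>Adding \<open>0 * g\<close> leaves the values alone and cuts the domain down to
  \<open>V\<close>, whose openness is known through \<open>g\<close>.\<close>

lemma aff_regular_restrict:
  "aff_regular N C U f \<Longrightarrow> aff_regular N C V g \<Longrightarrow> aff_regular N C (U \<inter> V) f"
  using aff_regular_add[of N C U f V "\<lambda>y. 0 * g y"]
    aff_regular_mult[OF aff_regular_polyfun[OF polyfun_const[of 0]], where C = C and V = V and g = g and N = N]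
  by (simp add: aff_regular_def Int_absorb1)

text \<open>An empty sum is regular only if \<open>U\<close> is open; this is what \<open>f0\<close>
  certifies, through \<open>f0 - f0\<close>.\<close>

lemma aff_regular_sum:
  assumes "aff_regular N C U f0" "\<And>i. i \<in> A \<Longrightarrow> aff_regular N C U (f i)"
  shows "aff_regular N C U (\<lambda>y. \<Sum>i\<in>A. f i y)"
  using assms(2)
proof (induction A rule: infinite_finite_induct)
  case (insert a A)
  then show ?case using aff_regular_add[of N C U "f a" U] by simp
qed (use aff_regular_diff[OF assms(1) assms(1)] in auto)

text \<open>The polynomials \<open>h\<close> for which \<open>f * h\<close> is polynomial on
  \<open>s \<noteq> 0\<close> form an ideal. Its zeros lie in \<open>C\<close> and, by the local
  quotients, outside \<open>s \<noteq> 0\<close>, so the Nullstellensatz puts a power of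
  \<open>s\<close> into it.\<close>

lemma aff_regular_principal_open:
  fixes f :: "(nat \<Rightarrow> 'k::alg_closed_field) \<Rightarrow> 'k"
  assumes C: "C = zero_locus N E" "E \<subseteq> polyfun N" and s: "s \<in> polyfun N"
    and f: "aff_regular N C {y \<in> C. s y \<noteq> 0} f"
  shows "\<exists>M. \<exists>a\<in>polyfun N. \<forall>y\<in>C. s y \<noteq> 0 \<longrightarrow> f y * s y ^ M = a y"
proof -
  define J where "J = {h \<in> polyfun N. \<exists>g\<in>polyfun N. \<forall>z\<in>C. s z \<noteq> 0 \<longrightarrow> f z * h z = g z}"
  have "ideal_in (polyfun N) J"
    unfolding ideal_in_def
  proof (intro conjI ballI)
    show "J \<subseteq> polyfun N" unfolding J_def by blast
    show "0 \<in> J" unfolding J_def using subring_setD(2)[OF subring_set_polyfun] by (auto simp: zero_fun_def)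
    show "a + b \<in> J" if ab: "a \<in> J" "b \<in> J" for a b
    proof -
      obtain g g' where "g \<in> polyfun N" "g' \<in> polyfun N" "\<forall>z\<in>C. s z \<noteq> 0 \<longrightarrow> f z * a z = g z"
        "\<forall>z\<in>C. s z \<noteq> 0 \<longrightarrow> f z * b z = g' z" using ab unfolding J_def by blast
      then show ?thesis using ab unfolding J_def plus_fun_def
        by (auto intro!: polyfun_intros bexI[of _ "\<lambda>z. g z + g' z"] simp: distrib_left)
    qed
    show "a * b \<in> J" if ab: "a \<in> polyfun N" "b \<in> J" for a b
    proof -
      obtain g where "g \<in> polyfun N" "\<forall>z\<in>C. s z \<noteq> 0 \<longrightarrow> f z * b z = g z" using ab unfolding J_def by blast
      then show ?thesis using ab unfolding J_def times_fun_def
        by (auto intro!: polyfun_intros bexI[of _ "\<lambda>z. a z * g z"] simp: mult.left_commute)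
    qed
  qed
  moreover have "s y = 0" if y: "\<forall>i\<ge>N. y i = 0" "\<forall>h\<in>J. h y = 0" for y
  proof (rule ccontr)
    assume sy: "s y \<noteq> 0"
    have "e \<in> J" if "e \<in> E" for e
      using that C unfolding J_def zero_locus_def by (auto intro!: bexI[of _ "\<lambda>_. 0"] polyfun_const)
    then have yC: "y \<in> C" unfolding C(1) zero_locus_def using y by blast
    obtain g h where gh: "g \<in> polyfun N" "h \<in> polyfun N" "h y \<noteq> 0"
      "\<And>z. z \<in> C \<Longrightarrow> h z \<noteq> 0 \<Longrightarrow> z \<in> {y \<in> C. s y \<noteq> 0} \<and> f z = g z / h z"
      by (rule aff_regularE[OF f, of y]) (use yC sy in auto)
    \<comment> \<open>The square is taken because \<open>f = g / h\<close> says nothing where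
      \<open>h = 0\<close>; the identity between \<open>f\<close> times the square and
      \<open>g * h\<close> holds there as well.\<close>
    have "(\<lambda>z. h z * h z) \<in> J" unfolding J_def
    proof (intro CollectI conjI bexI[of _ "\<lambda>z. g z * h z"] ballI impI polyfun_mult gh(1,2))
      fix z assume "z \<in> C"
      then show "f z * (h z * h z) = g z * h z" using gh(4)[of z] by (cases "h z = 0") auto
    qed
    then show False using y(2) gh(3) by fastforce
  qed
  ultimately obtain M where "(\<lambda>y. s y ^ M) \<in> J" using nullstellensatz[OF _ s] by blast
  then show ?thesis unfolding J_def by blast
qed

text \<open>The functions that are combinations of the \<open>s x\<close> on \<open>C\<close> form
  an ideal without zeros, which therefore contains 1. The equations \<open>E\<close> belong to it as
  empty combinations.\<close>

lemma polyfun_partition_of_unity: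
  fixes s :: "'i \<Rightarrow> (nat \<Rightarrow> 'k::alg_closed_field) \<Rightarrow> 'k"
  assumes C: "C = zero_locus N E" "E \<subseteq> polyfun N" and s: "\<And>x. x \<in> X \<Longrightarrow> s x \<in> polyfun N"
    and cover: "\<And>y. y \<in> C \<Longrightarrow> \<exists>x\<in>X. s x y \<noteq> 0"
  shows "\<exists>X0 c. finite X0 \<and> X0 \<subseteq> X \<and> (\<forall>x. c x \<in> polyfun N) \<and> (\<forall>y\<in>C. (\<Sum>x\<in>X0. c x y * s x y) = 1)"
proof -
  define comb where "comb = (\<lambda>X0 c h. finite X0 \<and> X0 \<subseteq> X \<and> (\<forall>x. c x \<in> polyfun N) \<and>
    (\<forall>y\<in>C. h y = (\<Sum>x\<in>X0. c x y * s x y)))"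
  define J where "J = {h \<in> polyfun N. \<exists>X0 c. comb X0 c h}"
  have "ideal_in (polyfun N) J"
    unfolding ideal_in_def
  proof (intro conjI ballI)
    show "J \<subseteq> polyfun N" unfolding J_def by blast
    have "comb {} (\<lambda>_ _. 0) 0" unfolding comb_def by (auto simp: zero_fun_def intro: polyfun_const)
    then show "0 \<in> J" unfolding J_def using subring_setD(2)[OF subring_set_polyfun] by blast
    show "a + b \<in> J" if ab: "a \<in> J" "b \<in> J" for a b
    proof -
      obtain X0 c X1 d where *: "comb X0 c a" "comb X1 d b" using ab unfolding J_def by blast
      have "comb (X0 \<union> X1) (\<lambda>x y. (if x \<in> X0 then c x y else 0) + (if x \<in> X1 then d x y else 0)) (a + b)"
        unfolding comb_def
      proof (intro conjI ballI allI)
        fix y assume y: "y \<in> C"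
        have fin: "finite (X0 \<union> X1)" using * unfolding comb_def by blast
        have "(\<Sum>x\<in>X0. c x y * s x y) = (\<Sum>x\<in>X0 \<union> X1. (if x \<in> X0 then c x y else 0) * s x y)"
          using fin by (intro sum.mono_neutral_cong_left) auto
        moreover have "(\<Sum>x\<in>X1. d x y * s x y) = (\<Sum>x\<in>X0 \<union> X1. (if x \<in> X1 then d x y else 0) * s x y)"
          using fin by (intro sum.mono_neutral_cong_left) auto
        ultimately show "(a + b) y = (\<Sum>x\<in>X0 \<union> X1. ((if x \<in> X0 then c x y else 0) + (if x \<in> X1 then d x y else 0)) * s x y)"
          using * y unfolding comb_def plus_fun_def by (simp add: distrib_right sum.distrib)
      next
        fix x show "(\<lambda>y. (if x \<in> X0 then c x y else 0) + (if x \<in> X1 then d x y else 0)) \<in> polyfun N"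
          using * unfolding comb_def by (cases "x \<in> X0"; cases "x \<in> X1") (auto intro!: polyfun_intros)
      qed (use * in \<open>auto simp: comb_def\<close>)
      then show ?thesis unfolding J_def using ab polyfun_add[of a N b] by (auto simp: J_def plus_fun_def)
    qed
    show "a * b \<in> J" if ab: "a \<in> polyfun N" "b \<in> J" for a b
    proof -
      obtain X0 c where *: "comb X0 c b" using ab unfolding J_def by blast
      have "comb X0 (\<lambda>x y. a y * c x y) (a * b)"
        using * ab unfolding comb_def by (auto simp: times_fun_def sum_distrib_left mult.assoc intro!: polyfun_intros)
      then show ?thesis unfolding J_def using ab polyfun_mult[of a N b] by (auto simp: J_def times_fun_def)
    qed
  qed
  moreover have "(1::'k) = 0" if y: "\<forall>i\<ge>N. y i = 0" "\<forall>h\<in>J. h y = 0" for y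
  proof -
    have "comb {} (\<lambda>_ _. 0) e" if "e \<in> E" for e
      using that C unfolding comb_def zero_locus_def by (auto intro: polyfun_const)
    then have "E \<subseteq> J" unfolding J_def using C(2) by blast
    then have "y \<in> C" unfolding C(1) zero_locus_def using y by blast
    then obtain x where x: "x \<in> X" "s x y \<noteq> 0" using cover by blast
    have "comb {x} (\<lambda>_ _. 1) (s x)" unfolding comb_def using x by (auto intro: polyfun_const)
    then have "s x \<in> J" unfolding J_def using s x by blast
    then show ?thesis using y(2) x(2) by blast
  qed
  ultimately obtain M where "(\<lambda>y. 1 ^ M) \<in> J" using nullstellensatz[of N J "\<lambda>_. 1"] polyfun_const by blast
  then obtain X0 c where "comb X0 c (\<lambda>_. 1)" unfolding J_def by auto
  then show ?thesis unfolding comb_def by metis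
qed

text \<open>Partition of unity: if \<open>\<Sum>\<^sub>l b\<^sub>l s\<^sub>l\<^sup>M\<^sup>+\<^sup>1 = 1\<close> and \<open>s\<^sub>l\<^sup>M f\<^sub>l\<^sub>j\<close> extends over \<open>s\<^sub>l = 0\<close>, then
  \<open>h\<^sub>j = \<Sum>\<^sub>l b\<^sub>l s\<^sub>l\<^sup>M\<^sup>+\<^sup>1 f\<^sub>l\<^sub>j\<close> trivializes \<open>f\<close> on the sets \<open>s\<^sub>j \<noteq> 0\<close>.\<close>

theorem affine_cocycle_is_coboundary:
  fixes f :: "'i \<Rightarrow> 'i \<Rightarrow> (nat \<Rightarrow> 'k::alg_closed_field) \<Rightarrow> 'k"
  assumes C: "C = zero_locus N E" "E \<subseteq> polyfun N"
    and V: "\<And>x. x \<in> X \<Longrightarrow> aff_regular N C (V x) (\<lambda>_. 0)" and cover: "C \<subseteq> (\<Union>x\<in>X. V x)"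
    and f: "\<And>x y. x \<in> X \<Longrightarrow> y \<in> X \<Longrightarrow> aff_regular N C (V x \<inter> V y) (f x y)"
    and cocycle: "\<And>x y z P. x \<in> X \<Longrightarrow> y \<in> X \<Longrightarrow> z \<in> X \<Longrightarrow> P \<in> V x \<inter> V y \<inter> V z \<Longrightarrow> f y z P - f x z P + f x y P = 0"
  shows "\<exists>h. (\<forall>x\<in>X. aff_regular N C (V x) (h x)) \<and> (\<forall>x\<in>X. \<forall>y\<in>X. \<forall>P\<in>V x \<inter> V y. f x y P = h y P - h x P)"
proof -
  have "\<exists>x s. x \<in> X \<and> s \<in> polyfun N \<and> s y \<noteq> 0 \<and> (\<forall>z\<in>C. s z \<noteq> 0 \<longrightarrow> z \<in> V x)" if y: "y \<in> C" for y
  proof -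
    obtain x where x: "x \<in> X" "y \<in> V x" using cover y by blast
    show ?thesis by (rule aff_regularE[OF V[OF x(1)] x(2)]) (use x(1) in blast)
  qed
  then obtain \<xi> s where \<xi>: "\<And>y. y \<in> C \<Longrightarrow> \<xi> y \<in> X" and s: "\<And>y. y \<in> C \<Longrightarrow> s y \<in> polyfun N"
    and s0: "\<And>y. y \<in> C \<Longrightarrow> s y y \<noteq> 0" and sV: "\<And>y z. y \<in> C \<Longrightarrow> z \<in> C \<Longrightarrow> s y z \<noteq> 0 \<Longrightarrow> z \<in> V (\<xi> y)"
    by metis
  \<comment> \<open>The first partition of unity extracts a finite subcover; by this finiteness the
    pairs have a common exponent \<open>M\<close>.\<close>
  obtain X0 c where X0: "finite X0" "X0 \<subseteq> C" and c: "\<forall>y\<in>C. (\<Sum>x\<in>X0. c x y * s x y) = 1"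
    using polyfun_partition_of_unity[OF C, of C s] s s0 by blast
  have X0cover: "\<exists>i\<in>X0. s i y \<noteq> 0" if "y \<in> C" for y
  proof (rule ccontr)
    assume "\<not> ?thesis"
    then have "(\<Sum>x\<in>X0. c x y * s x y) = 0" by (intro sum.neutral) auto
    then show False using c that by fastforce
  qed
  have DV: "aff_regular N C {y \<in> C. s i y \<noteq> 0} (\<lambda>_. 0)" if "i \<in> C" for i
    using aff_regular_mult[OF aff_regular_inverse[OF s[OF that]] aff_regular_polyfun[OF polyfun_const[of 0]], of C]
    by (simp add: Int_absorb2)
  have "\<exists>M. \<exists>a\<in>polyfun N. \<forall>y\<in>C. s i y * s j y \<noteq> 0 \<longrightarrow> f (\<xi> i) (\<xi> j) y * (s i y * s j y) ^ M = a y"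
    if ij: "i \<in> C" "j \<in> C" for i j
  proof (rule aff_regular_principal_open[OF C polyfun_mult[OF s[OF ij(1)] s[OF ij(2)]]])
    have "aff_regular N C ((V (\<xi> i) \<inter> V (\<xi> j)) \<inter> ({y \<in> C. s i y \<noteq> 0} \<inter> {y \<in> C. s j y \<noteq> 0})) (f (\<xi> i) (\<xi> j))"
      by (rule aff_regular_restrict[OF f[OF \<xi>[OF ij(1)] \<xi>[OF ij(2)]] aff_regular_add[OF DV[OF ij(1)] DV[OF ij(2)]]])
    moreover have "(V (\<xi> i) \<inter> V (\<xi> j)) \<inter> ({y \<in> C. s i y \<noteq> 0} \<inter> {y \<in> C. s j y \<noteq> 0}) = {y \<in> C. s i y * s j y \<noteq> 0}"
      using sV ij by auto
    ultimately show "aff_regular N C {y \<in> C. s i y * s j y \<noteq> 0} (f (\<xi> i) (\<xi> j))" by simp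
  qed
  then obtain m a where a: "\<And>i j. i \<in> C \<Longrightarrow> j \<in> C \<Longrightarrow> a i j \<in> polyfun N"
    and fa: "\<And>i j y. i \<in> C \<Longrightarrow> j \<in> C \<Longrightarrow> y \<in> C \<Longrightarrow> s i y * s j y \<noteq> 0 \<Longrightarrow> f (\<xi> i) (\<xi> j) y * (s i y * s j y) ^ m i j = a i j y"
    by metis
  define M where "M = Max (insert 0 ((\<lambda>(i, j). m i j) ` (X0 \<times> X0)))"
  have mM: "m i j \<le> M" if "i \<in> X0" "j \<in> X0" for i j
    unfolding M_def using X0(1) that by (intro Max_ge) auto
  define a' where "a' = (\<lambda>i j y. a i j y * (s i y * s j y) ^ (M - m i j))"
  have a': "a' i j \<in> polyfun N" if "i \<in> X0" "j \<in> X0" for i j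
  proof -
    have "i \<in> C" "j \<in> C" using that X0(2) by auto
    then show ?thesis unfolding a'_def by (intro polyfun_mult polyfun_power a s)
  qed
  have fa': "f (\<xi> i) (\<xi> j) y * (s i y * s j y) ^ M = a' i j y"
    if "i \<in> X0" "j \<in> X0" "y \<in> C" "s i y * s j y \<noteq> 0" for i j y
  proof -
    have "f (\<xi> i) (\<xi> j) y * (s i y * s j y) ^ M = f (\<xi> i) (\<xi> j) y * (s i y * s j y) ^ (m i j + (M - m i j))"
      using mM[OF that(1,2)] by simp
    also have "\<dots> = a' i j y" unfolding power_add a'_def using fa[of i j y] that X0(2)
      by (metis mult.assoc subsetD)
    finally show ?thesis .
  qed
  obtain X1 b where X1: "finite X1" "X1 \<subseteq> X0" and b: "\<And>x. b x \<in> polyfun N"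
    and b1: "\<forall>y\<in>C. (\<Sum>x\<in>X1. b x y * s x y ^ Suc M) = 1"
  proof -
    have "\<exists>X1 b. finite X1 \<and> X1 \<subseteq> X0 \<and> (\<forall>x. b x \<in> polyfun N) \<and> (\<forall>y\<in>C. (\<Sum>x\<in>X1. b x y * s x y ^ Suc M) = 1)"
    proof (rule polyfun_partition_of_unity[OF C])
      show "(\<lambda>y. s x y ^ Suc M) \<in> polyfun N" if "x \<in> X0" for x using that X0(2) by (intro polyfun_power s) blast
      show "\<exists>x\<in>X0. s x y ^ Suc M \<noteq> 0" if "y \<in> C" for y using X0cover[OF that] by fastforce
    qed
    then show ?thesis by (elim exE conjE) (rule that, auto)
  qed
  \<comment> \<open>\<open>a' l j\<close> stands for
    \<open>f (\<xi> l) (\<xi> j) * (s l * s j) ^ M\<close>, so of the factor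
    \<open>s l ^ Suc M\<close> one \<open>s l\<close> remains. It makes the summand vanish where
    \<open>s l = 0\<close>, where nothing is known about \<open>a' l j\<close>.\<close>
  define h where "h = (\<lambda>j y. \<Sum>l\<in>X1. b l y * s l y * a' l j y * (1 / s j y ^ M))"
  have hreg: "aff_regular N C {y \<in> C. s j y \<noteq> 0} (h j)" if j: "j \<in> X0" for j
    unfolding h_def
  proof (rule aff_regular_sum)
    have jC: "j \<in> C" using j X0(2) by blast
    show "aff_regular N C {y \<in> C. s j y \<noteq> 0} (\<lambda>_. 0)" using DV jC by blast
    fix l assume l: "l \<in> X1"
    have eq: "C \<inter> {y \<in> C. s j y ^ M \<noteq> 0} \<inter> {y \<in> C. s j y \<noteq> 0} = {y \<in> C. s j y \<noteq> 0}" by auto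
    have "aff_regular N C (C \<inter> {y \<in> C. s j y ^ M \<noteq> 0} \<inter> {y \<in> C. s j y \<noteq> 0})
        (\<lambda>y. b l y * s l y * a' l j y * (1 / s j y ^ M))"
      using l X1(2) X0(2) j jC s b a'
      by (intro aff_regular_restrict[OF aff_regular_mult[OF aff_regular_polyfun aff_regular_inverse] DV[OF jC]] polyfun_intros) auto
    then show "aff_regular N C {y \<in> C. s j y \<noteq> 0} (\<lambda>y. b l y * s l y * a' l j y * (1 / s j y ^ M))"
      unfolding eq .
  qed
  have hdiff: "f (\<xi> i) (\<xi> j) y = h j y - h i y"
    if ij: "i \<in> X0" "j \<in> X0" and y: "y \<in> C" "s i y \<noteq> 0" "s j y \<noteq> 0" for i j y
  proof -
    have trm: "b l y * s l y * a' l k y * (1 / s k y ^ M) = b l y * s l y ^ Suc M * f (\<xi> l) (\<xi> k) y"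
      if "l \<in> X1" "s l y \<noteq> 0" "k \<in> X0" "s k y \<noteq> 0" for l k
    proof -
      have "a' l k y = f (\<xi> l) (\<xi> k) y * (s l y * s k y) ^ M" using fa'[of l k y] that X1(2) y(1) by auto
      then show ?thesis using that by (simp add: power_mult_distrib)
    qed
    have "h j y - h i y = (\<Sum>l\<in>X1. b l y * s l y ^ Suc M * f (\<xi> i) (\<xi> j) y)"
      unfolding h_def sum_subtractf[symmetric]
    proof (rule sum.cong[OF refl])
      fix l assume l: "l \<in> X1"
      have lC: "l \<in> C" "i \<in> C" "j \<in> C" using l ij X1(2) X0(2) by auto
      show "b l y * s l y * a' l j y * (1 / s j y ^ M) - b l y * s l y * a' l i y * (1 / s i y ^ M) =
        b l y * s l y ^ Suc M * f (\<xi> i) (\<xi> j) y"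
      proof (cases "s l y = 0")
        case False
        have "f (\<xi> i) (\<xi> j) y - f (\<xi> l) (\<xi> j) y + f (\<xi> l) (\<xi> i) y = 0"
          using cocycle[OF \<xi>[OF lC(1)] \<xi>[OF lC(2)] \<xi>[OF lC(3)]] sV lC y False by blast
        then have "f (\<xi> i) (\<xi> j) y = f (\<xi> l) (\<xi> j) y - f (\<xi> l) (\<xi> i) y" by (simp add: algebra_simps)
        then show ?thesis unfolding trm[OF l False ij(1) y(2)] trm[OF l False ij(2) y(3)] by (simp only: right_diff_distrib)
      qed simp
    qed
    also have "\<dots> = f (\<xi> i) (\<xi> j) y" using b1 y(1) by (simp flip: sum_distrib_right)
    finally show ?thesis by simp
  qed
  define \<iota> where "\<iota> = (\<lambda>y. SOME i. i \<in> X0 \<and> s i y \<noteq> 0)"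
  have \<iota>: "\<iota> y \<in> X0" "s (\<iota> y) y \<noteq> 0" if "y \<in> C" for y
    using someI_ex[of "\<lambda>i. i \<in> X0 \<and> s i y \<noteq> 0"] X0cover[OF that] unfolding \<iota>_def by blast+
  \<comment> \<open>The functions \<open>h\<close> live on the finite refinement. On
    \<open>V x\<close> they are corrected by \<open>f (\<xi> i) x\<close>; the cocycle rule makes
    the result independent of \<open>i\<close>, so a pointwise choice \<open>\<iota>\<close> still
    gives a regular function.\<close>
  define k where "k = (\<lambda>x y. h (\<iota> y) y + f (\<xi> (\<iota> y)) x y)"
  have VC: "V x \<subseteq> C" if "x \<in> X" for x using V[OF that] unfolding aff_regular_def by blast
  have kdiff: "f x y P = k y P - k x P" if "x \<in> X" "y \<in> X" "P \<in> V x \<inter> V y" for x y P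
  proof -
    have PC: "P \<in> C" using VC that by blast
    have iC: "\<iota> P \<in> C" using \<iota>(1)[OF PC] X0(2) by blast
    have "f x y P - f (\<xi> (\<iota> P)) y P + f (\<xi> (\<iota> P)) x P = 0"
      using cocycle[OF \<xi>[OF iC] that(1,2)] that(3) sV[OF iC PC \<iota>(2)[OF PC]] by blast
    then show ?thesis unfolding k_def by (simp add: algebra_simps)
  qed
  have kreg: "aff_regular N C (V x) (k x)" if x: "x \<in> X" for x
  proof (rule aff_regular_local)
    fix y assume y: "y \<in> V x"
    then have yC: "y \<in> C" using VC x by blast
    define i where "i = \<iota> y"
    have i: "i \<in> X0" "i \<in> C" "s i y \<noteq> 0" unfolding i_def using \<iota>[OF yC] X0(2) by auto
    define W where "W = {y \<in> C. s i y \<noteq> 0} \<inter> (V (\<xi> i) \<inter> V x)"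
    have "aff_regular N C W (\<lambda>y. h i y + f (\<xi> i) x y)"
      unfolding W_def by (rule aff_regular_add[OF hreg[OF i(1)] f[OF \<xi>[OF i(2)] x]])
    moreover have "y \<in> W" unfolding W_def using y yC i sV by auto
    moreover have "k x z = h i z + f (\<xi> i) x z" if z: "z \<in> W" for z
    proof -
      have zC: "z \<in> C" "s i z \<noteq> 0" using z unfolding W_def by auto
      have jC: "\<iota> z \<in> C" using \<iota>(1)[OF zC(1)] X0(2) by blast
      have "f (\<xi> i) x z - f (\<xi> (\<iota> z)) x z + f (\<xi> (\<iota> z)) (\<xi> i) z = 0"
        using cocycle[OF \<xi>[OF jC] \<xi>[OF i(2)] x] z sV[OF jC zC(1) \<iota>(2)[OF zC(1)]] unfolding W_def by blast
      then show ?thesis unfolding k_def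
        using hdiff[OF \<iota>(1)[OF zC(1)] i(1) zC(1) \<iota>(2)[OF zC(1)] zC(2)] by (simp add: algebra_simps)
    qed
    ultimately show "\<exists>W f'. aff_regular N C W f' \<and> y \<in> W \<and> W \<subseteq> V x \<and> (\<forall>z\<in>W. k x z = f' z)"
      unfolding W_def by blast
  qed
  show ?thesis using kreg kdiff by blast
qed

section \<open>Cech cohomology of a projective set with two affine charts\<close>

section \<open>Projective algebraic sets covered by two charts\<close>

subsection \<open>Forms\<close>

text \<open>Products and sums of forms repeat exponent vectors, whereas \<open>homog_poly\<close>
  sums over a set of them; coefficients of equal exponents are therefore collected.\<close>

lemma homog_poly_sumI:
  assumes "finite K" "\<And>k. k \<in> K \<Longrightarrow> (\<Sum>i\<le>t. e k i) = d"
  shows "homog_poly t d (\<lambda>y. \<Sum>k\<in>K. c k * (\<Prod>i\<le>t. y i ^ e k i))"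
proof -
  define a where "a v = (\<Sum>k | k \<in> K \<and> e k = v. c k)" for v
  have "(\<Sum>k\<in>K. c k * (\<Prod>i\<le>t. y i ^ e k i)) = (\<Sum>v\<in>e ` K. a v * (\<Prod>i\<le>t. y i ^ v i))" for y
    unfolding a_def by (subst sum.image_gen[OF assms(1), of _ e]) (auto simp: sum_distrib_right intro!: sum.cong)
  then show ?thesis
    unfolding homog_poly_def using assms by (intro exI[of _ "e ` K"] exI[of _ a]) auto
qed

lemma homog_poly_mult:
  assumes "homog_poly t d f" "homog_poly t d' g"
  shows "homog_poly t (d + d') (\<lambda>y. f y * g y)"
proof -
  obtain E a where 1: "finite E" "\<forall>e\<in>E. (\<Sum>i\<le>t. e i) = d" "f = (\<lambda>y. \<Sum>e\<in>E. a e * (\<Prod>i\<le>t. y i ^ e i))"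
    using assms(1) unfolding homog_poly_def by blast
  obtain E' a' where 2: "finite E'" "\<forall>e\<in>E'. (\<Sum>i\<le>t. e i) = d'" "g = (\<lambda>y. \<Sum>e\<in>E'. a' e * (\<Prod>i\<le>t. y i ^ e i))"
    using assms(2) unfolding homog_poly_def by blast
  have eq: "(\<lambda>y. f y * g y) = (\<lambda>y. \<Sum>k\<in>E \<times> E'. (a (fst k) * a' (snd k)) * (\<Prod>i\<le>t. y i ^ (fst k i + snd k i)))"
    unfolding 1(3) 2(3) sum_product sum.cartesian_product
    by (intro ext sum.cong) (auto simp: power_add prod.distrib)
  show ?thesis unfolding eq using 1(1,2) 2(1,2) by (intro homog_poly_sumI) (auto simp: sum.distrib)
qed

lemma homog_poly_add:
  assumes "homog_poly t d f" "homog_poly t d g"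
  shows "homog_poly t d (\<lambda>y. f y + g y)"
proof -
  obtain E a where 1: "finite E" "\<forall>e\<in>E. (\<Sum>i\<le>t. e i) = d" "f = (\<lambda>y. \<Sum>e\<in>E. a e * (\<Prod>i\<le>t. y i ^ e i))"
    using assms(1) unfolding homog_poly_def by blast
  obtain E' a' where 2: "finite E'" "\<forall>e\<in>E'. (\<Sum>i\<le>t. e i) = d" "g = (\<lambda>y. \<Sum>e\<in>E'. a' e * (\<Prod>i\<le>t. y i ^ e i))"
    using assms(2) unfolding homog_poly_def by blast
  have eq: "(\<lambda>y. f y + g y) = (\<lambda>y. \<Sum>k\<in>E <+> E'. case_sum a a' k * (\<Prod>i\<le>t. y i ^ case_sum id id k i))"
    unfolding 1(3) 2(3) using 1(1) 2(1) by (intro ext) (simp add: sum.Plus)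
  show ?thesis unfolding eq using 1(1,2) 2(1,2) by (intro homog_poly_sumI) auto
qed

lemma homog_poly_const: "homog_poly t 0 (\<lambda>_. c)"
  using homog_poly_sumI[of "{()}" "\<lambda>_ _. 0" t 0 "\<lambda>_. c"] by simp

lemma homog_poly_var:
  assumes "i \<le> t" shows "homog_poly t 1 (\<lambda>y :: nat \<Rightarrow> 'a::field. y i)"
proof -
  have "(\<Prod>j\<le>t. y j ^ (if j = i then 1 else 0)) = y i" for y :: "nat \<Rightarrow> 'a"
  proof -
    have "(\<Prod>j\<le>t. y j ^ (if j = i then 1 else 0)) = (\<Prod>j\<in>{i}. y j)"
      using assms by (intro prod.mono_neutral_cong_right) auto
    then show ?thesis by simp
  qed
  then have "(\<lambda>y::nat \<Rightarrow> 'a. y i) = (\<lambda>y. \<Sum>k\<in>{()}. 1 * (\<Prod>j\<le>t. y j ^ (if j = i then 1 else 0)))"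
    by simp
  moreover have "homog_poly t 1 (\<lambda>y::nat \<Rightarrow> 'a. \<Sum>k\<in>{()}. 1 * (\<Prod>j\<le>t. y j ^ (if j = i then 1 else 0)))"
    using assms by (intro homog_poly_sumI) auto
  ultimately show ?thesis by (simp only:)
qed

lemma homog_poly_power: "homog_poly t d f \<Longrightarrow> homog_poly t (n * d) (\<lambda>y. f y ^ n)"
  by (induction n) (auto intro: homog_poly_const homog_poly_mult)

lemma homog_poly_scale:
  assumes "homog_poly t d f" shows "f (\<lambda>i. c * y i) = c ^ d * f y"
proof -
  obtain E a where 1: "\<forall>e\<in>E. (\<Sum>i\<le>t. e i) = d" "f = (\<lambda>y. \<Sum>e\<in>E. a e * (\<Prod>i\<le>t. y i ^ e i))"
    using assms(1) unfolding homog_poly_def by blast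
  show ?thesis unfolding 1(2) sum_distrib_left
  proof (rule sum.cong[OF refl])
    fix e assume "e \<in> E"
    then have "(\<Prod>i\<le>t. c ^ e i) = c ^ d" using 1(1) by (simp flip: power_sum)
    then show "a e * (\<Prod>i\<le>t. (c * y i) ^ e i) = c ^ d * (a e * (\<Prod>i\<le>t. y i ^ e i))"
      by (simp add: power_mult_distrib prod.distrib)
  qed
qed

lemma homog_poly_polyfun: "homog_poly t d f \<Longrightarrow> f \<in> polyfun (Suc t)"
  unfolding homog_poly_def by (elim exE conjE) (auto intro!: polyfun_intros)

text \<open>Powers of the coordinate \<open>y i\<close> equalize the degrees of two summands and are
  invisible where \<open>y i = 1\<close>.\<close>

lemma polyfun_homogenize:
  fixes f :: "(nat \<Rightarrow> 'k::field) \<Rightarrow> 'k"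
  assumes "f \<in> polyfun (Suc t)" "i \<le> t"
  shows "\<exists>d F. homog_poly t d F \<and> (\<forall>y. y i = 1 \<longrightarrow> F y = f y)"
  using assms(1)
proof (induction rule: polyfun.induct)
  case (polyfun_const c)
  show ?case using homog_poly_const by blast
next
  case (polyfun_var j)
  then show ?case using homog_poly_var[of j t] by fastforce
next
  case (polyfun_add f g)
  then obtain d F d' G where *: "homog_poly t d F" "\<forall>y. y i = 1 \<longrightarrow> F y = f y"
    "homog_poly t d' G" "\<forall>y. y i = 1 \<longrightarrow> G y = g y" by blast
  have H: "homog_poly t (d + d') (\<lambda>y. F y * y i ^ d' + G y * y i ^ d)"
    using homog_poly_mult[OF *(1) homog_poly_power[OF homog_poly_var[OF assms(2)], of d']]
      homog_poly_mult[OF *(3) homog_poly_power[OF homog_poly_var[OF assms(2)], of d]]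
    by (intro homog_poly_add) (simp_all add: add.commute)
  show ?case by (rule exI, rule exI, rule conjI, rule H) (use *(2,4) in auto)
next
  case (polyfun_mult f g)
  then obtain d F d' G where *: "homog_poly t d F" "\<forall>y. y i = 1 \<longrightarrow> F y = f y"
    "homog_poly t d' G" "\<forall>y. y i = 1 \<longrightarrow> G y = g y" by blast
  show ?case by (rule exI, rule exI, rule conjI, rule homog_poly_mult[OF *(1,3)]) (use *(2,4) in auto)
qed

subsection \<open>Regular functions on projective algebraic sets\<close>

lemma proj_open_Int:
  assumes "proj_open t Y U" "proj_open t Y V" shows "proj_open t Y (U \<inter> V)"
proof -
  obtain T where T: "\<forall>g\<in>T. \<exists>d. homog_poly t d g" "U = {P \<in> Y. \<exists>g\<in>T. \<forall>y\<in>P. g y \<noteq> 0}"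
    using assms(1) unfolding proj_open_def by blast
  obtain T' where T': "\<forall>g\<in>T'. \<exists>d. homog_poly t d g" "V = {P \<in> Y. \<exists>g\<in>T'. \<forall>y\<in>P. g y \<noteq> 0}"
    using assms(2) unfolding proj_open_def by blast
  show ?thesis unfolding proj_open_def
  proof (intro exI[of _ "{\<lambda>y. g y * h y | g h. g \<in> T \<and> h \<in> T'}"] conjI ballI)
    show "U \<inter> V = {P \<in> Y. \<exists>g\<in>{\<lambda>y. g y * h y | g h. g \<in> T \<and> h \<in> T'}. \<forall>y\<in>P. g y \<noteq> 0}"
    proof (intro equalityI subsetI)
      fix P assume "P \<in> U \<inter> V"
      then obtain g h where "g \<in> T" "h \<in> T'" "P \<in> Y" "\<forall>y\<in>P. g y \<noteq> 0" "\<forall>y\<in>P. h y \<noteq> 0"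
        unfolding T(2) T'(2) by blast
      then show "P \<in> {P \<in> Y. \<exists>g\<in>{\<lambda>y. g y * h y | g h. g \<in> T \<and> h \<in> T'}. \<forall>y\<in>P. g y \<noteq> 0}"
        by (intro CollectI conjI bexI[of _ "\<lambda>y. g y * h y"]) auto
    next
      fix P assume "P \<in> {P \<in> Y. \<exists>g\<in>{\<lambda>y. g y * h y | g h. g \<in> T \<and> h \<in> T'}. \<forall>y\<in>P. g y \<noteq> 0}"
      then obtain g h where "g \<in> T" "h \<in> T'" "P \<in> Y" "\<forall>y\<in>P. g y * h y \<noteq> 0" by blast
      then show "P \<in> U \<inter> V" unfolding T(2) T'(2) by auto
    qed
    fix g assume "g \<in> {\<lambda>y. g y * h y | g h. g \<in> T \<and> h \<in> T'}"
    then show "\<exists>d. homog_poly t d g" using T(1) T'(1) homog_poly_mult by blast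
  qed
qed

lemma proj_open_form: "homog_poly t d g \<Longrightarrow> proj_open t Y {P \<in> Y. \<forall>y\<in>P. g y \<noteq> 0}"
  unfolding proj_open_def by (intro exI[of _ "{g}"]) auto

lemma regular_onE:
  assumes "regular_on t Y U f" "P \<in> U"
  obtains V d g h where "proj_open t Y V" "P \<in> V" "V \<subseteq> U" "homog_poly t d g" "homog_poly t d h"
    "\<And>Q y. Q \<in> V \<Longrightarrow> y \<in> Q \<Longrightarrow> h y \<noteq> 0 \<and> f Q = g y / h y"
proof -
  have "\<exists>V d g h. proj_open t Y V \<and> P \<in> V \<and> V \<subseteq> U \<and> homog_poly t d g \<and> homog_poly t d h \<and>
        (\<forall>Q\<in>V. \<forall>y\<in>Q. h y \<noteq> 0 \<and> f Q = g y / h y)"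
    using assms unfolding regular_on_def by simp
  then show ?thesis using that by (elim exE conjE) simp
qed

lemma regular_on_add:
  assumes "regular_on t Y U f" "regular_on t Y U g"
  shows "regular_on t Y U (\<lambda>P. f P + g P)"
  unfolding regular_on_def
proof
  fix P assume P: "P \<in> U"
  obtain V d a h where 1: "proj_open t Y V" "P \<in> V" "V \<subseteq> U" "homog_poly t d a" "homog_poly t d h"
    "\<And>Q y. Q \<in> V \<Longrightarrow> y \<in> Q \<Longrightarrow> h y \<noteq> 0 \<and> f Q = a y / h y" using regular_onE[OF assms(1) P] by metis
  obtain V' d' a' h' where 2: "proj_open t Y V'" "P \<in> V'" "V' \<subseteq> U" "homog_poly t d' a'" "homog_poly t d' h'"
    "\<And>Q y. Q \<in> V' \<Longrightarrow> y \<in> Q \<Longrightarrow> h' y \<noteq> 0 \<and> g Q = a' y / h' y" using regular_onE[OF assms(2) P] by metis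
  show "\<exists>V d c h. proj_open t Y V \<and> P \<in> V \<and> V \<subseteq> U \<and> homog_poly t d c \<and> homog_poly t d h \<and>
      (\<forall>Q\<in>V. \<forall>y\<in>Q. h y \<noteq> 0 \<and> f Q + g Q = c y / h y)"
  proof (intro exI conjI)
    show "proj_open t Y (V \<inter> V')" by (rule proj_open_Int[OF 1(1) 2(1)])
    show "homog_poly t (d + d') (\<lambda>y. a y * h' y + h y * a' y)"
      by (rule homog_poly_add[OF homog_poly_mult[OF 1(4) 2(5)] homog_poly_mult[OF 1(5) 2(4)]])
    show "homog_poly t (d + d') (\<lambda>y. h y * h' y)" by (rule homog_poly_mult[OF 1(5) 2(5)])
    show "\<forall>Q\<in>V \<inter> V'. \<forall>y\<in>Q. h y * h' y \<noteq> 0 \<and> f Q + g Q = (a y * h' y + h y * a' y) / (h y * h' y)"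
    proof (intro ballI)
      fix Q y assume "Q \<in> V \<inter> V'" "y \<in> Q"
      then show "h y * h' y \<noteq> 0 \<and> f Q + g Q = (a y * h' y + h y * a' y) / (h y * h' y)"
        using 1(6)[of Q y] 2(6)[of Q y] by (simp add: add_frac_eq mult.commute)
    qed
  qed (use 1(2,3) 2(2) in auto)
qed

lemma regular_on_mult:
  assumes "regular_on t Y U f" "regular_on t Y U g"
  shows "regular_on t Y U (\<lambda>P. f P * g P)"
  unfolding regular_on_def
proof
  fix P assume P: "P \<in> U"
  obtain V d a h where 1: "proj_open t Y V" "P \<in> V" "V \<subseteq> U" "homog_poly t d a" "homog_poly t d h"
    "\<And>Q y. Q \<in> V \<Longrightarrow> y \<in> Q \<Longrightarrow> h y \<noteq> 0 \<and> f Q = a y / h y" using regular_onE[OF assms(1) P] by metis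
  obtain V' d' a' h' where 2: "proj_open t Y V'" "P \<in> V'" "V' \<subseteq> U" "homog_poly t d' a'" "homog_poly t d' h'"
    "\<And>Q y. Q \<in> V' \<Longrightarrow> y \<in> Q \<Longrightarrow> h' y \<noteq> 0 \<and> g Q = a' y / h' y" using regular_onE[OF assms(2) P] by metis
  show "\<exists>V d c h. proj_open t Y V \<and> P \<in> V \<and> V \<subseteq> U \<and> homog_poly t d c \<and> homog_poly t d h \<and>
      (\<forall>Q\<in>V. \<forall>y\<in>Q. h y \<noteq> 0 \<and> f Q * g Q = c y / h y)"
  proof (intro exI conjI)
    show "proj_open t Y (V \<inter> V')" by (rule proj_open_Int[OF 1(1) 2(1)])
    show "homog_poly t (d + d') (\<lambda>y. a y * a' y)" by (rule homog_poly_mult[OF 1(4) 2(4)])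
    show "homog_poly t (d + d') (\<lambda>y. h y * h' y)" by (rule homog_poly_mult[OF 1(5) 2(5)])
    show "\<forall>Q\<in>V \<inter> V'. \<forall>y\<in>Q. h y * h' y \<noteq> 0 \<and> f Q * g Q = (a y * a' y) / (h y * h' y)"
    proof (intro ballI)
      fix Q y assume "Q \<in> V \<inter> V'" "y \<in> Q"
      then show "h y * h' y \<noteq> 0 \<and> f Q * g Q = (a y * a' y) / (h y * h' y)"
        using 1(6)[of Q y] 2(6)[of Q y] by simp
    qed
  qed (use 1(2,3) 2(2) in auto)
qed

lemma regular_on_const:
  assumes "proj_open t Y U" shows "regular_on t Y U (\<lambda>_. c)"
  unfolding regular_on_def
  using assms by (intro ballI exI[of _ U] exI[of _ 0] exI[of _ "\<lambda>_. c"] exI[of _ "\<lambda>_. 1"]) (auto intro: homog_poly_const)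

lemma regular_on_power: "proj_open t Y U \<Longrightarrow> regular_on t Y U f \<Longrightarrow> regular_on t Y U (\<lambda>P. f P ^ n)"
  by (induction n) (auto intro: regular_on_const regular_on_mult)

lemma regular_on_cmult: "proj_open t Y U \<Longrightarrow> regular_on t Y U f \<Longrightarrow> regular_on t Y U (\<lambda>P. c * f P)"
  by (intro regular_on_mult regular_on_const)

lemma regular_on_diff:
  "proj_open t Y U \<Longrightarrow> regular_on t Y U f \<Longrightarrow> regular_on t Y U g \<Longrightarrow> regular_on t Y U (\<lambda>P. f P - g P)"
  using regular_on_add[OF _ regular_on_cmult[of t Y U g "- 1"]] by simp

lemma regular_on_sum:
  "proj_open t Y U \<Longrightarrow> (\<And>i. i \<in> A \<Longrightarrow> regular_on t Y U (f i)) \<Longrightarrow> regular_on t Y U (\<lambda>P. \<Sum>i\<in>A. f i P)"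
  by (induction A rule: infinite_finite_induct) (auto intro: regular_on_const regular_on_add)

lemma regular_on_local:
  assumes "\<And>P. P \<in> U \<Longrightarrow> \<exists>W f'. regular_on t Y W f' \<and> P \<in> W \<and> W \<subseteq> U \<and> (\<forall>Q\<in>W. f Q = f' Q)"
  shows "regular_on t Y U f"
  unfolding regular_on_def
proof
  fix P assume "P \<in> U"
  then obtain W f' where W: "regular_on t Y W f'" "P \<in> W" "W \<subseteq> U" "\<forall>Q\<in>W. f Q = f' Q" using assms by metis
  obtain V d a h where 1: "proj_open t Y V" "P \<in> V" "V \<subseteq> W" "homog_poly t d a" "homog_poly t d h"
    "\<And>Q y. Q \<in> V \<Longrightarrow> y \<in> Q \<Longrightarrow> h y \<noteq> 0 \<and> f' Q = a y / h y" using regular_onE[OF W(1,2)] by metis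
  then show "\<exists>V d g h. proj_open t Y V \<and> P \<in> V \<and> V \<subseteq> U \<and> homog_poly t d g \<and> homog_poly t d h \<and>
      (\<forall>Q\<in>V. \<forall>y\<in>Q. h y \<noteq> 0 \<and> f Q = g y / h y)"
    using W(3,4) by (intro exI[of _ V] exI[of _ d] exI[of _ a] exI[of _ h]) auto
qed

lemma regular_on_cong: "regular_on t Y U f \<Longrightarrow> (\<And>P. P \<in> U \<Longrightarrow> f P = g P) \<Longrightarrow> regular_on t Y U g"
  by (rule regular_on_local) fastforce

lemma regular_on_Int:
  assumes "regular_on t Y U f" "proj_open t Y W" shows "regular_on t Y (U \<inter> W) f"
  unfolding regular_on_def
proof
  fix P assume P: "P \<in> U \<inter> W"
  obtain V d a h where 1: "proj_open t Y V" "P \<in> V" "V \<subseteq> U" "homog_poly t d a" "homog_poly t d h"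
    "\<And>Q y. Q \<in> V \<Longrightarrow> y \<in> Q \<Longrightarrow> h y \<noteq> 0 \<and> f Q = a y / h y" using regular_onE[OF assms(1), of P] P by blast
  then show "\<exists>V d g h. proj_open t Y V \<and> P \<in> V \<and> V \<subseteq> U \<inter> W \<and> homog_poly t d g \<and> homog_poly t d h \<and>
      (\<forall>Q\<in>V. \<forall>y\<in>Q. h y \<noteq> 0 \<and> f Q = g y / h y)"
    using proj_open_Int[OF 1(1) assms(2)] P
    by (intro exI[of _ "V \<inter> W"] exI[of _ d] exI[of _ a] exI[of _ h]) auto
qed

lemma regular_on_Int':
  "regular_on t Y U f \<Longrightarrow> proj_open t Y W \<Longrightarrow> V = U \<inter> W \<Longrightarrow> regular_on t Y V f"
  using regular_on_Int by blast

subsection \<open>Affine charts\<close>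

definition cls :: "(nat \<Rightarrow> 'k::field) \<Rightarrow> 'k point" where
  "cls y = {(\<lambda>i. c * y i) | c. c \<noteq> 0}"

definition normalize_at :: "nat \<Rightarrow> 'k::field point \<Rightarrow> nat \<Rightarrow> 'k" where
  "normalize_at i P = (THE y. y \<in> P \<and> y i = 1)"

definition chart :: "'k::field point set \<Rightarrow> nat \<Rightarrow> 'k point set" where
  "chart Y i = {P \<in> Y. \<forall>y\<in>P. y i \<noteq> 0}"

lemma cls_self: "y \<in> cls y"
  unfolding cls_def by (intro CollectI exI[of _ 1]) auto

lemma cls_scale:
  assumes "c \<noteq> 0" shows "cls (\<lambda>i. c * y i) = cls y"
proof (intro equalityI subsetI)
  fix z assume "z \<in> cls (\<lambda>i. c * y i)"
  then obtain d where "d \<noteq> 0" "z = (\<lambda>i. (d * c) * y i)" unfolding cls_def by (auto simp: mult.assoc)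
  then show "z \<in> cls y" unfolding cls_def using assms by (intro CollectI exI[of _ "d * c"]) auto
next
  fix z assume "z \<in> cls y"
  then obtain d where "d \<noteq> 0" "z = (\<lambda>i. d * y i)" unfolding cls_def by auto
  then show "z \<in> cls (\<lambda>i. c * y i)" unfolding cls_def using assms by (intro CollectI exI[of _ "d / c"]) auto
qed

lemma cls_eq: "z \<in> cls y \<Longrightarrow> cls z = cls y"
proof -
  assume "z \<in> cls y"
  then obtain c where "c \<noteq> 0" "z = (\<lambda>i. c * y i)" unfolding cls_def by blast
  then show "cls z = cls y" using cls_scale by blast
qed

lemma proj_spaceE:
  assumes "P \<in> proj_space t" "y \<in> P"
  shows "P = cls y" "\<And>i. i > t \<Longrightarrow> y i = 0"
proof -
  obtain z where z: "P = cls z" "\<forall>i>t. z i = 0" using assms(1) unfolding proj_space_def cls_def by blast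
  show "P = cls y" using cls_eq z(1) assms(2) by blast
  show "y i = 0" if "i > t" for i using assms(2) z(2) that unfolding z(1) cls_def by auto
qed

lemma proj_space_nonempty: "P \<in> proj_space t \<Longrightarrow> \<exists>y. y \<in> P"
  unfolding proj_space_def using cls_self unfolding cls_def by blast

lemma normalize_at:
  assumes "P \<in> proj_space t" "\<forall>y\<in>P. y i \<noteq> 0"
  shows "normalize_at i P \<in> P" "normalize_at i P i = 1" "cls (normalize_at i P) = P"
    "y \<in> P \<Longrightarrow> y i = 1 \<Longrightarrow> normalize_at i P = y"
proof -
  obtain z where z: "z \<in> P" using proj_space_nonempty[OF assms(1)] by blast
  have P: "P = cls z" using proj_spaceE[OF assms(1) z] by blast
  have zi: "z i \<noteq> 0" using assms(2) z by blast
  have un: "w = (\<lambda>j. 1 / z i * z j)" if w: "w \<in> P" "w i = 1" for w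
  proof -
    obtain c where "w = (\<lambda>j. c * z j)" using w(1) unfolding P cls_def by blast
    with w(2) have "c = 1 / z i" using zi by (simp add: field_simps)
    with \<open>w = (\<lambda>j. c * z j)\<close> show ?thesis by simp
  qed
  have mem: "(\<lambda>j. 1 / z i * z j) \<in> P" unfolding P cls_def using zi by (intro CollectI exI[of _ "1 / z i"]) auto
  have eq: "normalize_at i P = (\<lambda>j. 1 / z i * z j)"
    unfolding normalize_at_def by (rule the_equality, use mem zi in simp, use un in blast)
  show "normalize_at i P \<in> P" unfolding eq by (rule mem)
  show "normalize_at i P i = 1" unfolding eq using zi by simp
  show "cls (normalize_at i P) = P" using proj_spaceE[OF assms(1) mem] eq by simp
  show "y \<in> P \<Longrightarrow> y i = 1 \<Longrightarrow> normalize_at i P = y" unfolding eq by (rule un[symmetric])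
qed

lemma homog_poly_nonzero_class:
  assumes "homog_poly t d g" "z \<in> cls y" shows "g z \<noteq> 0 \<longleftrightarrow> g y \<noteq> 0"
  using assms homog_poly_scale[OF assms(1), of _ y] unfolding cls_def by auto

lemma homog_poly_quotient_class:
  assumes "homog_poly t d g" "homog_poly t d h" "z \<in> cls y" shows "g z / h z = g y / h y"
proof -
  obtain c where "c \<noteq> 0" "z = (\<lambda>i. c * y i)" using assms(3) unfolding cls_def by blast
  then show ?thesis using homog_poly_scale[OF assms(1), of c y] homog_poly_scale[OF assms(2), of c y] by simp
qed

text \<open>The last condition says that \<open>Y\<close> misses the linear space
  \<open>y 0 = y 1 = 0\<close>; two affine charts then cover \<open>Y\<close>, and only one overlap
  enters its cohomology.\<close>

locale two_chart =
  fixes t :: nat and F :: "((nat \<Rightarrow> 'k::alg_closed_field) \<Rightarrow> 'k) set" and Y :: "'k point set"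
  assumes t: "t \<ge> 1" and F: "\<And>e. e \<in> F \<Longrightarrow> \<exists>d. homog_poly t d e"
    and Y: "Y = {P \<in> proj_space t. \<forall>y\<in>P. \<forall>e\<in>F. e y = 0}"
    and cover: "\<And>P y. P \<in> Y \<Longrightarrow> y \<in> P \<Longrightarrow> y 0 \<noteq> 0 \<or> y 1 \<noteq> 0"
begin

text \<open>The chart \<open>i\<close> is realized as the slice \<open>y i = 1\<close> of the cone
  over \<open>Y\<close>, so that all charts keep the numbering of the coordinates.\<close>

definition eqs :: "nat \<Rightarrow> ((nat \<Rightarrow> 'k) \<Rightarrow> 'k) set" where "eqs i = insert (\<lambda>y. y i - 1) F"

definition aff :: "nat \<Rightarrow> (nat \<Rightarrow> 'k) set" where "aff i = zero_locus (Suc t) (eqs i)"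

lemma eqs_polyfun: "i \<le> t \<Longrightarrow> eqs i \<subseteq> polyfun (Suc t)"
  unfolding eqs_def using F homog_poly_polyfun by (auto intro!: polyfun_intros)

lemma chart_normalize:
  assumes "P \<in> chart Y i"
  shows "normalize_at i P \<in> aff i" "cls (normalize_at i P) = P" "normalize_at i P \<in> P"
proof -
  have P: "P \<in> proj_space t" "\<forall>y\<in>P. y i \<noteq> 0" "\<forall>y\<in>P. \<forall>e\<in>F. e y = 0" using assms unfolding chart_def Y by auto
  note n = normalize_at[OF P(1,2)]
  show "cls (normalize_at i P) = P" "normalize_at i P \<in> P" by (rule n(3), rule n(1))
  show "normalize_at i P \<in> aff i" unfolding aff_def zero_locus_def eqs_def
    using n(1,2) P(3) proj_spaceE(2)[OF P(1) n(1)] by auto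
qed

lemma aff_cls:
  assumes "y \<in> aff i"
  shows "cls y \<in> chart Y i" "normalize_at i (cls y) = y" "y i = 1"
proof -
  have y: "\<forall>j\<ge>Suc t. y j = 0" "y i = 1" "\<forall>e\<in>F. e y = 0" using assms unfolding aff_def zero_locus_def eqs_def by auto
  show "y i = 1" by (rule y(2))
  have P: "cls y \<in> proj_space t" unfolding proj_space_def cls_def
  proof (intro CollectI exI[of _ y] conjI)
    show "\<exists>i. y i \<noteq> 0" using y(2) by (intro exI[of _ i]) simp
    show "\<forall>i>t. y i = 0" using y(1) by simp
  qed (rule refl)
  have i0: "\<forall>z\<in>cls y. z i \<noteq> 0" unfolding cls_def using y(2) by auto
  have "e z = 0" if e: "z \<in> cls y" "e \<in> F" for z e
  proof -
    obtain d where "homog_poly t d e" using F e(2) by blast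
    moreover have "e y = 0" using y(3) e(2) by blast
    ultimately show ?thesis using homog_poly_nonzero_class e(1) by metis
  qed
  then show "cls y \<in> chart Y i" unfolding chart_def Y using P i0 by blast
  show "normalize_at i (cls y) = y" by (rule normalize_at(4)[OF P i0 cls_self y(2)])
qed

lemma chart_open: "i \<le> t \<Longrightarrow> proj_open t Y (chart Y i)"
  unfolding chart_def by (rule proj_open_form[OF homog_poly_var])

lemma mem_proj_open_form:
  assumes "P \<in> Y" "y \<in> P" "homog_poly t d g" "g y \<noteq> 0"
  shows "P \<in> {P \<in> Y. \<forall>y\<in>P. g y \<noteq> 0}"
proof -
  have "P \<in> proj_space t" using assms(1) unfolding Y by blast
  then have P: "P = cls y" by (rule proj_spaceE(1)[OF _ assms(2)])
  have "g z \<noteq> 0" if "z \<in> P" for z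
    using homog_poly_nonzero_class[OF assms(3), of z y] that P assms(4) by simp
  then show ?thesis using assms(1) by simp
qed

lemma regular_on_affI:
  assumes i: "i \<le> t" and U: "U \<subseteq> chart Y i"
    and f: "aff_regular (Suc t) (aff i) {y \<in> aff i. cls y \<in> U} (\<lambda>y. f (cls y))"
  shows "regular_on t Y U f"
  unfolding regular_on_def
proof
  fix P assume P: "P \<in> U"
  define y where "y = normalize_at i P"
  have y: "y \<in> aff i" "cls y = P" unfolding y_def using chart_normalize P U by auto
  obtain g h where gh: "g \<in> polyfun (Suc t)" "h \<in> polyfun (Suc t)" "h y \<noteq> 0"
    and *: "\<And>z. z \<in> aff i \<Longrightarrow> h z \<noteq> 0 \<Longrightarrow> z \<in> {y \<in> aff i. cls y \<in> U} \<and> f (cls z) = g z / h z"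
    by (rule aff_regularE[OF f, of y]) (use y P in auto)
  obtain d G where G: "homog_poly t d G" "\<forall>y. y i = 1 \<longrightarrow> G y = g y" using polyfun_homogenize[OF gh(1) i] by blast
  obtain d' H where H: "homog_poly t d' H" "\<forall>y. y i = 1 \<longrightarrow> H y = h y" using polyfun_homogenize[OF gh(2) i] by blast
  \<comment> \<open>\<open>G\<close> and \<open>H\<close> come with unrelated degrees; exchanging
    powers of \<open>y i\<close> makes them equal without affecting the slice
    \<open>y i = 1\<close>.\<close>
  define G' where "G' = (\<lambda>y. G y * y i ^ d')"
  define H' where "H' = (\<lambda>y. H y * y i ^ d)"
  have G': "homog_poly t (d + d') G'" unfolding G'_def
    using homog_poly_mult[OF G(1) homog_poly_power[OF homog_poly_var[OF i], of d']] by simp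
  have H': "homog_poly t (d + d') H'" unfolding H'_def
    using homog_poly_mult[OF H(1) homog_poly_power[OF homog_poly_var[OF i], of d]] by (simp add: add.commute)
  \<comment> \<open>The factor \<open>y i\<close> forces \<open>V\<close> into the chart.\<close>
  define V where "V = {P \<in> Y. \<forall>y\<in>P. H' y * y i \<noteq> 0}"
  have s: "homog_poly t (d + d' + 1) (\<lambda>y. H' y * y i)" by (rule homog_poly_mult[OF H' homog_poly_var[OF i]])
  have V: "Q \<in> U \<and> (\<forall>w\<in>Q. H' w \<noteq> 0 \<and> f Q = G' w / H' w)" if Q: "Q \<in> V" for Q
  proof -
    have Qc: "Q \<in> chart Y i" using Q unfolding V_def chart_def by auto
    define z where "z = normalize_at i Q"
    have z: "z \<in> aff i" "cls z = Q" "z \<in> Q" unfolding z_def using chart_normalize[OF Qc] by auto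
    have "H' z \<noteq> 0" using Q z(3) unfolding V_def by auto
    then have hz: "h z \<noteq> 0" unfolding H'_def using H(2) aff_cls(3)[OF z(1)] by auto
    have "f Q = G' z / H' z" using *[OF z(1) hz] z(2) G(2) H(2) aff_cls(3)[OF z(1)] unfolding G'_def H'_def by auto
    moreover have "G' w / H' w = G' z / H' z" if "w \<in> Q" for w
      by (rule homog_poly_quotient_class[OF G' H']) (use that z(2) in auto)
    ultimately show ?thesis using *[OF z(1) hz] z(2) Q unfolding V_def by auto
  qed
  show "\<exists>V d g h. proj_open t Y V \<and> P \<in> V \<and> V \<subseteq> U \<and> homog_poly t d g \<and> homog_poly t d h \<and>
      (\<forall>Q\<in>V. \<forall>y\<in>Q. h y \<noteq> 0 \<and> f Q = g y / h y)"
  proof (intro exI conjI)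
    show "proj_open t Y V" unfolding V_def by (rule proj_open_form[OF s])
    show "homog_poly t (d + d') G'" "homog_poly t (d + d') H'" by (fact G', fact H')
    have "H' y * y i \<noteq> 0" unfolding H'_def using H(2) aff_cls(3)[OF y(1)] gh(3) by auto
    then show "P \<in> V" unfolding V_def
      using P U y(2) cls_self[of y] unfolding chart_def by (intro mem_proj_open_form[OF _ _ s, of _ y]) auto
  qed (use V in auto)
qed

lemma regular_on_affD:
  assumes i: "i \<le> t" and f: "regular_on t Y U f" and U: "U \<subseteq> chart Y i"
  shows "aff_regular (Suc t) (aff i) {y \<in> aff i. cls y \<in> U} (\<lambda>y. f (cls y))"
  unfolding aff_regular_def
proof (intro conjI ballI)
  fix y assume y: "y \<in> {y \<in> aff i. cls y \<in> U}"
  then have yU: "cls y \<in> U" by blast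
  obtain V d g h where V: "proj_open t Y V" "cls y \<in> V" "V \<subseteq> U" "homog_poly t d g" "homog_poly t d h"
    "\<And>Q y. Q \<in> V \<Longrightarrow> y \<in> Q \<Longrightarrow> h y \<noteq> 0 \<and> f Q = g y / h y" using regular_onE[OF f yU] by metis
  obtain s e where s: "homog_poly t e s" "\<forall>z\<in>cls y. s z \<noteq> 0" "\<And>P. P \<in> Y \<Longrightarrow> \<forall>z\<in>P. s z \<noteq> 0 \<Longrightarrow> P \<in> V"
    using V(1,2) unfolding proj_open_def by blast
  show "\<exists>g\<in>polyfun (Suc t). \<exists>h\<in>polyfun (Suc t). h y \<noteq> 0 \<and>
      (\<forall>z\<in>aff i. h z \<noteq> 0 \<longrightarrow> z \<in> {y \<in> aff i. cls y \<in> U} \<and> f (cls z) = g z / h z)"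
  \<comment> \<open>The form \<open>s\<close> cuts a principal open set out of \<open>V\<close>;
    multiplying numerator and denominator by it confines the quotient to that set.\<close>
  proof (rule bexI[of _ "\<lambda>z. g z * s z"], rule bexI[of _ "\<lambda>z. h z * s z"], intro conjI ballI impI)
    show "h y * s y \<noteq> 0" using V(6)[OF V(2) cls_self] s(2) cls_self[of y] by auto
    fix z assume z: "z \<in> aff i" "h z * s z \<noteq> 0"
    then have "\<forall>w\<in>cls z. s w \<noteq> 0" using homog_poly_nonzero_class[OF s(1)] by auto
    then have zV: "cls z \<in> V" using s(3) aff_cls(1)[OF z(1)] unfolding chart_def by blast
    show "z \<in> {y \<in> aff i. cls y \<in> U}" using z(1) zV V(3) by blast
    show "f (cls z) = g z * s z / (h z * s z)" using V(6)[OF zV cls_self] z(2) by auto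
  qed (use homog_poly_polyfun V(4,5) s(1) in \<open>auto intro!: polyfun_mult\<close>)
qed auto

subsection \<open>Reduction of Cech cocycles to the two charts\<close>

text \<open>\<open>theta g\<close> is the cocycle of the two-chart cover with value \<open>g\<close> on the overlap, written as the
  coboundary of the functions \<open>kappa x * g\<close>, which need not be regular.\<close>

definition kappa :: "'k point \<Rightarrow> 'k" where "kappa x = (if x \<in> chart Y 0 then 0 else 1)"

definition theta :: "('k point \<Rightarrow> 'k) \<Rightarrow> 'k cochain" where
  "theta g = (\<lambda>x y P. (kappa y - kappa x) * g P)"

definition overlap :: "'k point set" where "overlap = chart Y 0 \<inter> chart Y 1"

lemma one_le_t: "0 \<le> t" "1 \<le> t" using t by auto

lemma chart_cover: "P \<in> Y \<Longrightarrow> P \<in> chart Y 0 \<or> P \<in> chart Y 1"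
proof -
  assume P: "P \<in> Y"
  then obtain y where y: "y \<in> P" using proj_space_nonempty unfolding Y by blast
  have "P = cls y" using proj_spaceE(1) P y unfolding Y by blast
  then show ?thesis using cover[OF P y] P unfolding chart_def cls_def by auto
qed

lemma overlap_open: "proj_open t Y overlap"
  unfolding overlap_def by (intro proj_open_Int chart_open one_le_t)

lemma chart_sub: "chart Y i \<subseteq> Y" unfolding chart_def by blast

lemma cocycle_trivial_on_chart:
  assumes i: "i \<le> t" and U: "point_cover t Y U"
    and f: "\<And>x y. x \<in> Y \<Longrightarrow> y \<in> Y \<Longrightarrow> regular_on t Y (U x \<inter> U y) (f x y)"
    and cocycle: "\<And>x y z P. x \<in> Y \<Longrightarrow> y \<in> Y \<Longrightarrow> z \<in> Y \<Longrightarrow> P \<in> U x \<inter> U y \<inter> U z \<Longrightarrow> f y z P - f x z P + f x y P = 0"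
  shows "\<exists>H. (\<forall>x\<in>Y. regular_on t Y (U x \<inter> chart Y i) (H x)) \<and>
    (\<forall>x\<in>Y. \<forall>y\<in>Y. \<forall>P\<in>U x \<inter> U y \<inter> chart Y i. f x y P = H y P - H x P)"
proof -
  have Uo: "proj_open t Y (U x)" "x \<in> U x" if "x \<in> Y" for x using U that unfolding point_cover_def by auto
  define V where "V = (\<lambda>x. {y \<in> aff i. cls y \<in> U x})"
  have eq: "{y \<in> aff i. cls y \<in> W \<inter> chart Y i} = {y \<in> aff i. cls y \<in> W}" for W using aff_cls(1) by blast
  have "\<exists>h. (\<forall>x\<in>Y. aff_regular (Suc t) (aff i) (V x) (h x)) \<and>
    (\<forall>x\<in>Y. \<forall>y\<in>Y. \<forall>P\<in>V x \<inter> V y. f x y (cls P) = h y P - h x P)"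
  proof (rule affine_cocycle_is_coboundary[OF aff_def eqs_polyfun[OF i]])
    fix x assume x: "x \<in> Y"
    have "regular_on t Y (U x \<inter> chart Y i) (\<lambda>_. 0)"
      by (intro regular_on_Int regular_on_const Uo(1)[OF x] chart_open[OF i])
    from regular_on_affD[OF i this Int_lower2] show "aff_regular (Suc t) (aff i) (V x) (\<lambda>_. 0)"
      unfolding V_def eq .
  next
    show "aff i \<subseteq> (\<Union>x\<in>Y. V x)"
    proof
      fix y assume y: "y \<in> aff i"
      then have "cls y \<in> Y" using aff_cls(1) chart_sub by blast
      then show "y \<in> (\<Union>x\<in>Y. V x)" unfolding V_def using y Uo(2) by blast
    qed
  next
    fix x y assume xy: "x \<in> Y" "y \<in> Y"
    have "regular_on t Y ((U x \<inter> U y) \<inter> chart Y i) (f x y)"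
      by (intro regular_on_Int f xy chart_open[OF i])
    from regular_on_affD[OF i this Int_lower2] have "aff_regular (Suc t) (aff i) {z \<in> aff i. cls z \<in> U x \<inter> U y} (\<lambda>P. f x y (cls P))"
      unfolding eq .
    moreover have "{z \<in> aff i. cls z \<in> U x \<inter> U y} = V x \<inter> V y" unfolding V_def by blast
    ultimately show "aff_regular (Suc t) (aff i) (V x \<inter> V y) (\<lambda>P. f x y (cls P))" by simp
  next
    fix x y z P assume xyz: "x \<in> Y" "y \<in> Y" "z \<in> Y" "P \<in> V x \<inter> V y \<inter> V z"
    then show "f y z (cls P) - f x z (cls P) + f x y (cls P) = 0" by (intro cocycle) (auto simp: V_def)
  qed
  then obtain h where h: "\<And>x. x \<in> Y \<Longrightarrow> aff_regular (Suc t) (aff i) (V x) (h x)"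
    "\<And>x y P. x \<in> Y \<Longrightarrow> y \<in> Y \<Longrightarrow> P \<in> V x \<inter> V y \<Longrightarrow> f x y (cls P) = h y P - h x P" by metis
  define H where "H = (\<lambda>x P. h x (normalize_at i P))"
  have "regular_on t Y (U x \<inter> chart Y i) (H x)" if x: "x \<in> Y" for x
  proof (rule regular_on_affI[OF i Int_lower2])
    have "aff_regular (Suc t) (aff i) (V x) (\<lambda>y. H x (cls y))"
      by (rule aff_regular_cong[OF h(1)[OF x]]) (simp add: H_def V_def aff_cls(2))
    then show "aff_regular (Suc t) (aff i) {y \<in> aff i. cls y \<in> U x \<inter> chart Y i} (\<lambda>y. H x (cls y))"
      unfolding eq V_def .
  qed
  moreover have "f x y P = H y P - H x P" if "x \<in> Y" "y \<in> Y" "P \<in> U x \<inter> U y \<inter> chart Y i" for x y P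
    using h(2)[OF that(1,2), of "normalize_at i P"] that(3) chart_normalize[of P i] unfolding H_def V_def by auto
  ultimately show ?thesis by blast
qed

lemma point_cover_charts: "point_cover t Y (\<lambda>x. if x \<in> chart Y 0 then chart Y 0 else chart Y 1)"
  unfolding point_cover_def using chart_cover chart_open[OF one_le_t(1)] chart_open[OF one_le_t(2)] by auto

lemma theta_cocycle:
  assumes g: "regular_on t Y overlap g" shows "theta g \<in> cocycles t Y"
proof -
  define U where "U = (\<lambda>x. if x \<in> chart Y 0 then chart Y 0 else chart Y 1)"
  have open': "proj_open t Y (U x)" for x unfolding U_def using chart_open one_le_t by auto
  have "regular_on t Y (U x \<inter> U y) (theta g x y)" for x y
  proof (cases "kappa x = kappa y")
    case True
    have "regular_on t Y (U x \<inter> U y) (\<lambda>_. 0)" by (intro regular_on_const proj_open_Int open')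
    then show ?thesis using True by (simp add: theta_def)
  next
    case False
    then have "U x \<inter> U y = overlap" unfolding U_def overlap_def kappa_def by (auto split: if_splits)
    then show ?thesis unfolding theta_def using regular_on_cmult[OF overlap_open g] by simp
  qed
  then show ?thesis unfolding cocycles_def using point_cover_charts[folded U_def]
    by (intro CollectI exI[of _ U]) (auto simp: theta_def algebra_simps)
qed

text \<open>The trivializations \<open>H0\<close> and \<open>H1\<close> on the two charts have the
  same coboundary, so \<open>H0 x - H1 x\<close> does not depend on \<open>x\<close> and glues to a
  function \<open>g\<close> on the overlap. Choosing \<open>H0\<close> or \<open>H1\<close>
  according to the chart of the index \<open>x\<close> trivializes what remains.\<close>

lemma cocycle_eq_theta:
  assumes "f \<in> cocycles t Y"
  shows "\<exists>g. regular_on t Y overlap g \<and> (\<lambda>x y P. f x y P - theta g x y P) \<in> coboundaries t Y"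
proof -
  obtain U where U: "point_cover t Y U" and f: "\<And>x y. x \<in> Y \<Longrightarrow> y \<in> Y \<Longrightarrow> regular_on t Y (U x \<inter> U y) (f x y)"
    and cocycle: "\<And>x y z P. x \<in> Y \<Longrightarrow> y \<in> Y \<Longrightarrow> z \<in> Y \<Longrightarrow> P \<in> U x \<inter> U y \<inter> U z \<Longrightarrow> f y z P - f x z P + f x y P = 0"
    using assms unfolding cocycles_def by blast
  have Uo: "proj_open t Y (U x)" "x \<in> U x" if "x \<in> Y" for x using U that unfolding point_cover_def by auto
  obtain H0 where H0: "\<And>x. x \<in> Y \<Longrightarrow> regular_on t Y (U x \<inter> chart Y 0) (H0 x)"
    "\<And>x y P. x \<in> Y \<Longrightarrow> y \<in> Y \<Longrightarrow> P \<in> U x \<inter> U y \<inter> chart Y 0 \<Longrightarrow> f x y P = H0 y P - H0 x P"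
    using cocycle_trivial_on_chart[OF one_le_t(1) U f cocycle] by blast
  obtain H1 where H1: "\<And>x. x \<in> Y \<Longrightarrow> regular_on t Y (U x \<inter> chart Y 1) (H1 x)"
    "\<And>x y P. x \<in> Y \<Longrightarrow> y \<in> Y \<Longrightarrow> P \<in> U x \<inter> U y \<inter> chart Y 1 \<Longrightarrow> f x y P = H1 y P - H1 x P"
    using cocycle_trivial_on_chart[OF one_le_t(2) U f cocycle] by blast
  \<comment> \<open>The index \<open>P\<close> itself is admissible at the point \<open>P\<close>,
    which makes the gluing explicit.\<close>
  define g where "g = (\<lambda>P. H0 P P - H1 P P)"
  have gx: "g P = H0 x P - H1 x P" if "x \<in> Y" "P \<in> U x" "P \<in> overlap" for x P
  proof -
    have P: "P \<in> Y" using that(3) unfolding overlap_def chart_def by blast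
    have "H0 x P - H0 P P = H1 x P - H1 P P"
      using H0(2)[OF P that(1), of P] H1(2)[OF P that(1), of P] that Uo(2)[OF P] unfolding overlap_def by simp
    then show ?thesis unfolding g_def by (simp add: algebra_simps)
  qed
  have "regular_on t Y overlap g"
  proof (rule regular_on_local)
    fix P assume P: "P \<in> overlap"
    then have PY: "P \<in> Y" unfolding overlap_def chart_def by blast
    have o: "proj_open t Y (U P \<inter> overlap)" by (intro proj_open_Int Uo(1)[OF PY] overlap_open)
    have "regular_on t Y (U P \<inter> overlap) (\<lambda>Q. H0 P Q - H1 P Q)"
      by (intro regular_on_diff o regular_on_Int'[OF H0(1)[OF PY] chart_open[OF one_le_t(2)]]
          regular_on_Int'[OF H1(1)[OF PY] chart_open[OF one_le_t(1)]]) (auto simp: overlap_def)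
    then show "\<exists>W f'. regular_on t Y W f' \<and> P \<in> W \<and> W \<subseteq> overlap \<and> (\<forall>Q\<in>W. g Q = f' Q)"
      using gx[OF PY] P Uo(2)[OF PY] by (intro exI[of _ "U P \<inter> overlap"] exI[of _ "\<lambda>Q. H0 P Q - H1 P Q"]) auto
  qed
  moreover have "(\<lambda>x y P. f x y P - theta g x y P) \<in> coboundaries t Y"
    unfolding coboundaries_def
  proof (intro CollectI exI conjI ballI)
    define W where "W = (\<lambda>x. U x \<inter> (if x \<in> chart Y 0 then chart Y 0 else chart Y 1))"
    define K where "K = (\<lambda>x. if x \<in> chart Y 0 then H0 x else H1 x)"
    show "point_cover t Y W" unfolding point_cover_def W_def
      using Uo chart_open[OF one_le_t(1)] chart_open[OF one_le_t(2)] chart_cover by (auto intro!: proj_open_Int)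
    show "regular_on t Y (W x) (K x)" if "x \<in> Y" for x
      using H0(1)[OF that] H1(1)[OF that] unfolding W_def K_def by simp
    fix x y P assume *: "x \<in> Y" "y \<in> Y" "P \<in> W x \<inter> W y"
    consider "x \<in> chart Y 0" "y \<in> chart Y 0" | "x \<notin> chart Y 0" "y \<notin> chart Y 0"
      | "x \<in> chart Y 0" "y \<notin> chart Y 0" | "x \<notin> chart Y 0" "y \<in> chart Y 0" by blast
    then show "f x y P - theta g x y P = K y P - K x P"
    proof cases
      case 1
      then show ?thesis using * H0(2)[OF *(1,2), of P] unfolding K_def W_def theta_def kappa_def by auto
    next
      case 2
      then show ?thesis using * H1(2)[OF *(1,2), of P] unfolding K_def W_def theta_def kappa_def by auto
    next
      case 3
      then have "P \<in> overlap" using *(3) unfolding W_def overlap_def by auto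
      then show ?thesis using 3 * H0(2)[OF *(1,2), of P] gx[OF *(2), of P]
        unfolding K_def W_def theta_def kappa_def by auto
    next
      case 4
      then have "P \<in> overlap" using *(3) unfolding W_def overlap_def by auto
      then show ?thesis using 4 * H0(2)[OF *(1,2), of P] gx[OF *(1), of P]
        unfolding K_def W_def theta_def kappa_def by auto
    qed
  qed
  ultimately show ?thesis by blast
qed

text \<open>On an arbitrary cover \<open>h x\<close> and \<open>h y\<close> agree when
  \<open>kappa x = kappa y\<close> and differ by \<open>g\<close> up to sign otherwise, so they glue
  to one function for each value of \<open>kappa\<close>.\<close>

lemma theta_coboundaryD:
  assumes g: "regular_on t Y overlap g" and "theta g \<in> coboundaries t Y"
  shows "\<exists>G0 G1. regular_on t Y (chart Y 0) G0 \<and> regular_on t Y (chart Y 1) G1 \<and> (\<forall>P\<in>overlap. g P = G1 P - G0 P)"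
proof -
  obtain U h where U: "point_cover t Y U" and h: "\<And>x. x \<in> Y \<Longrightarrow> regular_on t Y (U x) (h x)"
    and d: "\<And>x y P. x \<in> Y \<Longrightarrow> y \<in> Y \<Longrightarrow> P \<in> U x \<inter> U y \<Longrightarrow> theta g x y P = h y P - h x P"
    using assms(2) unfolding coboundaries_def by blast
  have Uo: "proj_open t Y (U x)" "x \<in> U x" if "x \<in> Y" for x using U that unfolding point_cover_def by auto
  define G0 where "G0 = (\<lambda>P. h P P)"
  \<comment> \<open>A point of the overlap has \<open>kappa = 0\<close>; adding \<open>g\<close>
    moves its own function \<open>h P\<close> to the value that an index with
    \<open>kappa = 1\<close> gives.\<close>
  define G1 where "G1 = (\<lambda>P. if P \<in> chart Y 0 then h P P + g P else h P P)"
  have G0: "regular_on t Y (chart Y 0) G0"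
  proof (rule regular_on_local)
    fix P assume P: "P \<in> chart Y 0"
    then have PY: "P \<in> Y" unfolding chart_def by blast
    have "regular_on t Y (U P \<inter> chart Y 0) (h P)" by (intro regular_on_Int h PY chart_open one_le_t)
    moreover have "G0 Q = h P Q" if "Q \<in> U P \<inter> chart Y 0" for Q
    proof -
      have "Q \<in> Y" using that unfolding chart_def by blast
      then show ?thesis using d[OF PY, of Q Q] that P Uo(2)[of Q] unfolding G0_def theta_def kappa_def by auto
    qed
    ultimately show "\<exists>W f'. regular_on t Y W f' \<and> P \<in> W \<and> W \<subseteq> chart Y 0 \<and> (\<forall>Q\<in>W. G0 Q = f' Q)"
      using P Uo(2)[OF PY] by (intro exI[of _ "U P \<inter> chart Y 0"] exI[of _ "h P"]) auto
  qed
  moreover have "regular_on t Y (chart Y 1) G1"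
  proof (rule regular_on_local)
    fix P assume P: "P \<in> chart Y 1"
    then have PY: "P \<in> Y" unfolding chart_def by blast
    show "\<exists>W f'. regular_on t Y W f' \<and> P \<in> W \<and> W \<subseteq> chart Y 1 \<and> (\<forall>Q\<in>W. G1 Q = f' Q)"
    proof (cases "P \<in> chart Y 0")
      case True
      have "regular_on t Y overlap (\<lambda>Q. G0 Q + g Q)"
        using regular_on_Int[OF G0 chart_open[OF one_le_t(2)]] g unfolding overlap_def[symmetric] by (rule regular_on_add)
      then show ?thesis using True P
        by (intro exI[of _ overlap] exI[of _ "\<lambda>Q. G0 Q + g Q"]) (auto simp: overlap_def G0_def G1_def)
    next
      case False
      have "regular_on t Y (U P \<inter> chart Y 1) (h P)" by (intro regular_on_Int h PY chart_open one_le_t)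
      moreover have "G1 Q = h P Q" if "Q \<in> U P \<inter> chart Y 1" for Q
      proof -
        have "Q \<in> Y" using that unfolding chart_def by blast
        then show ?thesis using d[OF PY, of Q Q] that P False Uo(2)[of Q]
          unfolding G1_def theta_def kappa_def by (auto simp: algebra_simps split: if_splits)
      qed
      ultimately show ?thesis
        using P Uo(2)[OF PY] by (intro exI[of _ "U P \<inter> chart Y 1"] exI[of _ "h P"]) auto
    qed
  qed
  moreover have "\<forall>P\<in>overlap. g P = G1 P - G0 P" unfolding overlap_def G0_def G1_def by auto
  ultimately show ?thesis by blast
qed

lemma theta_coboundaryI:
  assumes "regular_on t Y (chart Y 0) G0" "regular_on t Y (chart Y 1) G1" "\<And>P. P \<in> overlap \<Longrightarrow> g P = G1 P - G0 P"
  shows "theta g \<in> coboundaries t Y"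
  unfolding coboundaries_def
proof (intro CollectI exI conjI ballI)
  show "point_cover t Y (\<lambda>x. if x \<in> chart Y 0 then chart Y 0 else chart Y 1)" by (rule point_cover_charts)
  show "regular_on t Y (if x \<in> chart Y 0 then chart Y 0 else chart Y 1) (if x \<in> chart Y 0 then G0 else G1)" for x
    using assms by simp
  show "theta g x y P = (if y \<in> chart Y 0 then G0 else G1) P - (if x \<in> chart Y 0 then G0 else G1) P"
    if "P \<in> (if x \<in> chart Y 0 then chart Y 0 else chart Y 1) \<inter> (if y \<in> chart Y 0 then chart Y 0 else chart Y 1)" for x y P
    using that assms(3)[of P] unfolding theta_def kappa_def overlap_def by (auto split: if_splits)
qed

end

section \<open>Monomials on generalized Fermat curves\<close>

section \<open>Generalized Fermat curves\<close>

subsection \<open>Spans of monomials\<close>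

text \<open>Only the values on \<open>D\<close> count (\<open>lspan_cong\<close>), so the equations
  of the curve may be used inside a span.\<close>

inductive_set lspan :: "'y set \<Rightarrow> ('b \<Rightarrow> 'y \<Rightarrow> 'k::field) \<Rightarrow> 'b set \<Rightarrow> ('y \<Rightarrow> 'k) set" for D mo J where
  lspan_base: "b \<in> J \<Longrightarrow> mo b \<in> lspan D mo J"
| lspan_zero: "(\<lambda>_. 0) \<in> lspan D mo J"
| lspan_add: "f \<in> lspan D mo J \<Longrightarrow> g \<in> lspan D mo J \<Longrightarrow> (\<lambda>y. f y + g y) \<in> lspan D mo J"
| lspan_cmult: "f \<in> lspan D mo J \<Longrightarrow> (\<lambda>y. c * f y) \<in> lspan D mo J"
| lspan_cong: "f \<in> lspan D mo J \<Longrightarrow> (\<And>y. y \<in> D \<Longrightarrow> f y = g y) \<Longrightarrow> g \<in> lspan D mo J"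

lemma lspan_subst:
  assumes "f \<in> lspan D mo J" "\<And>b. b \<in> J \<Longrightarrow> mo b \<in> lspan D mo J'"
  shows "f \<in> lspan D mo J'"
  using assms(1) by (induction rule: lspan.induct) (auto intro: assms(2) lspan.intros)

lemma lspan_mono: "f \<in> lspan D mo J \<Longrightarrow> J \<subseteq> J' \<Longrightarrow> f \<in> lspan D mo J'"
  by (erule lspan_subst) (auto intro: lspan_base)

lemma lspan_sum: "(\<And>i. i \<in> A \<Longrightarrow> f i \<in> lspan D mo J) \<Longrightarrow> (\<lambda>y. \<Sum>i\<in>A. f i y) \<in> lspan D mo J"
  by (induction A rule: infinite_finite_induct) (auto intro: lspan_zero lspan_add)

lemma lspan_diff: "f \<in> lspan D mo J \<Longrightarrow> g \<in> lspan D mo J \<Longrightarrow> (\<lambda>y. f y - g y) \<in> lspan D mo J"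
  using lspan_add[OF _ lspan_cmult[where c = "- 1"]] by fastforce

lemma lspan_mult:
  assumes f: "f \<in> lspan D mo J" and g: "g \<in> lspan D mo J'"
    and mult: "\<And>b b'. b \<in> J \<Longrightarrow> b' \<in> J' \<Longrightarrow> (\<lambda>y. mo b y * mo b' y) \<in> lspan D mo K"
  shows "(\<lambda>y. f y * g y) \<in> lspan D mo K"
proof -
  have base: "(\<lambda>y. mo b y * g y) \<in> lspan D mo K" if b: "b \<in> J" for b
    using g
  proof (induction rule: lspan.induct)
    case (lspan_base b')
    then show ?case by (rule mult[OF b])
  next
    case lspan_zero
    show ?case by (simp add: lspan.lspan_zero)
  next
    case (lspan_add f g)
    then show ?case using lspan.lspan_add[of "\<lambda>y. mo b y * f y"] by (simp add: distrib_left)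
  next
    case (lspan_cmult f c)
    then show ?case using lspan.lspan_cmult[of "\<lambda>y. mo b y * f y" _ _ _ c] by (simp add: mult.left_commute)
  next
    case (lspan_cong f g)
    from lspan_cong(3) show ?case by (rule lspan.lspan_cong) (simp add: lspan_cong(2))
  qed
  show ?thesis using f
  proof (induction rule: lspan.induct)
    case (lspan_base b')
    then show ?case by (rule base)
  next
    case lspan_zero
    show ?case by (simp add: lspan.lspan_zero)
  next
    case (lspan_add f h)
    then show ?case using lspan.lspan_add[of "\<lambda>y. f y * g y"] by (simp add: distrib_right)
  next
    case (lspan_cmult f c)
    then show ?case using lspan.lspan_cmult[of "\<lambda>y. f y * g y" _ _ _ c] by (simp add: mult.assoc)
  next
    case (lspan_cong f h)
    from lspan_cong(3) show ?case by (rule lspan.lspan_cong) (simp add: lspan_cong(2))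
  qed
qed

lemma lspan_rep:
  fixes mo :: "'b \<Rightarrow> 'y \<Rightarrow> 'k::field"
  assumes "f \<in> lspan D mo J"
  shows "\<exists>c. finite {b. c b \<noteq> 0} \<and> {b. c b \<noteq> 0} \<subseteq> J \<and> (\<forall>y\<in>D. f y = (\<Sum>b | c b \<noteq> 0. c b * mo b y))"
  using assms
proof (induction rule: lspan.induct)
  case (lspan_base b)
  have eq: "{b'. (if b' = b then 1 else 0 :: 'k) \<noteq> 0} = {b}" by auto
  show ?case using lspan_base by (intro exI[of _ "\<lambda>b'. if b' = b then 1 else 0"]) (simp add: eq)
next
  case lspan_zero
  show ?case by (intro exI[of _ "\<lambda>_. 0"]) auto
next
  case (lspan_add f g)
  then obtain c d where c: "finite {b. c b \<noteq> 0}" "{b. c b \<noteq> 0} \<subseteq> J" "\<forall>y\<in>D. f y = (\<Sum>b | c b \<noteq> 0. c b * mo b y)"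
    and d: "finite {b. d b \<noteq> 0}" "{b. d b \<noteq> 0} \<subseteq> J" "\<forall>y\<in>D. g y = (\<Sum>b | d b \<noteq> 0. d b * mo b y)" by blast
  let ?S = "{b. c b \<noteq> 0} \<union> {b. d b \<noteq> 0}"
  have "f y + g y = (\<Sum>b | c b + d b \<noteq> 0. (c b + d b) * mo b y)" if y: "y \<in> D" for y
  proof -
    have "f y = (\<Sum>b\<in>?S. c b * mo b y)" using c y by (auto simp: d(1) intro!: sum.mono_neutral_left)
    moreover have "g y = (\<Sum>b\<in>?S. d b * mo b y)" using d y by (auto simp: c(1) intro!: sum.mono_neutral_left)
    moreover have "(\<Sum>b | c b + d b \<noteq> 0. (c b + d b) * mo b y) = (\<Sum>b\<in>?S. (c b + d b) * mo b y)"
      using c(1) d(1) by (intro sum.mono_neutral_left) auto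
    ultimately show ?thesis by (simp add: distrib_right sum.distrib)
  qed
  moreover have "{b. c b + d b \<noteq> 0} \<subseteq> ?S" by auto
  ultimately show ?case using c(1,2) d(1,2) by (intro exI[of _ "\<lambda>b. c b + d b"]) (auto intro: finite_subset)
next
  case (lspan_cmult f a)
  then obtain c where c: "finite {b. c b \<noteq> 0}" "{b. c b \<noteq> 0} \<subseteq> J" "\<forall>y\<in>D. f y = (\<Sum>b | c b \<noteq> 0. c b * mo b y)" by blast
  show ?case
  proof (cases "a = 0")
    case True
    then show ?thesis by (intro exI[of _ "\<lambda>_. 0"]) auto
  next
    case False
    then have "{b. a * c b \<noteq> 0} = {b. c b \<noteq> 0}" by auto
    then show ?thesis using c by (intro exI[of _ "\<lambda>b. a * c b"]) (simp add: sum_distrib_left mult.assoc)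
  qed
next
  case (lspan_cong f g)
  then show ?case by auto
qed

subsection \<open>Roots in algebraically closed fields\<close>

text \<open>A double root of \<open>w ^ m - c\<close> would be a zero of the derivative
  \<open>m * x ^ (m - 1)\<close>, which is impossible for \<open>x \<noteq> 0\<close> as
  \<open>m\<close> is nonzero in the field.\<close>

lemma card_nth_roots_alg_closed:
  fixes c :: "'k::alg_closed_field"
  assumes "of_nat m \<noteq> (0::'k)" "c \<noteq> 0"
  shows "card {w. w ^ m = c} = m"
proof -
  have m: "m > 0" using assms(1) by (cases m) auto
  define p where "p = monom 1 m + [:- c:]"
  have dp: "degree p = m" unfolding p_def using m by (subst degree_add_eq_left) (auto simp: degree_monom_eq)
  have p0: "p \<noteq> 0" using dp m by auto
  obtain A where A: "size A = degree p" "p = Polynomial.smult (lead_coeff p) (\<Prod>x\<in>#A. [:- x, 1:])"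
    using alg_closed_imp_factorization[OF p0] by blast
  have ev: "poly p w = w ^ m - c" for w unfolding p_def by (simp add: poly_monom)
  have "count A x \<le> 1" for x
  proof (rule ccontr)
    assume "\<not> count A x \<le> 1"
    then have "{#x, x#} \<subseteq># A" by (simp add: subseteq_mset_def)
    then obtain B where B: "A = {#x, x#} + B" using mset_subset_eq_exists_conv by blast
    have "\<exists>q. p = [:- x, 1:] * ([:- x, 1:] * q)"
      by (rule exI[of _ "Polynomial.smult (lead_coeff p) (\<Prod>x\<in>#B. [:- x, 1:])"], subst A(2))
        (simp add: B mult.assoc del: mult_pCons_left mult_pCons_right)
    then obtain q where q: "p = [:- x, 1:] * ([:- x, 1:] * q)" by blast
    have "poly p x = 0" unfolding q by simp
    then have "x ^ m = c" using ev by simp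
    then have "x \<noteq> 0" using assms(2) m by (auto simp: power_0_left)
    have "poly (pderiv p) x = 0" unfolding q by (simp add: pderiv_mult del: mult_pCons_left mult_pCons_right)
    moreover have "poly (pderiv p) x = of_nat m * x ^ (m - 1)" unfolding p_def
      by (simp add: pderiv_add pderiv_monom poly_monom pderiv_pCons)
    ultimately show False using assms(1) \<open>x \<noteq> 0\<close> by simp
  qed
  then have "card (set_mset A) = size A"
    by (metis (no_types, lifting) One_nat_def count_eq_zero_iff le_neq_implies_less less_one size_multiset_overloaded_eq sum.cong card_eq_sum)
  moreover have "set_mset A = {w. w ^ m = c}"
  proof -
    have "poly p w = 0 \<longleftrightarrow> w \<in># A" for w
      using p0 by (subst A(2)) (auto simp: poly_prod_mset prod_mset_zero_iff)
    then show ?thesis using ev by auto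
  qed
  ultimately show ?thesis using A(1) dp by simp
qed

definition exps :: "nat \<Rightarrow> nat set \<Rightarrow> (nat \<Rightarrow> nat) set" where
  "exps m X = {a. (\<forall>x\<in>X. a x < m) \<and> (\<forall>x. x \<notin> X \<longrightarrow> a x = 0)}"

lemma exps_insert:
  assumes "x \<notin> X"
  shows "bij_betw (\<lambda>(a, i). a(x := i)) (exps m X \<times> {..<m}) (exps m (insert x X))"
proof (rule bij_betwI')
  fix p q assume "p \<in> exps m X \<times> {..<m}" "q \<in> exps m X \<times> {..<m}"
  then obtain a i b j where *: "p = (a, i)" "q = (b, j)" "a x = 0" "b x = 0" using assms unfolding exps_def by auto
  have "a = b \<and> i = j" if "a(x := i) = b(x := j)"
  proof -
    have "a y = b y" for y using fun_cong[OF that, of y] *(3,4) by (cases "y = x") auto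
    then show ?thesis using fun_cong[OF that, of x] by auto
  qed
  then show "((case p of (a, i) \<Rightarrow> a(x := i)) = (case q of (a, i) \<Rightarrow> a(x := i))) = (p = q)" using * by auto
next
  fix p assume "p \<in> exps m X \<times> {..<m}"
  then show "(case p of (a, i) \<Rightarrow> a(x := i)) \<in> exps m (insert x X)" unfolding exps_def by auto
next
  fix b assume b: "b \<in> exps m (insert x X)"
  have "b = (b(x := 0))(x := b x)" by simp
  moreover have "b(x := 0) \<in> exps m X" "b x < m" using b assms unfolding exps_def by auto
  ultimately show "\<exists>p\<in>exps m X \<times> {..<m}. b = (case p of (a, i) \<Rightarrow> a(x := i))"
    by (intro bexI[of _ "(b(x := 0), b x)"]) auto
qed

lemma finite_exps: "finite X \<Longrightarrow> finite (exps m X)"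
proof (induction X rule: finite_induct)
  case empty
  have "exps m {} = {\<lambda>_. 0}" unfolding exps_def by auto
  then show ?case by simp
next
  case (insert x X)
  then show ?case using bij_betw_finite[OF exps_insert[OF insert(2)]] by auto
qed

text \<open>In each variable the degree is below \<open>m\<close> while \<open>m\<close> values are
  allowed. One variable is split off and its value fixed; the induction kills the coefficients in
  the others, and these are one-variable polynomials with \<open>m\<close> roots.\<close>

lemma multivariate_vanishing:
  fixes R :: "nat \<Rightarrow> 'k::field set"
  assumes "finite X" "\<And>x. x \<in> X \<Longrightarrow> card (R x) = m"
    and "\<And>w. (\<And>x. x \<in> X \<Longrightarrow> w x \<in> R x) \<Longrightarrow> (\<Sum>a\<in>exps m X. p a * (\<Prod>x\<in>X. w x ^ a x)) = 0"
    and "a \<in> exps m X"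
  shows "p a = 0"
  using assms
proof (induction X arbitrary: p a rule: finite_induct)
  case empty
  have "exps m {} = {\<lambda>_. 0}" unfolding exps_def by auto
  then show ?case using empty by simp
next
  case (insert x X)
  note bij = exps_insert[OF insert.hyps(2), of m]
  have sum0: "(\<Sum>a\<in>exps m X. (\<Sum>i<m. p (a(x := i)) * v ^ i) * (\<Prod>x\<in>X. w x ^ a x)) = 0"
    if v: "v \<in> R x" and w: "\<And>x. x \<in> X \<Longrightarrow> w x \<in> R x" for v w
  proof -
    define u where "u = w(x := v)"
    have uX: "(\<Prod>y\<in>X. u y ^ (a(x := i)) y) = (\<Prod>y\<in>X. w y ^ a y)" for a i
      using insert.hyps(2) by (intro prod.cong) (auto simp: u_def)
    have "0 = (\<Sum>a\<in>exps m (insert x X). p a * (\<Prod>y\<in>insert x X. u y ^ a y))"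
      by (rule sym, rule insert.prems(2)) (use v w in \<open>auto simp: u_def\<close>)
    also have "\<dots> = (\<Sum>q\<in>exps m X \<times> {..<m}. p ((fst q)(x := snd q)) * (\<Prod>y\<in>insert x X. u y ^ ((fst q)(x := snd q)) y))"
      by (subst sum.reindex_bij_betw[OF bij, symmetric]) (simp add: case_prod_beta)
    also have "\<dots> = (\<Sum>q\<in>exps m X \<times> {..<m}. (p ((fst q)(x := snd q)) * v ^ snd q) * (\<Prod>y\<in>X. w y ^ fst q y))"
      using insert.hyps uX by (intro sum.cong) (auto simp: u_def)
    also have "\<dots> = (\<Sum>a\<in>exps m X. \<Sum>i<m. (p (a(x := i)) * v ^ i) * (\<Prod>y\<in>X. w y ^ a y))"
      by (simp add: sum.cartesian_product case_prod_beta)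
    finally show ?thesis by (simp add: sum_distrib_right)
  qed
  have cf: "p (a(x := i)) = 0" if a: "a \<in> exps m X" and i: "i < m" for a i
  proof -
    define q where "q = (\<Sum>i<m. monom (p (a(x := i))) i)"
    have ev: "poly q v = (\<Sum>i<m. p (a(x := i)) * v ^ i)" for v unfolding q_def by (simp add: poly_sum poly_monom)
    have "poly q v = 0" if v: "v \<in> R x" for v
      unfolding ev by (rule insert.IH[OF _ _ a, of "\<lambda>a. \<Sum>i<m. p (a(x := i)) * v ^ i"]) (use insert.prems(1) sum0[OF v] in auto)
    then have sub: "R x \<subseteq> {v. poly q v = 0}" by blast
    have "q = 0"
    proof (rule ccontr)
      assume q0: "q \<noteq> 0"
      have "card (R x) \<le> card {v. poly q v = 0}" by (rule card_mono[OF poly_roots_finite[OF q0] sub])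
      also have "\<dots> \<le> degree q" by (rule card_poly_roots_bound[OF q0])
      also have "\<dots> < m" unfolding q_def using i by (intro degree_sum_less) (auto intro: le_less_trans[OF degree_monom_le])
      finally show False using insert.prems(1) by simp
    qed
    then have "coeff q i = 0" by simp
    then show ?thesis unfolding q_def using i by (simp add: coeff_sum if_distrib[of "\<lambda>z. _ z"] sum.delta cong: if_cong)
  qed
  obtain q where q: "q \<in> exps m X \<times> {..<m}" "a = (fst q)(x := snd q)"
    using insert.prems(3) bij unfolding bij_betw_def by (force simp: case_prod_beta)
  then have "fst q \<in> exps m X" "snd q < m" by auto
  from cf[OF this] show ?case unfolding q(2) .
qed

subsection \<open>The cohomology of generalized Fermat curves\<close>

text \<open>The pair \<open>(j, a)\<close> stands for the monomial \<open>z\<^sup>j w\<^sup>a\<close>; the exponents \<open>a\<close> are indexed by the indices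
  of the parameters \<open>l x\<close>, so that different curves share their monomials.\<close>

definition idx :: "nat \<Rightarrow> nat set \<Rightarrow> (int \<times> (nat \<Rightarrow> nat)) set" where
  "idx m X = {b. snd b \<in> exps m X \<and> - int (sum (snd b) X) < fst b \<and> fst b < 0}"

lemma finite_idx:
  assumes "finite X" shows "finite (idx m X)"
proof (rule finite_subset)
  show "idx m X \<subseteq> {- int (card X * m)..0} \<times> exps m X"
  proof
    fix b assume b: "b \<in> idx m X"
    have "sum (snd b) X \<le> (\<Sum>x\<in>X. m)" using b unfolding idx_def exps_def by (intro sum_mono) (auto intro: less_imp_le)
    then have "sum (snd b) X \<le> card X * m" by simp
    then have "int (sum (snd b) X) \<le> int (card X * m)" by (simp only: of_nat_le_iff)
    then show "b \<in> {- int (card X * m)..0} \<times> exps m X" using b unfolding idx_def by (simp add: mem_Times_iff)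
  qed
qed (simp add: finite_exps assms)

text \<open>Writing \<open>p * a x = m * q + r\<close>, the equation of the curve turns
  \<open>w ^ (m * q)\<close> into \<open>(- (l x + z ^ m)) ^ q\<close>; the product of these factors
  is this polynomial in \<open>z\<close>.\<close>

definition frob_poly :: "nat \<Rightarrow> nat \<Rightarrow> (nat \<Rightarrow> 'k::field) \<Rightarrow> (nat \<Rightarrow> nat) \<Rightarrow> 'k poly" where
  "frob_poly p m l a = (\<Prod>x | a x \<noteq> 0. (- ([:l x:] + monom 1 m)) ^ (p * a x div m))"

text \<open>Column \<open>b\<close> lists the coefficients of the \<open>p\<close>-th power of the
  monomial \<open>b\<close>; the shift by \<open>p * fst b\<close> is the power of \<open>z\<close>
  in front of \<open>frob_poly\<close>.\<close>

definition frob_matrix :: "nat \<Rightarrow> nat \<Rightarrow> (nat \<Rightarrow> 'k::field) \<Rightarrow> int \<times> (nat \<Rightarrow> nat) \<Rightarrow> int \<times> (nat \<Rightarrow> nat) \<Rightarrow> 'k" where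
  "frob_matrix p m l b' b =
     (if snd b' = (\<lambda>x. p * snd b x mod m) \<and> fst b' \<ge> int p * fst b
      then coeff (frob_poly p m l (snd b)) (nat (fst b' - int p * fst b)) else 0)"

text \<open>For \<open>N = idx m X\<close> the monomials that occur but are cut off extend to a
  chart and are zero in cohomology.\<close>

definition frob_coords :: "nat \<Rightarrow> nat \<Rightarrow> (nat \<Rightarrow> 'k::field) \<Rightarrow> (int \<times> (nat \<Rightarrow> nat)) set \<Rightarrow>
    (int \<times> (nat \<Rightarrow> nat) \<Rightarrow> 'k) \<Rightarrow> int \<times> (nat \<Rightarrow> nat) \<Rightarrow> 'k" where
  "frob_coords p m l N v b' = (if b' \<in> N then \<Sum>b\<in>N. frob_matrix p m l b' b * v b ^ p else 0)"

lemma proj_space_nonzero: "P \<in> proj_space t \<Longrightarrow> y \<in> P \<Longrightarrow> \<exists>i. y i \<noteq> 0"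
  unfolding proj_space_def by fastforce

lemma gen_fermat_eq:
  "gen_fermat m \<mu>s = {P \<in> proj_space (Suc (length \<mu>s)). \<forall>y\<in>P. \<forall>q<length \<mu>s. \<mu>s ! q * y 0 ^ m + y 1 ^ m + y (q + 2) ^ m = 0}"
  unfolding gen_fermat_def by simp

locale fermat_curve =
  fixes l :: "nat \<Rightarrow> 'k::alg_closed_field" and m :: nat and js :: "nat list"
  assumes m: "of_nat m \<noteq> (0::'k)" and js: "distinct js"
begin

text \<open>Translates a parameter index, common to all curves, into a coordinate of this one; the
  shift by 2 passes over \<open>y 0\<close> and \<open>y 1\<close>.\<close>

definition crd :: "nat \<Rightarrow> nat" where "crd x = (THE q. q < length js \<and> js ! q = x) + 2"

abbreviation X :: "nat set" where "X \<equiv> set js"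

abbreviation t :: nat where "t \<equiv> Suc (length js)"

abbreviation Y :: "'k point set" where "Y \<equiv> gen_fermat m (map l js)"

definition F :: "((nat \<Rightarrow> 'k) \<Rightarrow> 'k) set" where
  "F = (\<lambda>x y. l x * y 0 ^ m + y 1 ^ m + y (crd x) ^ m) ` X"

lemma m_pos: "m > 0" using m by (cases m) auto

lemma crd_nth: "q < length js \<Longrightarrow> crd (js ! q) = q + 2"
  unfolding crd_def using js by (subst the_equality[of _ q]) (auto simp: nth_eq_iff_index_eq)

lemma crdE:
  assumes "x \<in> X" obtains q where "q < length js" "x = js ! q" "crd x = q + 2"
  using assms crd_nth by (metis in_set_conv_nth)

lemma crd_bounds: "x \<in> X \<Longrightarrow> 2 \<le> crd x \<and> crd x \<le> t"
  by (elim crdE) auto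

lemma F_zero_iff_X: "(\<forall>e\<in>F. e y = 0) \<longleftrightarrow> (\<forall>x\<in>X. l x * y 0 ^ m + y 1 ^ m + y (crd x) ^ m = 0)"
  unfolding F_def by simp

lemma F_zero_iff: "(\<forall>e\<in>F. e y = 0) \<longleftrightarrow> (\<forall>q<length js. map l js ! q * y 0 ^ m + y 1 ^ m + y (q + 2) ^ m = 0)"
  unfolding F_zero_iff_X
proof (intro iffI allI impI ballI)
  fix q assume *: "\<forall>x\<in>X. l x * y 0 ^ m + y 1 ^ m + y (crd x) ^ m = 0" "q < length js"
  then have "l (js ! q) * y 0 ^ m + y 1 ^ m + y (crd (js ! q)) ^ m = 0" using nth_mem by blast
  then show "map l js ! q * y 0 ^ m + y 1 ^ m + y (q + 2) ^ m = 0" using crd_nth[OF *(2)] *(2) by simp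
next
  fix x assume *: "\<forall>q<length js. map l js ! q * y 0 ^ m + y 1 ^ m + y (q + 2) ^ m = 0" "x \<in> X"
  show "l x * y 0 ^ m + y 1 ^ m + y (crd x) ^ m = 0" by (rule crdE[OF *(2)]) (use *(1) in auto)
qed

sublocale two_chart t F Y
proof
  show "1 \<le> t" by simp
  show "Y = {P \<in> proj_space t. \<forall>y\<in>P. \<forall>e\<in>F. e y = 0}"
    unfolding F_zero_iff gen_fermat_eq by simp
  fix e assume "e \<in> F"
  then obtain x where x: "x \<in> X" "e = (\<lambda>y. l x * y 0 ^ m + y 1 ^ m + y (crd x) ^ m)" unfolding F_def by blast
  have "homog_poly t m (\<lambda>y::nat \<Rightarrow> 'k. y i ^ m)" if "i \<le> t" for i
    using homog_poly_power[OF homog_poly_var[OF that], of m] by simp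
  moreover from this[of 0] have "homog_poly t m (\<lambda>y::nat \<Rightarrow> 'k. l x * y 0 ^ m)"
    using homog_poly_mult[OF homog_poly_const] by fastforce
  ultimately have "homog_poly t m e" unfolding x(2) using crd_bounds[OF x(1)] by (intro homog_poly_add) auto
  then show "\<exists>d. homog_poly t d e" by blast
next
  fix P y assume P: "P \<in> Y" "y \<in> P"
  show "y 0 \<noteq> 0 \<or> y 1 \<noteq> 0"
  \<comment> \<open>If \<open>y 0 = y 1 = 0\<close>, every equation reduces to
    \<open>y (q + 2) ^ m = 0\<close>, leaving no nonzero coordinate.\<close>
  proof (rule ccontr)
    assume 0: "\<not> ?thesis"
    have PS: "P \<in> proj_space t" and eq: "\<And>q. q < length js \<Longrightarrow> map l js ! q * y 0 ^ m + y 1 ^ m + y (q + 2) ^ m = 0"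
      using P unfolding gen_fermat_eq by auto
    have "y i = 0" for i
    proof -
      consider "i = 0" | "i = 1" | q where "i = q + 2" "q < length js" | "i > t"
      proof -
        assume a: "i = 0 \<Longrightarrow> thesis" "i = 1 \<Longrightarrow> thesis" "\<And>q. i = q + 2 \<Longrightarrow> q < length js \<Longrightarrow> thesis" "t < i \<Longrightarrow> thesis"
        show thesis
        proof (cases "i \<ge> 2 \<and> i \<le> t")
          case True
          then show ?thesis using a(3)[of "i - 2"] by auto
        qed (use a in fastforce)
      qed
      then show ?thesis
      proof cases
        case 3
        then show ?thesis using eq[of q] 0 m_pos by (simp add: power_0_left)
      qed (use 0 proj_spaceE(2)[OF PS P(2)] in auto)
    qed
    then show False using proj_space_nonzero[OF PS P(2)] by blast
  qed
qed

text \<open>Affine coordinates for the overlap: with \<open>y 0 = 1\<close>, the entry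
  \<open>y 1\<close> is \<open>z\<close> and \<open>y (crd x)\<close> is the \<open>w\<close> with
  index \<open>x\<close>.\<close>

definition D :: "(nat \<Rightarrow> 'k) set" where "D = {y \<in> aff 0. y 1 \<noteq> 0}"

definition mo :: "int \<times> (nat \<Rightarrow> nat) \<Rightarrow> (nat \<Rightarrow> 'k) \<Rightarrow> 'k" where
  "mo b y = y 1 powi fst b * (\<Prod>x\<in>X. y (crd x) ^ snd b x)"

lemma D_iff: "y \<in> D \<longleftrightarrow> (\<forall>i>t. y i = 0) \<and> y 0 = 1 \<and> y 1 \<noteq> 0 \<and> (\<forall>x\<in>X. y (crd x) ^ m = - (l x + y 1 ^ m))"
proof -
  have aff0: "y \<in> aff 0 \<longleftrightarrow> (\<forall>i>t. y i = 0) \<and> y 0 = 1 \<and> (\<forall>e\<in>F. e y = 0)"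
    unfolding aff_def zero_locus_def eqs_def by (auto simp: Suc_le_eq)
  have "l x + y 1 ^ m + y (crd x) ^ m = 0 \<longleftrightarrow> y (crd x) ^ m = - (l x + y 1 ^ m)" for x
    by (rule add_eq_0_iff)
  then show ?thesis unfolding D_def mem_Collect_eq aff0 F_zero_iff_X by auto
qed

lemma D_cls: "y \<in> D \<Longrightarrow> cls y \<in> overlap" "y \<in> D \<Longrightarrow> normalize_at 0 (cls y) = y"
  using aff_cls[of y 0] unfolding D_def overlap_def chart_def cls_def by auto

lemma overlap_D: "P \<in> overlap \<Longrightarrow> normalize_at 0 P \<in> D \<and> cls (normalize_at 0 P) = P"
  using chart_normalize[of P 0] unfolding D_def overlap_def by (auto simp: chart_def)

lemma mo_mult: "y \<in> D \<Longrightarrow> mo b y * mo b' y = mo (fst b + fst b', \<lambda>x. snd b x + snd b' x) y"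
  unfolding mo_def D_iff by (simp add: power_int_add power_add prod.distrib)

text \<open>Replacing \<open>w\<^sub>x\<^sup>m\<close> by \<open>-(l x + z\<^sup>m)\<close> lowers \<open>|a|\<close> by \<open>m\<close> and raises \<open>j\<close> by \<open>0\<close> or \<open>m\<close>; the
  condition \<open>Q\<close> has to survive this.\<close>

lemma mo_reduce:
  assumes Q: "\<And>j s. Q j (s + m) \<Longrightarrow> Q j s \<and> Q (j + int m) s" and "Q j (sum a X)"
  shows "mo (j, a) \<in> lspan D mo {b. snd b \<in> exps m X \<and> Q (fst b) (sum (snd b) X)}"
  using assms(2)
proof (induction "sum a X" arbitrary: j a rule: less_induct)
  case less
  show ?case
  proof (cases "\<forall>x\<in>X. a x < m")
    case True
    define a' where "a' = (\<lambda>x. if x \<in> X then a x else 0)"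
    have "mo (j, a) = mo (j, a')" unfolding mo_def a'_def by (intro ext) simp
    moreover have "sum a' X = sum a X" unfolding a'_def by simp
    moreover have "a' \<in> exps m X" using True unfolding exps_def a'_def by auto
    ultimately show ?thesis using less.prems by (auto intro!: lspan_base)
  next
    case False
    then obtain x where x: "x \<in> X" "a x \<ge> m" by auto
    define a' where "a' = a(x := a x - m)"
    have "sum a X = a x + sum a (X - {x})" using x by (simp add: sum.remove)
    moreover have "sum a' X = (a x - m) + sum a (X - {x})"
      using x by (subst sum.remove[of _ x]) (auto simp: a'_def)
    ultimately have s: "sum a X = sum a' X + m" using x by simp
    have prod': "(\<Prod>x\<in>X. y (crd x) ^ a x) = y (crd x) ^ m * (\<Prod>x\<in>X. y (crd x) ^ a' x)" for y :: "nat \<Rightarrow> 'k"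
    proof -
      have "(\<Prod>x\<in>X. y (crd x) ^ a' x) = y (crd x) ^ (a x - m) * (\<Prod>x\<in>X - {x}. y (crd x) ^ a x)"
        using x by (subst prod.remove[of _ x]) (auto simp: a'_def)
      moreover have "(\<Prod>x\<in>X. y (crd x) ^ a x) = y (crd x) ^ (m + (a x - m)) * (\<Prod>x\<in>X - {x}. y (crd x) ^ a x)"
        using x by (subst prod.remove[of _ x]) auto
      ultimately show ?thesis by (simp add: power_add mult.assoc)
    qed
    have "Q j (sum a' X)" "Q (j + int m) (sum a' X)" using Q less.prems s by auto
    then have ih: "mo (j, a') \<in> lspan D mo {b. snd b \<in> exps m X \<and> Q (fst b) (sum (snd b) X)}"
      "mo (j + int m, a') \<in> lspan D mo {b. snd b \<in> exps m X \<and> Q (fst b) (sum (snd b) X)}"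
      using less.hyps s m_pos by auto
    from lspan_add[OF lspan_cmult[OF ih(1), of "- l x"] lspan_cmult[OF ih(2), of "- 1"]]
    show ?thesis
    proof (rule lspan_cong)
      fix y assume y: "y \<in> D"
      then have h: "y (crd x) ^ m = - (l x + y 1 ^ m)" "y 1 powi (j + int m) = y 1 powi j * y 1 ^ m"
        using x unfolding D_iff by (auto simp: power_int_add)
      then show "- l x * mo (j, a') y + - 1 * mo (j + int m, a') y = mo (j, a) y"
        unfolding mo_def fst_conv snd_conv prod' h by (simp add: algebra_simps del: One_nat_def)
    qed
  qed
qed

lemma prod_crd_delta:
  "x \<in> X \<Longrightarrow> (\<Prod>x'\<in>X. f x' ^ (if x' = x then 1 else 0)) = f x" for f :: "nat \<Rightarrow> 'k"
proof -
  assume x: "x \<in> X"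
  have "(\<Prod>x'\<in>X. f x' ^ (if x' = x then 1 else 0)) = (\<Prod>x'\<in>{x}. f x')"
    using x by (intro prod.mono_neutral_cong_right) auto
  then show ?thesis by simp
qed

lemma coordinate_cases:
  assumes "i < Suc t"
  obtains "i = 0" | "i = 1" | x where "x \<in> X" "i = crd x"
proof (cases "i \<ge> 2")
  case True
  then have "i - 2 < length js" "i = crd (js ! (i - 2))" using assms crd_nth[of "i - 2"] by auto
  then show ?thesis using that(3) by (metis nth_mem)
qed (use that in fastforce)

lemma polyfun_lspan_chart0:
  assumes "p \<in> polyfun (Suc t)" shows "p \<in> lspan D mo {b. fst b \<ge> 0}"
  using assms
proof (induction rule: polyfun.induct)
  case (polyfun_const c)
  have "mo (0, \<lambda>_. 0) \<in> lspan D mo {b. fst b \<ge> 0}" by (intro lspan_base) simp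
  from lspan_cmult[OF this, of c] show ?case by (rule lspan_cong) (simp add: mo_def)
next
  case (polyfun_var i)
  show ?case
  proof (rule coordinate_cases[OF polyfun_var])
    assume i: "i = 0"
    have "mo (0, \<lambda>_. 0) \<in> lspan D mo {b. fst b \<ge> 0}" by (intro lspan_base) simp
    then show ?thesis by (rule lspan_cong) (auto simp: i mo_def D_iff)
  next
    assume i: "i = 1"
    have "mo (1, \<lambda>_. 0) \<in> lspan D mo {b. fst b \<ge> 0}" by (intro lspan_base) simp
    then show ?thesis by (rule lspan_cong) (auto simp: i mo_def D_iff)
  next
    fix x assume x: "x \<in> X" "i = crd x"
    have "mo (0, \<lambda>x'. if x' = x then 1 else 0) \<in> lspan D mo {b. fst b \<ge> 0}" by (intro lspan_base) simp
    then show ?thesis by (rule lspan_cong) (simp only: x(2) mo_def snd_conv prod_crd_delta[OF x(1)], simp)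
  qed
next
  case (polyfun_add f g)
  then show ?case by (intro lspan_add)
next
  case (polyfun_mult f g)
  show ?case
  proof (rule lspan_mult[OF polyfun_mult(3,4)])
    fix b b' :: "int \<times> (nat \<Rightarrow> nat)" assume "b \<in> {b. fst b \<ge> 0}" "b' \<in> {b. fst b \<ge> 0}"
    then have "mo (fst b + fst b', \<lambda>x. snd b x + snd b' x) \<in> lspan D mo {b. fst b \<ge> 0}" by (intro lspan_base) simp
    then show "(\<lambda>y. mo b y * mo b' y) \<in> lspan D mo {b. fst b \<ge> 0}" by (rule lspan_cong) (simp add: mo_mult)
  qed
qed

text \<open>Dividing by \<open>y 1\<close> turns the coordinates into \<open>1 / z\<close>, 1 and
  \<open>w / z\<close>, which satisfy \<open>j \<le> - |a|\<close>; the condition is stable under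
  products.\<close>

lemma polyfun_lspan_chart1:
  assumes "p \<in> polyfun (Suc t)"
  shows "(\<lambda>y. p (\<lambda>i. y i / y 1)) \<in> lspan D mo {b. fst b \<le> - int (sum (snd b) X)}" (is "_ \<in> ?L")
  using assms
proof (induction rule: polyfun.induct)
  case (polyfun_const c)
  have "mo (0, \<lambda>_. 0) \<in> ?L" by (intro lspan_base) simp
  from lspan_cmult[OF this, of c] show ?case by (rule lspan_cong) (simp add: mo_def)
next
  case (polyfun_var i)
  show ?case
  proof (rule coordinate_cases[OF polyfun_var])
    assume i: "i = 0"
    have "mo (- 1, \<lambda>_. 0) \<in> ?L" by (intro lspan_base) simp
    then show ?thesis by (rule lspan_cong) (auto simp: i mo_def D_iff divide_inverse power_int_minus)
  next
    assume i: "i = 1"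
    have "mo (0, \<lambda>_. 0) \<in> ?L" by (intro lspan_base) simp
    then show ?thesis by (rule lspan_cong) (auto simp: i mo_def D_iff)
  next
    fix x assume x: "x \<in> X" "i = crd x"
    have s: "(\<Sum>x'\<in>X. if x' = x then 1 else 0) = (1::nat)" using x by simp
    have "mo (- 1, \<lambda>x'. if x' = x then 1 else 0) \<in> ?L"
      by (intro lspan_base CollectI, unfold fst_conv snd_conv s) simp
    then show ?thesis by (rule lspan_cong) (simp only: x(2) mo_def fst_conv snd_conv prod_crd_delta[OF x(1)], simp add: divide_inverse power_int_minus)
  qed
next
  case (polyfun_add f g)
  then show ?case by (intro lspan_add)
next
  case (polyfun_mult f g)
  show ?case
  proof (rule lspan_mult[OF polyfun_mult(3,4)])
    fix b b' :: "int \<times> (nat \<Rightarrow> nat)"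
    assume "b \<in> {b. fst b \<le> - int (sum (snd b) X)}" "b' \<in> {b. fst b \<le> - int (sum (snd b) X)}"
    then have "mo (fst b + fst b', \<lambda>x. snd b x + snd b' x) \<in> ?L" by (intro lspan_base) (simp add: sum.distrib)
    then show "(\<lambda>y. mo b y * mo b' y) \<in> ?L" by (rule lspan_cong) (simp add: mo_mult)
  qed
qed

text \<open>Inside the chart \<open>y 0 \<noteq> 0\<close> the overlap is the principal open set
  \<open>y 1 \<noteq> 0\<close>, so \<open>g\<close> becomes polynomial after multiplication by a
  power of \<open>z\<close>.\<close>

lemma regular_overlap_lspan:
  assumes "regular_on t Y overlap g"
  shows "(\<lambda>y. g (cls y)) \<in> lspan D mo {b. snd b \<in> exps m X}"
proof -
  have "aff_regular (Suc t) (aff 0) {y \<in> aff 0. cls y \<in> overlap} (\<lambda>y. g (cls y))"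
    by (rule regular_on_affD[OF _ assms]) (auto simp: overlap_def)
  moreover have "{y \<in> aff 0. cls y \<in> overlap} = {y \<in> aff 0. y 1 \<noteq> 0}"
    using D_cls(1) cls_self unfolding D_def overlap_def chart_def by auto
  ultimately obtain M p where p: "p \<in> polyfun (Suc t)" "\<forall>y\<in>aff 0. y 1 \<noteq> 0 \<longrightarrow> g (cls y) * y 1 ^ M = p y"
    using aff_regular_principal_open[OF aff_def eqs_polyfun polyfun_var, of 0 1 "\<lambda>y. g (cls y)"] by auto
  have "(\<lambda>y. p y * mo (- int M, \<lambda>_. 0) y) \<in> lspan D mo UNIV"
  proof (rule lspan_mult[OF polyfun_lspan_chart0[OF p(1)] lspan_base[of _ UNIV]])
    fix b b' show "(\<lambda>y. mo b y * mo b' y) \<in> lspan D mo UNIV"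
      by (rule lspan_cong[OF lspan_base[of "(fst b + fst b', \<lambda>x. snd b x + snd b' x)"]]) (simp_all add: mo_mult)
  qed simp
  then have "(\<lambda>y. g (cls y)) \<in> lspan D mo UNIV"
  proof (rule lspan_cong)
    fix y assume y: "y \<in> D"
    then have "p y = g (cls y) * y 1 ^ M" "y 1 \<noteq> 0" using p(2) unfolding D_def by auto
    then show "p y * mo (- int M, \<lambda>_. 0) y = g (cls y)" unfolding mo_def by (simp add: power_int_minus)
  qed
  then show ?thesis
  proof (rule lspan_subst)
    fix b show "mo b \<in> lspan D mo {b. snd b \<in> exps m X}"
      using mo_reduce[of "\<lambda>_ _. True" "fst b" "snd b"] by simp
  qed
qed

text \<open>The principal open set of the constant 1 is the whole chart.\<close>

lemma aff_regular_global:
  assumes "aff_regular (Suc t) (aff i) (aff i) f" "i \<le> t"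
  shows "\<exists>p\<in>polyfun (Suc t). \<forall>y\<in>aff i. f y = p y"
  using aff_regular_principal_open[OF aff_def eqs_polyfun[OF assms(2)] polyfun_const[of 1], of f] assms(1) by simp

lemma regular_chart0_lspan:
  assumes "regular_on t Y (chart Y 0) g"
  shows "(\<lambda>y. g (cls y)) \<in> lspan D mo {b. snd b \<in> exps m X \<and> fst b \<ge> 0}"
proof -
  have "aff_regular (Suc t) (aff 0) {y \<in> aff 0. cls y \<in> chart Y 0} (\<lambda>y. g (cls y))"
    by (rule regular_on_affD[OF _ assms]) auto
  moreover have "{y \<in> aff 0. cls y \<in> chart Y 0} = aff 0" using aff_cls(1) by blast
  ultimately have r: "aff_regular (Suc t) (aff 0) (aff 0) (\<lambda>y. g (cls y))" by (simp only:)
  then obtain p where p: "p \<in> polyfun (Suc t)" "\<forall>y\<in>aff 0. g (cls y) = p y"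
    using aff_regular_global[OF r one_le_t(1)] by blast
  have "(\<lambda>y. g (cls y)) \<in> lspan D mo {b. fst b \<ge> 0}"
    by (rule lspan_cong[OF polyfun_lspan_chart0[OF p(1)]]) (use p(2) in \<open>auto simp: D_def\<close>)
  then show ?thesis
  proof (rule lspan_subst)
    fix b :: "int \<times> (nat \<Rightarrow> nat)" assume "b \<in> {b. fst b \<ge> 0}"
    then show "mo b \<in> lspan D mo {b. snd b \<in> exps m X \<and> fst b \<ge> 0}"
      using mo_reduce[of "\<lambda>j _. j \<ge> 0" "fst b" "snd b"] by simp
  qed
qed

lemma overlap_normalize1:
  assumes "P \<in> overlap"
  shows "normalize_at 1 P = (\<lambda>i. normalize_at 0 P i / normalize_at 0 P 1)"
proof -
  define y where "y = normalize_at 0 P"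
  have y: "y \<in> D" "cls y = P" unfolding y_def using overlap_D[OF assms] by auto
  have "P \<in> Y" "\<forall>y\<in>P. y 1 \<noteq> 0" using assms unfolding overlap_def chart_def by auto
  then have P: "P \<in> proj_space t" "\<forall>y\<in>P. y 1 \<noteq> 0" unfolding gen_fermat_eq by auto
  have y1: "y 1 \<noteq> 0" using y(1) unfolding D_iff by blast
  have "(\<lambda>i. y i / y 1) \<in> P" unfolding y(2)[symmetric] cls_def
    using y1 by (intro CollectI exI[of _ "1 / y 1"]) auto
  then have "normalize_at 1 P = (\<lambda>i. y i / y 1)" by (rule normalize_at(4)[OF P]) (use y1 in simp)
  then show ?thesis unfolding y_def .
qed

lemma regular_chart1_lspan:
  assumes "regular_on t Y (chart Y 1) g"
  shows "(\<lambda>y. g (cls y)) \<in> lspan D mo {b. snd b \<in> exps m X \<and> fst b \<le> - int (sum (snd b) X)}"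
proof -
  have "aff_regular (Suc t) (aff 1) {y \<in> aff 1. cls y \<in> chart Y 1} (\<lambda>y. g (cls y))"
    by (rule regular_on_affD[OF _ assms]) auto
  moreover have "{y \<in> aff 1. cls y \<in> chart Y 1} = aff 1" using aff_cls(1) by blast
  ultimately have r: "aff_regular (Suc t) (aff 1) (aff 1) (\<lambda>y. g (cls y))" by (simp only:)
  then obtain p where p: "p \<in> polyfun (Suc t)" "\<forall>y\<in>aff 1. g (cls y) = p y"
    using aff_regular_global[OF r one_le_t(2)] by blast
  have "(\<lambda>y. g (cls y)) \<in> lspan D mo {b. fst b \<le> - int (sum (snd b) X)}"
  proof (rule lspan_cong[OF polyfun_lspan_chart1[OF p(1)]])
    fix y assume y: "y \<in> D"
    have c1: "cls y \<in> chart Y 1" using D_cls(1)[OF y] unfolding overlap_def by blast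
    have "g (cls y) = p (normalize_at 1 (cls y))" using chart_normalize[OF c1] p(2) by metis
    then show "p (\<lambda>i. y i / y 1) = g (cls y)" using overlap_normalize1[OF D_cls(1)[OF y]] D_cls(2)[OF y] by simp
  qed
  then show ?thesis
  proof (rule lspan_subst)
    fix b :: "int \<times> (nat \<Rightarrow> nat)" assume "b \<in> {b. fst b \<le> - int (sum (snd b) X)}"
    \<comment> \<open>Trading \<open>w ^ m\<close> for \<open>z ^ m\<close> respects the second
      chart: \<open>j \<le> - (s + m)\<close> implies \<open>j + m \<le> - s\<close>.\<close>
    then show "mo b \<in> lspan D mo {b. snd b \<in> exps m X \<and> fst b \<le> - int (sum (snd b) X)}"
      using mo_reduce[of "\<lambda>j s. j \<le> - int s" "fst b" "snd b"] by simp
  qed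
qed

text \<open>For a general \<open>z\<close> the values of the \<open>w\<close> run independently over
  \<open>m\<close> roots each, so \<open>multivariate_vanishing\<close> separates the exponents
  \<open>a\<close>. What remains for each \<open>a\<close> is a Laurent polynomial in
  \<open>z\<close> with infinitely many zeros.\<close>

lemma mo_independent:
  assumes fin: "finite {b. c b \<noteq> 0}" and sub: "{b. c b \<noteq> 0} \<subseteq> {b. snd b \<in> exps m X}"
    and zero: "\<And>y. y \<in> D \<Longrightarrow> (\<Sum>b | c b \<noteq> 0. c b * mo b y) = 0"
  shows "c b = 0"
proof (rule ccontr)
  assume cb: "c b \<noteq> 0"
  define S where "S = fst ` {b. c b \<noteq> 0}"
  have S: "finite S" using fin unfolding S_def by blast
  \<comment> \<open>Multiplication by \<open>z ^ K\<close> clears the negative exponents.\<close>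
  define K where "K = nat (Max ((\<lambda>j. \<bar>j\<bar>) ` S))"
  have jK: "j + int K \<ge> 0" if "j \<in> S" for j
  proof -
    have "\<bar>j\<bar> \<le> Max ((\<lambda>j. \<bar>j\<bar>) ` S)" using S that by (intro Max_ge) auto
    then show ?thesis unfolding K_def by linarith
  qed
  define q where "q = (\<Sum>j\<in>S. monom (c (j, snd b)) (nat (j + int K)))"
  \<comment> \<open>Excluded are \<open>z = 0\<close> and the finitely many \<open>z\<close> at
    which some \<open>w\<close> is 0.\<close>
  define bad where "bad = insert 0 (\<Union>x\<in>X. {z. l x + z ^ m = 0})"
  have finbad: "finite bad"
  proof -
    have "finite {z. l x + z ^ m = 0}" for x
    proof -
      have "[:l x:] + monom 1 m \<noteq> 0"
      proof
        assume "[:l x:] + monom 1 m = 0"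
        then have "coeff ([:l x:] + monom 1 m) m = 0" by simp
        then show False using m_pos by (simp add: coeff_pCons split: nat.splits)
      qed
      from poly_roots_finite[OF this] show ?thesis by (simp add: poly_monom)
    qed
    then show ?thesis unfolding bad_def by simp
  qed
  have root: "poly q z = 0" if z: "z \<notin> bad" for z
  proof -
    have z0: "z \<noteq> 0" and zx: "\<And>x. x \<in> X \<Longrightarrow> - (l x + z ^ m) \<noteq> 0"
      using z unfolding bad_def neg_equal_0_iff_equal by blast+
    have "(\<Sum>j\<in>S. c (j, snd b) * z powi j) = 0"
    proof (rule multivariate_vanishing[where X = X and m = m and R = "\<lambda>x. {w. w ^ m = - (l x + z ^ m)}" and a = "snd b" and p = "\<lambda>a. \<Sum>j\<in>S. c (j, a) * z powi j"])
      show "card {w. w ^ m = - (l x + z ^ m)} = m" if "x \<in> X" for x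
        by (rule card_nth_roots_alg_closed[OF m zx[OF that]])
      show "snd b \<in> exps m X" using sub cb by blast
      fix w assume w: "\<And>x. x \<in> X \<Longrightarrow> w x \<in> {w. w ^ m = - (l x + z ^ m)}"
      define y where "y = (\<lambda>i. if i = 0 then 1 else if i = 1 then z else if i \<le> t then w (js ! (i - 2)) else 0)"
      have yw: "y (crd x) = w x" if "x \<in> X" for x using that by (elim crdE) (auto simp: y_def)
      have yD: "y \<in> D" unfolding D_iff using yw w z0 by (auto simp: y_def)
      have "(\<Sum>a\<in>exps m X. (\<Sum>j\<in>S. c (j, a) * z powi j) * (\<Prod>x\<in>X. w x ^ a x)) =
        (\<Sum>a\<in>exps m X. \<Sum>j\<in>S. c (j, a) * mo (j, a) y)"
        unfolding sum_distrib_right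
        by (intro sum.cong refl) (simp add: mo_def yw mult.assoc, simp add: y_def)
      also have "\<dots> = (\<Sum>b\<in>S \<times> exps m X. c b * mo b y)"
        by (subst sum.swap) (simp add: sum.cartesian_product case_prod_beta)
      also have "\<dots> = (\<Sum>b | c b \<noteq> 0. c b * mo b y)"
      proof (rule sum.mono_neutral_right)
        show "{b. c b \<noteq> 0} \<subseteq> S \<times> exps m X" unfolding subset_iff using sub unfolding S_def mem_Times_iff by blast
      qed (use S finite_exps[of X m] in auto)
      also have "\<dots> = 0" by (rule zero[OF yD])
      finally show "(\<Sum>a\<in>exps m X. (\<Sum>j\<in>S. c (j, a) * z powi j) * (\<Prod>x\<in>X. w x ^ a x)) = 0" .
    qed simp
    moreover have "poly q z = z ^ K * (\<Sum>j\<in>S. c (j, snd b) * z powi j)"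
      unfolding q_def poly_sum sum_distrib_left
    proof (rule sum.cong[OF refl])
      fix j assume "j \<in> S"
      then have "z ^ nat (j + int K) = z powi (j + int K)" using jK by (simp add: power_int_def)
      then show "poly (monom (c (j, snd b)) (nat (j + int K))) z = z ^ K * (c (j, snd b) * z powi j)"
        using z0 by (simp add: poly_monom power_int_add)
    qed
    ultimately show ?thesis by simp
  qed
  have "q = 0"
  proof (rule ccontr)
    assume "q \<noteq> 0"
    then have "finite {z. poly q z = 0}" by (rule poly_roots_finite)
    moreover have "- bad \<subseteq> {z. poly q z = 0}" using root by blast
    ultimately have "finite (bad \<union> - bad)" using finbad finite_subset by blast
    then show False using infinite_alg_closed[where 'k='k] by simp
  qed
  moreover have "coeff q (nat (fst b + int K)) = c b"
  proof -
    have bS: "fst b \<in> S" using cb unfolding S_def by blast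
    have "coeff q (nat (fst b + int K)) = (\<Sum>j\<in>S. if j = fst b then c (j, snd b) else 0)"
      unfolding q_def coeff_sum
    proof (rule sum.cong[OF refl])
      fix j assume "j \<in> S"
      then have "nat (j + int K) = nat (fst b + int K) \<longleftrightarrow> j = fst b" using jK bS by (metis add_right_cancel eq_nat_nat_iff)
      then show "coeff (monom (c (j, snd b)) (nat (j + int K))) (nat (fst b + int K)) = (if j = fst b then c (j, snd b) else 0)" by simp
    qed
    also have "\<dots> = c b" using bS S by (simp add: sum.delta)
    finally show ?thesis .
  qed
  ultimately show False using cb by simp
qed

end

section \<open>Cocycles and coboundaries under linear operations and Frobenius\<close>

lemma cocycles_add:
  assumes "f \<in> cocycles t Y" "g \<in> cocycles t Y"
  shows "(\<lambda>x y P. f x y P + g x y P) \<in> cocycles t Y"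
proof -
  obtain U where U: "point_cover t Y U" "\<forall>x\<in>Y. \<forall>y\<in>Y. regular_on t Y (U x \<inter> U y) (f x y)"
    "\<forall>x\<in>Y. \<forall>y\<in>Y. \<forall>z\<in>Y. \<forall>P\<in>U x \<inter> U y \<inter> U z. f y z P - f x z P + f x y P = 0"
    using assms(1) unfolding cocycles_def by blast
  obtain V where V: "point_cover t Y V" "\<forall>x\<in>Y. \<forall>y\<in>Y. regular_on t Y (V x \<inter> V y) (g x y)"
    "\<forall>x\<in>Y. \<forall>y\<in>Y. \<forall>z\<in>Y. \<forall>P\<in>V x \<inter> V y \<inter> V z. g y z P - g x z P + g x y P = 0"
    using assms(2) unfolding cocycles_def by blast
  have open_U: "proj_open t Y (U x)" and open_V: "proj_open t Y (V x)" if "x \<in> Y" for x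
    using U(1) V(1) that unfolding point_cover_def by auto
  show ?thesis unfolding cocycles_def
  proof (intro CollectI exI[of _ "\<lambda>x. U x \<inter> V x"] conjI ballI)
    show "point_cover t Y (\<lambda>x. U x \<inter> V x)" using U(1) V(1) unfolding point_cover_def by (auto intro: proj_open_Int)
    fix x y assume xy: "x \<in> Y" "y \<in> Y"
    have "regular_on t Y (U x \<inter> V x \<inter> (U y \<inter> V y)) (f x y)"
      by (rule regular_on_Int'[of _ _ "U x \<inter> U y" _ "V x \<inter> V y"]) (use U(2) xy open_V in \<open>auto intro: proj_open_Int\<close>)
    moreover have "regular_on t Y (U x \<inter> V x \<inter> (U y \<inter> V y)) (g x y)"
      by (rule regular_on_Int'[of _ _ "V x \<inter> V y" _ "U x \<inter> U y"]) (use V(2) xy open_U in \<open>auto intro: proj_open_Int\<close>)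
    ultimately show "regular_on t Y (U x \<inter> V x \<inter> (U y \<inter> V y)) (\<lambda>P. f x y P + g x y P)" by (rule regular_on_add)
    fix z P assume z: "z \<in> Y" "P \<in> U x \<inter> V x \<inter> (U y \<inter> V y) \<inter> (U z \<inter> V z)"
    have "f y z P - f x z P + f x y P = 0" "g y z P - g x z P + g x y P = 0" using U(3) V(3) xy z by blast+
    moreover have "f y z P + g y z P - (f x z P + g x z P) + (f x y P + g x y P) =
      (f y z P - f x z P + f x y P) + (g y z P - g x z P + g x y P)" by (simp add: algebra_simps)
    ultimately show "f y z P + g y z P - (f x z P + g x z P) + (f x y P + g x y P) = 0" by simp
  qed
qed

lemma coboundaries_add:
  assumes "f \<in> coboundaries t Y" "g \<in> coboundaries t Y"
  shows "(\<lambda>x y P. f x y P + g x y P) \<in> coboundaries t Y"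
proof -
  obtain U h where U: "point_cover t Y U" "\<forall>x\<in>Y. regular_on t Y (U x) (h x)"
    "\<forall>x\<in>Y. \<forall>y\<in>Y. \<forall>P\<in>U x \<inter> U y. f x y P = h y P - h x P"
    using assms(1) unfolding coboundaries_def by blast
  obtain V k where V: "point_cover t Y V" "\<forall>x\<in>Y. regular_on t Y (V x) (k x)"
    "\<forall>x\<in>Y. \<forall>y\<in>Y. \<forall>P\<in>V x \<inter> V y. g x y P = k y P - k x P"
    using assms(2) unfolding coboundaries_def by blast
  have open_U: "proj_open t Y (U x)" and open_V: "proj_open t Y (V x)" if "x \<in> Y" for x
    using U(1) V(1) that unfolding point_cover_def by auto
  show ?thesis unfolding coboundaries_def
  proof (intro CollectI exI[of _ "\<lambda>x. U x \<inter> V x"] exI[of _ "\<lambda>x P. h x P + k x P"] conjI ballI)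
    show "point_cover t Y (\<lambda>x. U x \<inter> V x)" using U(1) V(1) unfolding point_cover_def by (auto intro: proj_open_Int)
    fix x assume x: "x \<in> Y"
    have "regular_on t Y (U x \<inter> V x) (h x)"
      by (rule regular_on_Int) (use U(2) x open_V in auto)
    moreover have "regular_on t Y (U x \<inter> V x) (k x)"
      by (rule regular_on_Int'[of _ _ "V x" _ "U x"]) (use V(2) x open_U in auto)
    ultimately show "regular_on t Y (U x \<inter> V x) (\<lambda>P. h x P + k x P)" by (rule regular_on_add)
    fix y P assume y: "y \<in> Y" "P \<in> U x \<inter> V x \<inter> (U y \<inter> V y)"
    have "f x y P = h y P - h x P" "g x y P = k y P - k x P" using U(3) V(3) x y by blast+
    then show "f x y P + g x y P = h y P + k y P - (h x P + k x P)" by simp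
  qed
qed

lemma cocycles_cmult:
  assumes "f \<in> cocycles t Y" shows "(\<lambda>x y P. c * f x y P) \<in> cocycles t Y"
proof -
  obtain U where U: "point_cover t Y U" "\<forall>x\<in>Y. \<forall>y\<in>Y. regular_on t Y (U x \<inter> U y) (f x y)"
    "\<forall>x\<in>Y. \<forall>y\<in>Y. \<forall>z\<in>Y. \<forall>P\<in>U x \<inter> U y \<inter> U z. f y z P - f x z P + f x y P = 0"
    using assms(1) unfolding cocycles_def by blast
  have "c * f y z P - c * f x z P + c * f x y P = 0" if "x \<in> Y" "y \<in> Y" "z \<in> Y" "P \<in> U x \<inter> U y \<inter> U z" for x y z P
  proof -
    have "f y z P - f x z P + f x y P = 0" using U(3) that by blast
    moreover have "c * f y z P - c * f x z P + c * f x y P = c * (f y z P - f x z P + f x y P)" by (simp add: algebra_simps)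
    ultimately show ?thesis by simp
  qed
  moreover have "regular_on t Y (U x \<inter> U y) (\<lambda>P. c * f x y P)" if "x \<in> Y" "y \<in> Y" for x y
    using U(1,2) that unfolding point_cover_def by (intro regular_on_cmult proj_open_Int) auto
  ultimately show ?thesis using U(1) unfolding cocycles_def by (intro CollectI exI[of _ U]) blast
qed

lemma coboundaries_cmult:
  assumes "f \<in> coboundaries t Y" shows "(\<lambda>x y P. c * f x y P) \<in> coboundaries t Y"
proof -
  obtain U h where U: "point_cover t Y U" "\<forall>x\<in>Y. regular_on t Y (U x) (h x)"
    "\<forall>x\<in>Y. \<forall>y\<in>Y. \<forall>P\<in>U x \<inter> U y. f x y P = h y P - h x P"
    using assms(1) unfolding coboundaries_def by blast
  have "regular_on t Y (U x) (\<lambda>P. c * h x P)" if "x \<in> Y" for x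
    using U(1,2) that unfolding point_cover_def by (intro regular_on_cmult) auto
  then show ?thesis using U(1,3) unfolding coboundaries_def
    by (intro CollectI exI[of _ U] exI[of _ "\<lambda>x P. c * h x P"]) (auto simp: right_diff_distrib)
qed

lemma coboundaries_diff:
  "f \<in> coboundaries t Y \<Longrightarrow> g \<in> coboundaries t Y \<Longrightarrow> (\<lambda>x y P. f x y P - g x y P) \<in> coboundaries t Y"
  using coboundaries_add[OF _ coboundaries_cmult[of g t Y "- 1"]] by simp

lemma coboundaries_zero: "(\<lambda>x y P. 0) \<in> coboundaries t Y"
proof -
  have "proj_open t Y Y"
    unfolding proj_open_def by (intro exI[of _ "{\<lambda>_. 1}"]) (auto intro: homog_poly_const)
  then have "\<forall>x\<in>Y. proj_open t Y Y \<and> x \<in> Y" "regular_on t Y Y (\<lambda>_. 0)" by (auto intro: regular_on_const)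
  then show ?thesis unfolding coboundaries_def point_cover_def
    by (intro CollectI exI[of _ "\<lambda>_. Y"] exI[of _ "\<lambda>_ _. 0"]) simp
qed

lemma coboundaries_subset_cocycles: "coboundaries t Y \<subseteq> cocycles t Y"
proof
  fix f assume "f \<in> coboundaries t Y"
  then obtain U h where U: "point_cover t Y U" "\<forall>x\<in>Y. regular_on t Y (U x) (h x)"
    "\<forall>x\<in>Y. \<forall>y\<in>Y. \<forall>P\<in>U x \<inter> U y. f x y P = h y P - h x P" unfolding coboundaries_def by blast
  have o: "proj_open t Y (U x)" if "x \<in> Y" for x using U(1) that unfolding point_cover_def by auto
  have "regular_on t Y (U x \<inter> U y) (f x y)" if xy: "x \<in> Y" "y \<in> Y" for x y
  proof -
    have "regular_on t Y (U x \<inter> U y) (h x)" using U(2) xy o by (intro regular_on_Int) auto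
    moreover have "regular_on t Y (U x \<inter> U y) (h y)" by (rule regular_on_Int'[OF U(2)[rule_format, OF xy(2)] o[OF xy(1)] Int_commute])
    ultimately have "regular_on t Y (U x \<inter> U y) (\<lambda>P. h y P - h x P)"
      using xy o by (intro regular_on_diff proj_open_Int) auto
    then show ?thesis by (rule regular_on_cong) (use U(3) xy in auto)
  qed
  moreover have "f y z P - f x z P + f x y P = 0" if "x \<in> Y" "y \<in> Y" "z \<in> Y" "P \<in> U x \<inter> U y \<inter> U z" for x y z P
    using U(3) that by simp
  ultimately show "f \<in> cocycles t Y" using U(1) unfolding cocycles_def by blast
qed

lemma power_diff_char:
  fixes a b :: "'k::field"
  assumes "prime CHAR('k)"
  shows "(a - b) ^ CHAR('k) = a ^ CHAR('k) - b ^ CHAR('k)"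
  using freshmans_dream[OF assms refl, of "a - b" b] by (simp add: algebra_simps)

lemma coboundaries_frobenius:
  fixes Y :: "'k::field point set"
  assumes "prime CHAR('k)" "f \<in> coboundaries t Y"
  shows "(\<lambda>x y P. f x y P ^ CHAR('k)) \<in> coboundaries t Y"
proof -
  obtain U h where U: "point_cover t Y U" "\<forall>x\<in>Y. regular_on t Y (U x) (h x)"
    "\<forall>x\<in>Y. \<forall>y\<in>Y. \<forall>P\<in>U x \<inter> U y. f x y P = h y P - h x P"
    using assms(2) unfolding coboundaries_def by blast
  have "regular_on t Y (U x) (\<lambda>P. h x P ^ CHAR('k))" if "x \<in> Y" for x
    using U(1,2) that unfolding point_cover_def by (intro regular_on_power) auto
  then show ?thesis using U(1,3) unfolding coboundaries_def
    by (intro CollectI exI[of _ U] exI[of _ "\<lambda>x P. h x P ^ CHAR('k)"]) (auto simp: power_diff_char[OF assms(1)])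
qed

section \<open>Monomial coordinates on the first cohomology\<close>

context fermat_curve
begin

definition mono_fun :: "int \<times> (nat \<Rightarrow> nat) \<Rightarrow> 'k point \<Rightarrow> 'k" where
  "mono_fun b P = mo b (normalize_at 0 P)"

lemma mono_fun_cls: "y \<in> aff 0 \<Longrightarrow> mono_fun b (cls y) = mo b y"
  unfolding mono_fun_def by (simp add: aff_cls(2))

lemma polyfun_coord_prod: "(\<lambda>y. \<Prod>x\<in>X. y (crd x) ^ a x) \<in> polyfun (Suc t)"
  using crd_bounds by (intro polyfun_intros) (auto simp: less_Suc_eq_le)

lemma mono_fun_regular_overlap: "regular_on t Y overlap (mono_fun b)"
proof (rule regular_on_affI[OF one_le_t(1)])
  show "overlap \<subseteq> chart Y 0" unfolding overlap_def by blast
  let ?W = "{y \<in> aff 0. y 1 ^ nat (- fst b) \<noteq> 0} \<inter> {y \<in> aff 0. y 1 \<noteq> 0}"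
  have eq: "{y \<in> aff 0. cls y \<in> overlap} = {y \<in> aff 0. y 1 \<noteq> 0}"
    using D_cls(1) cls_self unfolding D_def overlap_def chart_def by auto
  have p1: "(\<lambda>y::nat \<Rightarrow> 'k. y 1) \<in> polyfun (Suc t)" by (rule polyfun_var) simp
  \<comment> \<open>For \<open>fst b \<ge> 0\<close> the denominator is \<open>y 1 ^ 0\<close>,
    which vanishes nowhere; the condition \<open>y 1 \<noteq> 0\<close> is therefore imposed
    separately.\<close>
  have "aff_regular (Suc t) (aff 0) (aff 0 \<inter> ({y \<in> aff 0. y 1 ^ nat (- fst b) \<noteq> 0} \<inter> {y \<in> aff 0. y 1 \<noteq> 0}))
      (\<lambda>y. (y 1 ^ nat (fst b) * (\<Prod>x\<in>X. y (crd x) ^ snd b x)) * (1 / y 1 ^ nat (- fst b)))"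
    by (intro aff_regular_mult aff_regular_polyfun aff_regular_restrict[OF aff_regular_inverse aff_regular_inverse]
        polyfun_mult polyfun_power polyfun_coord_prod p1)
  moreover have "aff 0 \<inter> ({y \<in> aff 0. y 1 ^ nat (- fst b) \<noteq> 0} \<inter> {y \<in> aff 0. y 1 \<noteq> 0}) = {y \<in> aff 0. y 1 \<noteq> 0}" by auto
  ultimately have "aff_regular (Suc t) (aff 0) {y \<in> aff 0. y 1 \<noteq> 0}
      (\<lambda>y. (y 1 ^ nat (fst b) * (\<Prod>x\<in>X. y (crd x) ^ snd b x)) * (1 / y 1 ^ nat (- fst b)))" by simp
  then show "aff_regular (Suc t) (aff 0) {y \<in> aff 0. cls y \<in> overlap} (\<lambda>y. mono_fun b (cls y))"
    unfolding eq
  proof (rule aff_regular_cong)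
    fix y assume y: "y \<in> {y \<in> aff 0. y 1 \<noteq> 0}"
    then have "mono_fun b (cls y) = mo b y" using mono_fun_cls by blast
    then show "y 1 ^ nat (fst b) * (\<Prod>x\<in>X. y (crd x) ^ snd b x) * (1 / y 1 ^ nat (- fst b)) = mono_fun b (cls y)"
      by (cases "fst b \<ge> 0") (auto simp: mo_def power_int_def divide_inverse power_inverse)
  qed
qed

lemma mono_fun_regular_chart0:
  assumes "fst b \<ge> 0" shows "regular_on t Y (chart Y 0) (mono_fun b)"
proof (rule regular_on_affI[OF one_le_t(1) subset_refl])
  have eq: "{y \<in> aff 0. cls y \<in> chart Y 0} = aff 0" using aff_cls(1) by blast
  have "(\<lambda>y. y 1 ^ nat (fst b) * (\<Prod>x\<in>X. y (crd x) ^ snd b x)) \<in> polyfun (Suc t)"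
    by (intro polyfun_mult polyfun_power polyfun_coord_prod polyfun_var) simp
  from aff_regular_polyfun[OF this, of "aff 0"]
  show "aff_regular (Suc t) (aff 0) {y \<in> aff 0. cls y \<in> chart Y 0} (\<lambda>y. mono_fun b (cls y))"
    unfolding eq by (rule aff_regular_cong) (use assms in \<open>simp add: mono_fun_cls mo_def power_int_def\<close>)
qed

lemma mono_fun_regular_chart1:
  assumes "fst b \<le> - int (sum (snd b) X)"
  shows "\<exists>G. regular_on t Y (chart Y 1) G \<and> (\<forall>P\<in>overlap. G P = mono_fun b P)"
proof -
  \<comment> \<open>In the second chart \<open>z ^ j * w ^ a\<close> is
    \<open>(y 0 / y 1) ^ k\<close> times the product of the \<open>(y (crd x) / y 1) ^ a x\<close>,
    with \<open>k = - j - |a| \<ge> 0\<close>.\<close>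
  define k where "k = nat (- fst b - int (sum (snd b) X))"
  define q where "q = (\<lambda>y::nat \<Rightarrow> 'k. y 0 ^ k * (\<Prod>x\<in>X. y (crd x) ^ snd b x))"
  define G where "G = (\<lambda>P. q (normalize_at 1 P))"
  have "regular_on t Y (chart Y 1) G"
  proof (rule regular_on_affI[OF one_le_t(2) subset_refl])
    have eq: "{y \<in> aff 1. cls y \<in> chart Y 1} = aff 1" using aff_cls(1) by blast
    have "q \<in> polyfun (Suc t)" unfolding q_def
      by (intro polyfun_mult polyfun_power polyfun_coord_prod polyfun_var) simp
    from aff_regular_polyfun[OF this, of "aff 1"]
    show "aff_regular (Suc t) (aff 1) {y \<in> aff 1. cls y \<in> chart Y 1} (\<lambda>y. G (cls y))"
      unfolding eq by (rule aff_regular_cong) (simp add: G_def aff_cls(2))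
  qed
  moreover have "G P = mono_fun b P" if P: "P \<in> overlap" for P
  proof -
    define y where "y = normalize_at 0 P"
    have y: "y 0 = 1" "y 1 \<noteq> 0" using overlap_D[OF P] unfolding y_def D_iff by auto
    have "G P = (1 / y 1) ^ k * (\<Prod>x\<in>X. (y (crd x) / y 1) ^ snd b x)"
      unfolding G_def q_def overlap_normalize1[OF P] y_def[symmetric] by (simp add: y(1))
    also have "(\<Prod>x\<in>X. (y (crd x) / y 1) ^ snd b x) = (\<Prod>x\<in>X. y (crd x) ^ snd b x) / y 1 ^ sum (snd b) X"
      by (simp add: power_divide prod_dividef power_sum)
    also have "(1 / y 1) ^ k * ((\<Prod>x\<in>X. y (crd x) ^ snd b x) / y 1 ^ sum (snd b) X) =
      inverse (y 1 ^ (k + sum (snd b) X)) * (\<Prod>x\<in>X. y (crd x) ^ snd b x)"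
      by (simp add: power_add divide_inverse power_inverse)
    also have "inverse (y 1 ^ (k + sum (snd b) X)) = y 1 powi fst b"
    proof -
      have "fst b = - int (k + sum (snd b) X)" unfolding k_def using assms by simp
      then show ?thesis by (simp only: power_int_minus power_int_of_nat)
    qed
    finally show ?thesis unfolding mono_fun_def mo_def y_def .
  qed
  ultimately show ?thesis by blast
qed

lemma lspan_split_charts:
  assumes "f \<in> lspan D mo {b. fst b \<ge> 0 \<or> fst b \<le> - int (sum (snd b) X)}"
  shows "\<exists>G0 G1. regular_on t Y (chart Y 0) G0 \<and> regular_on t Y (chart Y 1) G1 \<and>
    (\<forall>P\<in>overlap. f (normalize_at 0 P) = G1 P - G0 P)"
  using assms
proof (induction rule: lspan.induct)
  case (lspan_base b)
  have zero: "regular_on t Y (chart Y i) (\<lambda>_. 0)" if "i \<le> t" for i by (intro regular_on_const chart_open that)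
  show ?case
  proof (cases "fst b \<ge> 0")
    case True
    have "regular_on t Y (chart Y 0) (\<lambda>P. - 1 * mono_fun b P)"
      by (intro regular_on_cmult chart_open one_le_t mono_fun_regular_chart0 True)
    then show ?thesis using zero[OF one_le_t(2)]
      by (intro exI[of _ "\<lambda>P. - 1 * mono_fun b P"] exI[of _ "\<lambda>_. 0"]) (simp add: mono_fun_def)
  next
    case False
    then obtain G where "regular_on t Y (chart Y 1) G" "\<forall>P\<in>overlap. G P = mono_fun b P"
      using mono_fun_regular_chart1 lspan_base by blast
    then show ?thesis using zero[OF one_le_t(1)]
      by (intro exI[of _ "\<lambda>_. 0"] exI[of _ G]) (simp add: mono_fun_def)
  qed
next
  case lspan_zero
  have "regular_on t Y (chart Y i) (\<lambda>_. 0)" if "i \<le> t" for i by (intro regular_on_const chart_open that)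
  then show ?case using one_le_t by (intro exI[of _ "\<lambda>_. 0"]) simp
next
  case (lspan_add f g)
  then obtain G0 G1 H0 H1 where "regular_on t Y (chart Y 0) G0" "regular_on t Y (chart Y 1) G1"
    "\<forall>P\<in>overlap. f (normalize_at 0 P) = G1 P - G0 P" "regular_on t Y (chart Y 0) H0" "regular_on t Y (chart Y 1) H1"
    "\<forall>P\<in>overlap. g (normalize_at 0 P) = H1 P - H0 P" by blast
  then show ?case
    by (intro exI[of _ "\<lambda>P. G0 P + H0 P"] exI[of _ "\<lambda>P. G1 P + H1 P"]) (auto intro: regular_on_add)
next
  case (lspan_cmult f c)
  then obtain G0 G1 where "regular_on t Y (chart Y 0) G0" "regular_on t Y (chart Y 1) G1"
    "\<forall>P\<in>overlap. f (normalize_at 0 P) = G1 P - G0 P" by blast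
  then show ?case using chart_open one_le_t
    by (intro exI[of _ "\<lambda>P. c * G0 P"] exI[of _ "\<lambda>P. c * G1 P"]) (auto intro: regular_on_cmult simp: right_diff_distrib)
next
  case (lspan_cong f g)
  then have "f (normalize_at 0 P) = g (normalize_at 0 P)" if "P \<in> overlap" for P using overlap_D that by blast
  then show ?case using lspan_cong.IH by simp
qed

lemma theta_lspan_coboundary:
  assumes "(\<lambda>y. g (cls y)) \<in> lspan D mo {b. fst b \<ge> 0 \<or> fst b \<le> - int (sum (snd b) X)}"
  shows "theta g \<in> coboundaries t Y"
proof -
  obtain G0 G1 where "regular_on t Y (chart Y 0) G0" "regular_on t Y (chart Y 1) G1"
    "\<forall>P\<in>overlap. g (cls (normalize_at 0 P)) = G1 P - G0 P" using lspan_split_charts[OF assms] by blast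
  then have "regular_on t Y (chart Y 0) G0" "regular_on t Y (chart Y 1) G1" "\<And>P. P \<in> overlap \<Longrightarrow> g P = G1 P - G0 P"
    using overlap_D by auto
  then show ?thesis by (rule theta_coboundaryI)
qed

abbreviation N :: "(int \<times> (nat \<Rightarrow> nat)) set" where "N \<equiv> idx m X"

lemma finite_N: "finite N"
  by (simp add: finite_idx)

definition rep :: "(int \<times> (nat \<Rightarrow> nat) \<Rightarrow> 'k) \<Rightarrow> 'k point \<Rightarrow> 'k" where
  "rep v P = (\<Sum>b\<in>N. v b * mono_fun b P)"

lemma rep_regular: "regular_on t Y overlap (rep v)"
  unfolding rep_def by (intro regular_on_sum regular_on_cmult overlap_open mono_fun_regular_overlap)

lemma rep_cls: "y \<in> D \<Longrightarrow> rep v (cls y) = (\<Sum>b\<in>N. v b * mo b y)"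
  unfolding rep_def D_def by (simp add: mono_fun_cls)

lemma theta_rep_cocycle: "theta (rep v) \<in> cocycles t Y"
  by (rule theta_cocycle[OF rep_regular])

lemma theta_add: "theta (\<lambda>P. f P + g P) = (\<lambda>x y P. theta f x y P + theta g x y P)"
  unfolding theta_def by (simp add: distrib_left)

lemma theta_diff: "theta (\<lambda>P. f P - g P) = (\<lambda>x y P. theta f x y P - theta g x y P)"
  unfolding theta_def by (simp add: right_diff_distrib)

lemma theta_rep_add: "theta (rep (\<lambda>b. v b + w b)) = (\<lambda>x y P. theta (rep v) x y P + theta (rep w) x y P)"
  unfolding theta_add[symmetric] rep_def by (simp add: distrib_right sum.distrib)

lemma theta_rep_cmult: "theta (rep (\<lambda>b. c * v b)) = (\<lambda>x y P. c * theta (rep v) x y P)"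
  unfolding theta_def rep_def by (intro ext) (simp add: sum_distrib_left mult.assoc mult.left_commute)

text \<open>Every cocycle comes, up to a coboundary, from a function on the overlap, a combination
  of monomials with reduced exponents. Those outside \<open>N\<close> extend to a chart and
  contribute a coboundary, so the coefficients in \<open>N\<close> are all that is kept.\<close>

lemma theta_rep_surj:
  assumes "f \<in> cocycles t Y"
  shows "\<exists>v. (\<forall>b. b \<notin> N \<longrightarrow> v b = 0) \<and> (\<lambda>x y P. f x y P - theta (rep v) x y P) \<in> coboundaries t Y"
proof -
  obtain g where g: "regular_on t Y overlap g" "(\<lambda>x y P. f x y P - theta g x y P) \<in> coboundaries t Y"
    using cocycle_eq_theta[OF assms] by blast
  obtain c where c: "finite {b. c b \<noteq> 0}" "{b. c b \<noteq> 0} \<subseteq> {b. snd b \<in> exps m X}"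
    "\<forall>y\<in>D. g (cls y) = (\<Sum>b | c b \<noteq> 0. c b * mo b y)" using lspan_rep[OF regular_overlap_lspan[OF g(1)]] by blast
  define v where "v = (\<lambda>b. if b \<in> N then c b else 0)"
  let ?B = "{b. fst b \<ge> 0 \<or> fst b \<le> - int (sum (snd b) X)}"
  have "(\<lambda>y. \<Sum>b\<in>{b. c b \<noteq> 0} - N. c b * mo b y) \<in> lspan D mo ?B"
  proof (intro lspan_sum lspan_cmult lspan_base)
    fix b assume "b \<in> {b. c b \<noteq> 0} - N"
    then show "b \<in> ?B" using c(2) unfolding idx_def by auto
  qed
  then have "(\<lambda>y. g (cls y) - rep v (cls y)) \<in> lspan D mo ?B"
  proof (rule lspan_cong)
    fix y assume y: "y \<in> D"
    have "rep v (cls y) = (\<Sum>b\<in>N. c b * mo b y)" unfolding rep_cls[OF y] v_def by simp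
    also have "\<dots> = (\<Sum>b\<in>{b. c b \<noteq> 0} \<inter> N. c b * mo b y)" using finite_N by (intro sum.mono_neutral_right) auto
    finally show "(\<Sum>b\<in>{b. c b \<noteq> 0} - N. c b * mo b y) = g (cls y) - rep v (cls y)"
      using c(3) y sum.Int_Diff[OF c(1), of "\<lambda>b. c b * mo b y" N] by simp
  qed
  then have "theta (\<lambda>P. g P - rep v P) \<in> coboundaries t Y" by (rule theta_lspan_coboundary)
  from coboundaries_add[OF g(2) this[unfolded theta_diff]]
  show ?thesis by (intro exI[of _ v]) (simp add: v_def)
qed

text \<open>If \<open>rep v\<close> is a difference of functions on the charts, it is also a
  combination of monomials outside \<open>N\<close>, and independence of the monomials makes the
  coefficients in \<open>N\<close> vanish.\<close>

lemma theta_rep_inj: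
  assumes "\<forall>b. b \<notin> N \<longrightarrow> v b = 0" and "theta (rep v) \<in> coboundaries t Y"
  shows "v b = 0"
proof -
  obtain G0 G1 where G: "regular_on t Y (chart Y 0) G0" "regular_on t Y (chart Y 1) G1"
    "\<forall>P\<in>overlap. rep v P = G1 P - G0 P" using theta_coboundaryD[OF rep_regular assms(2)] by blast
  let ?B = "{b. snd b \<in> exps m X \<and> (fst b \<ge> 0 \<or> fst b \<le> - int (sum (snd b) X))}"
  have "(\<lambda>y. G1 (cls y) - G0 (cls y)) \<in> lspan D mo ?B"
    by (rule lspan_diff; rule lspan_mono, (rule regular_chart1_lspan[OF G(2)] regular_chart0_lspan[OF G(1)]), blast)
  then obtain c where c: "finite {b. c b \<noteq> 0}" "{b. c b \<noteq> 0} \<subseteq> ?B"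
    "\<forall>y\<in>D. G1 (cls y) - G0 (cls y) = (\<Sum>b | c b \<noteq> 0. c b * mo b y)" using lspan_rep by blast
  have cN: "c b = 0" if "b \<in> N" for b using c(2) that unfolding idx_def by auto
  define d where "d = (\<lambda>b. v b - c b)"
  have sub: "{b. d b \<noteq> 0} \<subseteq> N \<union> {b. c b \<noteq> 0}" unfolding d_def using assms(1) by auto
  have "d b = 0" for b
  proof (rule mo_independent)
    show "finite {b. d b \<noteq> 0}" by (rule finite_subset[OF sub]) (use finite_N c(1) in blast)
    show "{b. d b \<noteq> 0} \<subseteq> {b. snd b \<in> exps m X}" using sub c(2) unfolding idx_def by blast
    fix y assume y: "y \<in> D"
    have fin: "finite (N \<union> {b. c b \<noteq> 0})" using finite_N c(1) by blast
    have "(\<Sum>b | d b \<noteq> 0. d b * mo b y) = (\<Sum>b\<in>N \<union> {b. c b \<noteq> 0}. d b * mo b y)"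
      by (rule sum.mono_neutral_left[OF fin sub]) auto
    also have "\<dots> = (\<Sum>b\<in>N \<union> {b. c b \<noteq> 0}. v b * mo b y) - (\<Sum>b\<in>N \<union> {b. c b \<noteq> 0}. c b * mo b y)"
      unfolding d_def by (simp add: left_diff_distrib sum_subtractf)
    also have "(\<Sum>b\<in>N \<union> {b. c b \<noteq> 0}. v b * mo b y) = rep v (cls y)"
      unfolding rep_cls[OF y] using fin assms(1) by (intro sum.mono_neutral_right) auto
    also have "(\<Sum>b\<in>N \<union> {b. c b \<noteq> 0}. c b * mo b y) = (\<Sum>b | c b \<noteq> 0. c b * mo b y)"
      using fin by (intro sum.mono_neutral_right) auto
    also have "rep v (cls y) - (\<Sum>b | c b \<noteq> 0. c b * mo b y) = 0"
      using G(3) c(3) y D_cls(1)[OF y] by simp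
    finally show "(\<Sum>b | d b \<noteq> 0. d b * mo b y) = 0" .
  qed
  then show ?thesis using cN assms(1) unfolding d_def by (cases "b \<in> N") (metis diff_zero, blast)
qed

text \<open>The differences \<open>kappa y - kappa x\<close> are 0, 1 or -1, hence fixed by the
  \<open>p\<close>-th power; for -1 this is additivity of Frobenius applied to
  \<open>0 - 1\<close>.\<close>

lemma theta_power_char:
  assumes "prime CHAR('k)"
  shows "theta g x y P ^ CHAR('k) = theta (\<lambda>P. g P ^ CHAR('k)) x y P"
proof -
  have "(0 - 1) ^ CHAR('k) = (0 - 1 :: 'k)"
    unfolding power_diff_char[OF assms] using prime_gt_0_nat[OF assms] by (simp add: power_0_left)
  then have "(kappa y - kappa x) ^ CHAR('k) = kappa y - kappa x"
    unfolding kappa_def using prime_gt_0_nat[OF assms] by (auto simp: power_0_left)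
  then show ?thesis unfolding theta_def by (simp add: power_mult_distrib)
qed

lemma mo_frobenius:
  assumes y: "y \<in> D" and a: "snd b \<in> exps m X"
  shows "mo b y ^ p = (\<Sum>i\<le>degree (frob_poly p m l (snd b)).
    coeff (frob_poly p m l (snd b)) i * mo (int p * fst b + int i, \<lambda>x. p * snd b x mod m) y)"
proof -
  have y1: "y 1 \<noteq> 0" and w: "\<And>x. x \<in> X \<Longrightarrow> y (crd x) ^ m = - (l x + y 1 ^ m)" using y unfolding D_iff by auto
  have "poly (frob_poly p m l (snd b)) (y 1) = (\<Prod>x | snd b x \<noteq> 0. (- (l x + y 1 ^ m)) ^ (p * snd b x div m))"
    unfolding frob_poly_def by (simp add: poly_prod poly_power poly_monom)
  also have "\<dots> = (\<Prod>x\<in>X. (- (l x + y 1 ^ m)) ^ (p * snd b x div m))"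
    using a by (intro prod.mono_neutral_left) (auto simp: exps_def)
  finally have fp: "poly (frob_poly p m l (snd b)) (y 1) = (\<Prod>x\<in>X. (- (l x + y 1 ^ m)) ^ (p * snd b x div m))" .
  have "y 1 powi (int p * fst b) = (y 1 powi fst b) ^ p"
    by (subst mult.commute) (simp only: power_int_mult power_int_of_nat)
  then have "mo b y ^ p = (y 1 powi (int p * fst b)) * (\<Prod>x\<in>X. y (crd x) ^ (p * snd b x))"
    unfolding mo_def power_mult_distrib prod_power_distrib by (simp add: mult.commute[of p] power_mult)
  also have "(\<Prod>x\<in>X. y (crd x) ^ (p * snd b x)) = (\<Prod>x\<in>X. (- (l x + y 1 ^ m)) ^ (p * snd b x div m) * y (crd x) ^ (p * snd b x mod m))"
  proof (rule prod.cong[OF refl])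
    fix x assume x: "x \<in> X"
    have "y (crd x) ^ (p * snd b x) = y (crd x) ^ (m * (p * snd b x div m) + p * snd b x mod m)" by simp
    also have "\<dots> = (y (crd x) ^ m) ^ (p * snd b x div m) * y (crd x) ^ (p * snd b x mod m)"
      by (simp only: power_add power_mult)
    finally show "y (crd x) ^ (p * snd b x) = (- (l x + y 1 ^ m)) ^ (p * snd b x div m) * y (crd x) ^ (p * snd b x mod m)"
      unfolding w[OF x] .
  qed
  also have "\<dots> = poly (frob_poly p m l (snd b)) (y 1) * (\<Prod>x\<in>X. y (crd x) ^ (p * snd b x mod m))"
    unfolding fp prod.distrib ..
  also have "y 1 powi (int p * fst b) * \<dots> = (\<Sum>i\<le>degree (frob_poly p m l (snd b)).
    coeff (frob_poly p m l (snd b)) i * mo (int p * fst b + int i, \<lambda>x. p * snd b x mod m) y)"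
    unfolding poly_altdef sum_distrib_left sum_distrib_right
    by (intro sum.cong refl) (use y1 in \<open>simp add: mo_def power_int_add mult_ac\<close>)
  finally show ?thesis .
qed

lemma theta_rep_frobenius:
  assumes "prime CHAR('k)"
  shows "(\<lambda>x y P. theta (rep v) x y P ^ CHAR('k) - theta (rep (frob_coords CHAR('k) m l N v)) x y P) \<in> coboundaries t Y"
proof -
  define p where "p = CHAR('k)"
  let ?B = "{b. fst b \<ge> 0 \<or> fst b \<le> - int (sum (snd b) X)}"
  define fp where "fp = (\<lambda>b :: int \<times> (nat \<Rightarrow> nat). frob_poly p m l (snd b))"
  define sh where "sh = (\<lambda>b i. (int p * fst b + int i, \<lambda>x. p * snd b x mod m) :: int \<times> (nat \<Rightarrow> nat))"
  \<comment> \<open>The exponents of \<open>sh b i\<close> are reduced, so it can leave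
    \<open>N\<close> only through the power of \<open>z\<close>, and then the monomial extends to a
    chart.\<close>
  define bad where "bad = (\<lambda>b. {i. i \<le> degree (fp b) \<and> sh b i \<notin> N})"
  define good where "good = (\<lambda>b. {i. i \<le> degree (fp b) \<and> sh b i \<in> N})"
  have shE: "snd (sh b i) \<in> exps m X" if "b \<in> N" for b i
    using that m_pos unfolding sh_def idx_def exps_def by auto
  have "(\<lambda>y. \<Sum>b\<in>N. v b ^ p * (\<Sum>i\<in>bad b. coeff (fp b) i * mo (sh b i) y)) \<in> lspan D mo ?B"
  proof (intro lspan_sum lspan_cmult lspan_base)
    fix b i assume "b \<in> N" "i \<in> bad b"
    then show "sh b i \<in> ?B" using shE[of b i] unfolding bad_def idx_def by auto
  qed
  then have "(\<lambda>y. rep v (cls y) ^ p - rep (frob_coords p m l N v) (cls y)) \<in> lspan D mo ?B"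
  proof (rule lspan_cong)
    fix y assume y: "y \<in> D"
    have "rep v (cls y) ^ p = (\<Sum>b\<in>N. v b ^ p * mo b y ^ p)"
      unfolding rep_cls[OF y] p_def freshmans_dream_sum[OF assms refl] by (simp add: power_mult_distrib)
    also have "\<dots> = (\<Sum>b\<in>N. v b ^ p * (\<Sum>i\<in>good b. coeff (fp b) i * mo (sh b i) y) +
      v b ^ p * (\<Sum>i\<in>bad b. coeff (fp b) i * mo (sh b i) y))"
    proof (rule sum.cong[OF refl])
      fix b assume b: "b \<in> N"
      then have "snd b \<in> exps m X" unfolding idx_def by blast
      then have "mo b y ^ p = (\<Sum>i\<le>degree (fp b). coeff (fp b) i * mo (sh b i) y)"
        using mo_frobenius[OF y] unfolding fp_def sh_def by blast
      also have "{..degree (fp b)} = good b \<union> bad b" unfolding good_def bad_def by auto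
      also have "(\<Sum>i\<in>good b \<union> bad b. coeff (fp b) i * mo (sh b i) y) =
        (\<Sum>i\<in>good b. coeff (fp b) i * mo (sh b i) y) + (\<Sum>i\<in>bad b. coeff (fp b) i * mo (sh b i) y)"
        by (rule sum.union_disjoint) (auto simp: good_def bad_def)
      finally show "v b ^ p * mo b y ^ p = v b ^ p * (\<Sum>i\<in>good b. coeff (fp b) i * mo (sh b i) y) +
        v b ^ p * (\<Sum>i\<in>bad b. coeff (fp b) i * mo (sh b i) y)" by (simp add: distrib_left)
    qed
    also have "\<dots> = (\<Sum>b\<in>N. v b ^ p * (\<Sum>i\<in>good b. coeff (fp b) i * mo (sh b i) y)) +
      (\<Sum>b\<in>N. v b ^ p * (\<Sum>i\<in>bad b. coeff (fp b) i * mo (sh b i) y))" by (rule sum.distrib)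
    also have "(\<Sum>b\<in>N. v b ^ p * (\<Sum>i\<in>good b. coeff (fp b) i * mo (sh b i) y)) =
      (\<Sum>b\<in>N. v b ^ p * (\<Sum>b'\<in>N. frob_matrix p m l b' b * mo b' y))"
    proof (rule sum.cong[OF refl])
      fix b assume b: "b \<in> N"
      have "(\<Sum>i\<in>good b. coeff (fp b) i * mo (sh b i) y) = (\<Sum>i\<in>good b. frob_matrix p m l (sh b i) b * mo (sh b i) y)"
        by (intro sum.cong refl) (simp add: frob_matrix_def sh_def fp_def)
      also have "\<dots> = (\<Sum>b'\<in>sh b ` good b. frob_matrix p m l b' b * mo b' y)"
        by (rule sum.reindex_cong[of "sh b", symmetric]) (auto simp: inj_on_def sh_def)
      also have "\<dots> = (\<Sum>b'\<in>N. frob_matrix p m l b' b * mo b' y)"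
      proof (rule sum.mono_neutral_left[OF finite_N])
        show "sh b ` good b \<subseteq> N" unfolding good_def by auto
        show "\<forall>b'\<in>N - sh b ` good b. frob_matrix p m l b' b * mo b' y = 0"
        proof
          fix b' assume b': "b' \<in> N - sh b ` good b"
          have "frob_matrix p m l b' b = 0"
          proof (rule ccontr)
            assume nz: "frob_matrix p m l b' b \<noteq> 0"
            define i where "i = nat (fst b' - int p * fst b)"
            have *: "snd b' = (\<lambda>x. p * snd b x mod m)" "fst b' \<ge> int p * fst b" "coeff (fp b) i \<noteq> 0"
              using nz unfolding frob_matrix_def i_def fp_def by (auto split: if_splits)
            have "sh b i = b'" unfolding sh_def i_def using *(1,2) by (simp add: prod_eq_iff)
            moreover have "i \<le> degree (fp b)" using *(3) by (rule le_degree)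
            ultimately show False using b' unfolding good_def by blast
          qed
          then show "frob_matrix p m l b' b * mo b' y = 0" by simp
        qed
      qed
      finally show "v b ^ p * (\<Sum>i\<in>good b. coeff (fp b) i * mo (sh b i) y) = v b ^ p * (\<Sum>b'\<in>N. frob_matrix p m l b' b * mo b' y)"
        by simp
    qed
    also have "\<dots> = rep (frob_coords p m l N v) (cls y)"
      unfolding rep_cls[OF y] frob_coords_def sum_distrib_left
      by (subst sum.swap) (simp add: sum_distrib_left sum_distrib_right mult_ac)
    finally show "(\<Sum>b\<in>N. v b ^ p * (\<Sum>i\<in>bad b. coeff (fp b) i * mo (sh b i) y)) =
      rep v (cls y) ^ p - rep (frob_coords p m l N v) (cls y)" by simp
  qed
  then have "theta (\<lambda>P. rep v P ^ p - rep (frob_coords p m l N v) P) \<in> coboundaries t Y"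
    by (rule theta_lspan_coboundary)
  then show ?thesis unfolding theta_diff p_def theta_power_char[OF assms] .
qed

end

section \<open>Semilinear algebra and the p-rank as a sum over supports\<close>

section \<open>The p-rank\<close>

subsection \<open>Semilinear endomorphisms\<close>

context vector_space
begin

text \<open>The ambient space may be infinite-dimensional; finite dimension of \<open>U\<close> is
  imported from a finite set \<open>A\<close> whose span contains it.\<close>

lemma subspace_finite_basis:
  assumes "subspace U" "U \<subseteq> span A" "finite A"
  obtains B where "finite B" "B \<subseteq> U" "independent B" "span B = U" "card B = dim U"
proof -
  obtain B where B: "B \<subseteq> U" "independent B" "U \<subseteq> span B" "card B = dim U" using basis_exists by blast
  have "finite B" using independent_span_bound[OF assms(3) B(2)] B(1) assms(2) by blast
  moreover have "span B = U" using B(1,3) assms(1) span_minimal by blast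
  ultimately show ?thesis using B that by blast
qed

lemma dim_subspace_mono:
  assumes "subspace U" "subspace U'" "U \<subseteq> U'" "U' \<subseteq> span A" "finite A"
  shows "dim U \<le> dim U'"
proof -
  obtain B where B: "B \<subseteq> U" "independent B" "card B = dim U"
    using subspace_finite_basis[OF assms(1) _ assms(5)] assms(3,4) by (metis order_trans)
  obtain B' where B': "finite B'" "span B' = U'" "card B' = dim U'"
    using subspace_finite_basis[OF assms(2,4,5)] by metis
  show ?thesis using independent_span_bound[OF B'(1) B(2)] B B' assms(3) by auto
qed

lemma subspace_eq_dim:
  assumes "subspace U" "subspace U'" "U \<subseteq> U'" "U' \<subseteq> span A" "finite A" "dim U = dim U'"
  shows "U = U'"
proof (rule ccontr)
  assume "U \<noteq> U'"
  then obtain x where x: "x \<in> U'" "x \<notin> U" using assms(3) by blast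
  obtain B where B: "finite B" "B \<subseteq> U" "independent B" "span B = U" "card B = dim U"
    using subspace_finite_basis[OF assms(1) _ assms(5)] assms(3,4) by (metis order_trans)
  obtain B' where B': "finite B'" "span B' = U'" "card B' = dim U'"
    using subspace_finite_basis[OF assms(2,4,5)] by metis
  have "independent (insert x B)" using x(2) B(3,4) by (intro independent_insertI) auto
  moreover have "insert x B \<subseteq> span B'" using x(1) B(2) B'(2) assms(3) by blast
  ultimately have "card (insert x B) \<le> card B'" using independent_span_bound[OF B'(1)] by blast
  moreover have "x \<notin> B" using x(2) B(2) by blast
  ultimately show False using B B' assms(6) by simp
qed

text \<open>Adding the vectors of \<open>B'\<close> to \<open>B\<close> one by one keeps
  independence: in a relation the part from \<open>U\<close> lies in \<open>U'\<close> too, so it is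
  0 and the relation is one within \<open>B'\<close>.\<close>

lemma dim_direct_sum:
  assumes "subspace U" "subspace U'" "U \<subseteq> span A" "U' \<subseteq> span A" "finite A" "U \<inter> U' = {0}"
  shows "dim {x + y | x y. x \<in> U \<and> y \<in> U'} = dim U + dim U'"
proof -
  obtain B where B: "finite B" "B \<subseteq> U" "independent B" "span B = U" "card B = dim U"
    using subspace_finite_basis[OF assms(1,3,5)] by metis
  obtain B' where B': "finite B'" "B' \<subseteq> U'" "independent B'" "span B' = U'" "card B' = dim U'"
    using subspace_finite_basis[OF assms(2,4,5)] by metis
  have "independent (B \<union> C)" if "C \<subseteq> B'" for C
    using finite_subset[OF that B'(1)] that
  proof (induction C rule: finite_induct)
    case (insert c C)
    have iC: "independent (insert c C)" using B'(3) insert.prems independent_mono by blast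
    have "c \<notin> span (B \<union> C)"
    proof
      assume "c \<in> span (B \<union> C)"
      then obtain x y where xy: "c = x + y" "x \<in> span B" "y \<in> span C" unfolding span_Un by blast
      have "y \<in> U'" using xy(3) insert.prems span_mono[of C B'] B'(4) by blast
      then have "x \<in> U'" using xy(1) insert.prems B'(2) subspace_diff[OF assms(2), of c y] by auto
      then have "x = 0" using xy(2) B(4) assms(6) by blast
      then have "c \<in> span C" using xy by simp
      then show False using iC insert.hyps(2) by (simp add: independent_insert)
    qed
    then show ?case using insert by (simp add: independent_insertI)
  qed (use B(3) in simp)
  then have ind: "independent (B \<union> B')" by blast
  have "B \<inter> B' \<subseteq> {0}" using B(2) B'(2) assms(6) by blast
  then have "B \<inter> B' = {}" using B(3) dependent_zero by blast
  then have "card (B \<union> B') = dim U + dim U'" using card_Un_disjoint[OF B(1) B'(1)] B(5) B'(5) by simp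
  moreover have "span (B \<union> B') = {x + y | x y. x \<in> U \<and> y \<in> U'}" unfolding span_Un B(4) B'(4) by blast
  ultimately show ?thesis using dim_span_eq_card_independent[OF ind] by simp
qed

end

locale semilinear = vector_space scale
  for scale :: "'k::field \<Rightarrow> 'v::ab_group_add \<Rightarrow> 'v" (infixr \<open>*s\<close> 75) +
  fixes F :: "'v \<Rightarrow> 'v" and p :: nat
  assumes F_add: "F (x + y) = F x + F y" and F_scale: "F (c *s x) = c ^ p *s F x"
    and perfect: "\<And>c::'k. \<exists>d. d ^ p = c"
begin

lemma F_zero: "F 0 = 0"
  using F_add[of 0 0] by simp

lemma F_diff: "F (x - y) = F x - F y"
  using F_add[of "x - y" y] by (simp add: algebra_simps)

lemma F_span: "F ` span B \<subseteq> span (F ` B)"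
proof
  fix y assume "y \<in> F ` span B"
  then obtain x where x: "x \<in> span B" "y = F x" by blast
  from x(1) have "F x \<in> span (F ` B)"
  proof (induction rule: span_induct_alt)
    case base
    show ?case by (simp add: F_zero span_zero)
  next
    case (step c x y)
    then show ?case unfolding F_add F_scale by (intro span_add[OF span_scale[OF span_base]]) auto
  qed
  then show "y \<in> span (F ` B)" using x(2) by simp
qed

text \<open>Closure under scalars needs \<open>p\<close>-th roots, which \<open>perfect\<close>
  provides: \<open>c *s F a = F (d *s a)\<close> for \<open>d ^ p = c\<close>.\<close>

lemma F_subspace: "subspace U \<Longrightarrow> subspace (F ` U)"
  unfolding subspace_def
proof (intro conjI ballI allI)
  assume U: "0 \<in> U \<and> (\<forall>x\<in>U. \<forall>y\<in>U. x + y \<in> U) \<and> (\<forall>c. \<forall>x\<in>U. c *s x \<in> U)"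
  show "0 \<in> F ` U" using U F_zero by (metis image_eqI)
  show "x + y \<in> F ` U" if xy: "x \<in> F ` U" "y \<in> F ` U" for x y
  proof -
    obtain a b where "a \<in> U" "b \<in> U" "x = F a" "y = F b" using xy by blast
    then show ?thesis using U F_add by (metis image_eqI)
  qed
  show "c *s x \<in> F ` U" if x: "x \<in> F ` U" for c x
  proof -
    obtain a where a: "a \<in> U" "x = F a" using x by blast
    obtain d where "d ^ p = c" using perfect by blast
    then have "c *s x = F (d *s a)" using a(2) F_scale by simp
    then show ?thesis using a(1) U by blast
  qed
qed

text \<open>A nonzero vector of the kernel extends to a basis of \<open>U\<close>; the images of the
  other basis vectors already span the image, whose dimension is then too small.\<close>

lemma F_inj:
  assumes U: "subspace U" "U \<subseteq> span A" "finite A" and eq: "dim (F ` U) = dim U"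
  shows "inj_on F U"
proof (rule inj_onI, rule ccontr)
  fix x y assume xy: "x \<in> U" "y \<in> U" "F x = F y" "x \<noteq> y"
  define z where "z = x - y"
  have z: "z \<in> U" "z \<noteq> 0" "F z = 0" unfolding z_def using xy F_diff subspace_diff[OF U(1)] by auto
  have "independent {z}" using z(2) dependent_single by blast
  then obtain B where B: "{z} \<subseteq> B" "B \<subseteq> U" "independent B" "U \<subseteq> span B"
    using maximal_independent_subset_extend[of "{z}" U] z(1) by blast
  have fin: "finite B" using independent_span_bound[OF U(3) B(3)] B(2) U(2) by blast
  have "card B = dim U" by (rule basis_card_eq_dim[OF B(2,4,3)])
  have "F ` U \<subseteq> span (F ` B)" using F_span[of B] B(4) by blast
  also have "F ` B \<subseteq> insert 0 (F ` (B - {z}))" using z(3) by auto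
  then have "span (F ` B) \<subseteq> span (F ` (B - {z}))" using span_mono span_insert_0 by metis
  finally have "dim (F ` U) \<le> card (F ` (B - {z}))" using fin by (intro dim_le_card) auto
  also have "\<dots> \<le> card (B - {z})" using fin by (intro card_image_le) auto
  also have "\<dots> < card B" using B(1) fin by (intro card_Diff1_less) auto
  finally show False using eq \<open>card B = dim U\<close> by simp
qed

text \<open>On a finite-dimensional space the images of the iterates of \<open>F\<close> become constant; the limit
  is the largest subspace that \<open>F\<close> maps bijectively to itself.\<close>

definition core :: "'v set \<Rightarrow> 'v set" where "core S = (\<Inter>i. (F ^^ i) ` S)"

definition stable :: "'v set \<Rightarrow> bool" where
  "stable S \<longleftrightarrow> subspace S \<and> F ` S \<subseteq> S \<and> (\<exists>A. finite A \<and> S \<subseteq> span A)"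

lemma stableE:
  assumes "stable S" obtains A where "finite A" "S \<subseteq> span A"
  using assms unfolding stable_def by blast

lemma iterates_subspace: "stable S \<Longrightarrow> subspace ((F ^^ i) ` S)"
proof (induction i)
  case (Suc i)
  then have "subspace (F ` (F ^^ i) ` S)" by (intro F_subspace)
  then show ?case by (simp add: image_comp)
qed (simp add: stable_def)

lemma iterates_Suc: "stable S \<Longrightarrow> (F ^^ Suc i) ` S \<subseteq> (F ^^ i) ` S"
proof (induction i)
  case (Suc i)
  then have "F ` (F ^^ Suc i) ` S \<subseteq> F ` (F ^^ i) ` S" by (intro image_mono)
  then show ?case by (simp add: image_comp)
qed (simp add: stable_def)

lemma iterates_antimono:
  assumes S: "stable S" and "i \<le> j" shows "(F ^^ j) ` S \<subseteq> (F ^^ i) ` S"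
  using assms(2)
proof (induction j rule: dec_induct)
  case (step j)
  then show ?case using iterates_Suc[OF S, of j] by blast
qed simp

text \<open>The dimensions of the iterated images cannot decrease forever. Once two consecutive ones
  agree, the images coincide, and applying \<open>F\<close> repeats this at every later
  step.\<close>

lemma iterates_eventually:
  assumes S: "stable S" shows "\<exists>K. \<forall>k\<ge>K. (F ^^ k) ` S = core S"
proof -
  obtain A where A: "finite A" "S \<subseteq> span A" by (rule stableE[OF S])
  define U where "U = (\<lambda>i. (F ^^ i) ` S)"
  have sub: "subspace (U i)" and US: "U i \<subseteq> span A" and dec: "U (Suc i) \<subseteq> U i" and step: "U (Suc i) = F ` U i" for i
    unfolding U_def using iterates_subspace[OF S] iterates_antimono[OF S, of 0 i] iterates_Suc[OF S] A(2)
    by (auto simp: image_comp)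
  have "\<exists>K. dim (U (Suc K)) = dim (U K)"
  proof (rule ccontr)
    assume "\<not> ?thesis"
    then have less: "dim (U (Suc i)) < dim (U i)" for i
      using dim_subspace_mono[OF sub sub dec US A(1), of i] by (simp add: order_less_le)
    have "dim (U i) + i \<le> dim (U 0)" for i
    proof (induction i)
      case (Suc i)
      then show ?case using less[of i] by linarith
    qed simp
    from this[of "Suc (dim (U 0))"] show False by simp
  qed
  then obtain K where K: "dim (U (Suc K)) = dim (U K)" by blast
  have eq: "U (Suc K) = U K" by (rule subspace_eq_dim[OF sub sub dec US A(1) K])
  have const: "U k = U K" if "k \<ge> K" for k
    using that by (induction k rule: dec_induct) (use step eq in auto)
  have "core S = U K"
  proof (intro equalityI subsetI)
    fix x assume "x \<in> U K"
    then have "x \<in> U i" for i using const[of i] iterates_antimono[OF S, of i K] unfolding U_def by (cases "i \<ge> K") auto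
    then show "x \<in> core S" unfolding core_def U_def by blast
  qed (auto simp: core_def U_def)
  then show ?thesis using const unfolding U_def by blast
qed

lemma core_facts:
  assumes S: "stable S"
  shows "subspace (core S)" "core S \<subseteq> S" "F ` core S = core S" "bij_betw F (core S) (core S)"
proof -
  obtain K where K: "\<forall>k\<ge>K. (F ^^ k) ` S = core S" using iterates_eventually[OF S] by blast
  then have KK: "core S = (F ^^ K) ` S" "core S = (F ^^ Suc K) ` S" by (metis order_refl, metis le_SucI order_refl)
  show sub: "subspace (core S)" unfolding KK(1) by (rule iterates_subspace[OF S])
  show cS: "core S \<subseteq> S" unfolding core_def using INF_lower[of 0 UNIV "\<lambda>i. (F ^^ i) ` S"] by simp
  have "F ` core S = F ` (F ^^ K) ` S" using KK(1) by simp
  also have "\<dots> = core S" using KK(2) by (simp add: image_comp)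
  finally show img: "F ` core S = core S" .
  obtain A where A: "finite A" "S \<subseteq> span A" by (rule stableE[OF S])
  have "inj_on F (core S)" by (rule F_inj[OF sub _ A(1)]) (use cS A(2) img in auto)
  then show "bij_betw F (core S) (core S)" using img unfolding bij_betw_def by blast
qed

text \<open>\<open>W\<close> is its own image under every iterate, so it is contained in each
  iterated image of \<open>S\<close>.\<close>

lemma core_greatest:
  assumes "W \<subseteq> S" "F ` W = W" shows "W \<subseteq> core S"
proof -
  have "(F ^^ i) ` W = W" for i
  proof (induction i)
    case (Suc i)
    have "(F ^^ Suc i) ` W = F ` (F ^^ i) ` W" by (simp add: image_comp)
    then show ?case using Suc assms(2) by simp
  qed simp
  then show ?thesis unfolding core_def using assms(1) by blast
qed

text \<open>For one large exponent \<open>k\<close> all three cores are images under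
  \<open>F ^^ k\<close>, which is additive and so carries the decomposition of \<open>S\<close> to
  one of \<open>core S\<close>.\<close>

lemma core_direct_sum:
  assumes S: "stable S" and S1: "stable S1" and S2: "stable S2"
    and sum: "S = {x + y | x y. x \<in> S1 \<and> y \<in> S2}" and int: "S1 \<inter> S2 = {0}"
  shows "dim (core S) = dim (core S1) + dim (core S2)"
proof -
  obtain K where K: "\<forall>k\<ge>K. (F ^^ k) ` S = core S" using iterates_eventually[OF S] by blast
  obtain K1 where K1: "\<forall>k\<ge>K1. (F ^^ k) ` S1 = core S1" using iterates_eventually[OF S1] by blast
  obtain K2 where K2: "\<forall>k\<ge>K2. (F ^^ k) ` S2 = core S2" using iterates_eventually[OF S2] by blast
  define k where "k = K + K1 + K2"
  have k: "(F ^^ k) ` S = core S" "(F ^^ k) ` S1 = core S1" "(F ^^ k) ` S2 = core S2"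
    using K K1 K2 unfolding k_def by auto
  have add: "(F ^^ i) (x + y) = (F ^^ i) x + (F ^^ i) y" for i x y by (induction i) (auto simp: F_add)
  have "core S = {x + y | x y. x \<in> core S1 \<and> y \<in> core S2}"
  proof (intro equalityI subsetI)
    fix z assume "z \<in> core S"
    then obtain x y where "x \<in> S1" "y \<in> S2" "z = (F ^^ k) (x + y)" unfolding k(1)[symmetric] using sum by blast
    then show "z \<in> {x + y | x y. x \<in> core S1 \<and> y \<in> core S2}" unfolding k(2,3)[symmetric] using add by blast
  next
    fix z assume "z \<in> {x + y | x y. x \<in> core S1 \<and> y \<in> core S2}"
    then obtain x y where "x \<in> S1" "y \<in> S2" "z = (F ^^ k) (x + y)" unfolding k(2,3)[symmetric] using add by force
    then show "z \<in> core S" unfolding k(1)[symmetric] using sum by blast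
  qed
  moreover obtain A where A: "finite A" "S \<subseteq> span A" by (rule stableE[OF S])
  have "0 \<in> S1" "0 \<in> S2" using S1 S2 subspace_0 unfolding stable_def by auto
  then have "S1 \<subseteq> S" "S2 \<subseteq> S" unfolding sum by force+
  then have "core S1 \<subseteq> span A" "core S2 \<subseteq> span A" using core_facts(2) S1 S2 A(2) by blast+
  moreover have "core S1 \<inter> core S2 = {0}"
    using core_facts(1,2)[OF S1] core_facts(1,2)[OF S2] int subspace_0 by blast
  ultimately show ?thesis using dim_direct_sum[OF core_facts(1)[OF S1] core_facts(1)[OF S2] _ _ A(1)] by simp
qed

end

subsection \<open>Transfer of dimensions\<close>

interpretation fs: vector_space "\<lambda>(c::'k::field) (f::'b \<Rightarrow> 'k) b. c * f b"
  by unfold_locales (auto simp: fun_eq_iff plus_fun_def algebra_simps)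

text \<open>Bridge from the type-based linear algebra of \<open>fs\<close> to the carrier-based one
  in which \<open>p_rank\<close> measures dimension.\<close>

definition fun_module :: "('b \<Rightarrow> 'k::field) set \<Rightarrow> ('k, 'b \<Rightarrow> 'k) module" where
  "fun_module S = \<lparr>carrier = S, monoid.mult = undefined, one = undefined, zero = 0, add = (+),
     smult = (\<lambda>c f b. c * f b)\<rparr>"

lemma fun_module_simps [simp]:
  "carrier (fun_module S) = S" "zero (fun_module S) = 0" "add (fun_module S) = (+)"
  "module.smult (fun_module S) c f = (\<lambda>b. c * f b)"
  unfolding fun_module_def by simp_all

lemma vectorspace_fun_module:
  fixes S :: "('b \<Rightarrow> 'k::field) set"
  assumes S: "fs.subspace S"
  shows "vectorspace class_ring (fun_module S)"
  unfolding vectorspace_def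
proof (intro conjI class_field moduleI abelian_groupI)
  show "cring (class_ring :: 'k ring)" using class_field[where 'a = 'k] unfolding field_def domain_def by blast
  show "\<zero>\<^bsub>fun_module S\<^esub> \<in> carrier (fun_module S)" using fs.subspace_0[OF S] by simp
  fix x assume x: "x \<in> carrier (fun_module S)"
  show "\<zero>\<^bsub>fun_module S\<^esub> \<oplus>\<^bsub>fun_module S\<^esub> x = x" by simp
  show "\<exists>y\<in>carrier (fun_module S). y \<oplus>\<^bsub>fun_module S\<^esub> x = \<zero>\<^bsub>fun_module S\<^esub>"
    using x fs.subspace_neg[OF S] by (intro bexI[of _ "- x"]) auto
  show "\<one>\<^bsub>class_ring\<^esub> \<odot>\<^bsub>fun_module S\<^esub> x = x" by simp
  fix a :: 'k
  show "a \<odot>\<^bsub>fun_module S\<^esub> x \<in> carrier (fun_module S)" using x fs.subspace_scale[OF S] by simp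
  {
    fix b :: 'k
    show "(a \<oplus>\<^bsub>class_ring\<^esub> b) \<odot>\<^bsub>fun_module S\<^esub> x = a \<odot>\<^bsub>fun_module S\<^esub> x \<oplus>\<^bsub>fun_module S\<^esub> b \<odot>\<^bsub>fun_module S\<^esub> x"
      by (simp add: plus_fun_def distrib_right)
    show "(a \<otimes>\<^bsub>class_ring\<^esub> b) \<odot>\<^bsub>fun_module S\<^esub> x = a \<odot>\<^bsub>fun_module S\<^esub> (b \<odot>\<^bsub>fun_module S\<^esub> x)"
      by (simp only: monoid.simps fun_module_simps mult.assoc)
  }
  fix y assume y: "y \<in> carrier (fun_module S)"
  show "x \<oplus>\<^bsub>fun_module S\<^esub> y \<in> carrier (fun_module S)" using x y fs.subspace_add[OF S] by simp
  show "x \<oplus>\<^bsub>fun_module S\<^esub> y = y \<oplus>\<^bsub>fun_module S\<^esub> x" by (simp add: add.commute)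
  show "a \<odot>\<^bsub>fun_module S\<^esub> (x \<oplus>\<^bsub>fun_module S\<^esub> y) = a \<odot>\<^bsub>fun_module S\<^esub> x \<oplus>\<^bsub>fun_module S\<^esub> a \<odot>\<^bsub>fun_module S\<^esub> y"
    by (simp add: plus_fun_def distrib_left)
  fix z assume "z \<in> carrier (fun_module S)"
  show "x \<oplus>\<^bsub>fun_module S\<^esub> y \<oplus>\<^bsub>fun_module S\<^esub> z = x \<oplus>\<^bsub>fun_module S\<^esub> (y \<oplus>\<^bsub>fun_module S\<^esub> z)"
    by (simp add: add.assoc)
qed

lemma finsum_fun_module:
  fixes S :: "('b \<Rightarrow> 'k::field) set"
  assumes S: "fs.subspace S" and "finite A" "\<And>i. i \<in> A \<Longrightarrow> f i \<in> S"
  shows "finsum (fun_module S) f A = sum f A"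
proof -
  interpret vectorspace class_ring "fun_module S" by (rule vectorspace_fun_module[OF S])
  show ?thesis using assms(2,3)
  proof (induction A rule: finite_induct)
    case (insert x A)
    then show ?case by (subst M.finsum_insert) auto
  qed simp
qed

text \<open>A basis in the sense of \<open>fs\<close> is one in the sense of modules with a carrier,
  because \<open>lincomb\<close> becomes an ordinary sum.\<close>

lemma dim_fun_module:
  fixes S :: "('b \<Rightarrow> 'k::field) set"
  assumes S: "fs.subspace S" and A: "finite A" "S \<subseteq> fs.span A"
  shows "vectorspace.fin_dim class_ring (fun_module S)" "vectorspace.dim class_ring (fun_module S) = fs.dim S"
proof -
  interpret V: vectorspace class_ring "fun_module S" by (rule vectorspace_fun_module[OF S])
  obtain B where B: "finite B" "B \<subseteq> S" "fs.independent B" "fs.span B = S" "card B = fs.dim S"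
    using fs.subspace_finite_basis[OF S A(2,1)] by metis
  have lin: "V.module.lincomb a C = (\<Sum>v\<in>C. (\<lambda>b. a v * v b))" if "finite C" "C \<subseteq> S" for a C
    unfolding V.module.lincomb_def using that fs.subspace_scale[OF S]
    by (subst finsum_fun_module[OF S]) auto
  have gen: "V.module.span B = carrier (fun_module S)"
  proof -
    have "V.module.span B = {\<Sum>v\<in>C. (\<lambda>b. a v * v b) | C a. finite C \<and> C \<subseteq> B}"
    proof (intro equalityI subsetI)
      fix x assume "x \<in> V.module.span B"
      then obtain a C where "x = V.module.lincomb a C" "finite C" "C \<subseteq> B" unfolding V.module.span_def by blast
      then show "x \<in> {\<Sum>v\<in>C. (\<lambda>b. a v * v b) | C a. finite C \<and> C \<subseteq> B}" using lin[of C a] B(2) by blast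
    next
      fix x assume "x \<in> {\<Sum>v\<in>C. (\<lambda>b. a v * v b) | C a. finite C \<and> C \<subseteq> B}"
      then obtain a C where "x = (\<Sum>v\<in>C. (\<lambda>b. a v * v b))" "finite C" "C \<subseteq> B" by blast
      then have "x = V.module.lincomb a C" "finite C" "C \<subseteq> B" "a \<in> C \<rightarrow> carrier class_ring"
        using lin[of C a] B(2) by auto
      then show "x \<in> V.module.span B" unfolding V.module.span_def by blast
    qed
    also have "\<dots> = fs.span B" unfolding fs.span_explicit by blast
    finally show ?thesis using B(4) by simp
  qed
  have ind: "\<not> V.module.lin_dep B"
  proof
    assume "V.module.lin_dep B"
    then obtain C a v where C: "finite C" "C \<subseteq> B" "V.module.lincomb a C = \<zero>\<^bsub>fun_module S\<^esub>" "v \<in> C" "a v \<noteq> \<zero>\<^bsub>class_ring\<^esub>"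
      unfolding V.module.lin_dep_def by blast
    then have "(\<Sum>v\<in>C. (\<lambda>b. a v * v b)) = 0" "a v \<noteq> 0" using lin[of C a] B(2) by auto
    then have "fs.dependent B" unfolding fs.dependent_explicit using C(1,2,4) by blast
    then show False using B(3) by blast
  qed
  have basis: "V.basis B" unfolding V.basis_def using gen ind B(2) by simp
  show "V.fin_dim" unfolding V.fin_dim_def using B(1,2) gen by auto
  show "V.dim = fs.dim S" using V.dim_basis[OF B(1) basis] B(5) by simp
qed

subsection \<open>The first cohomology as a vector space\<close>

text \<open>Every class of \<open>H1\<close> is written in this form, so that its operations become
  operations on representatives.\<close>

definition coset_of :: "nat \<Rightarrow> 'k::field point set \<Rightarrow> 'k cochain \<Rightarrow> 'k cochain set" where
  "coset_of t Y f = coboundaries t Y +>\<^bsub>cocycle_space t Y\<^esub> f"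

lemma cocycle_space_simps [simp]:
  "carrier (cocycle_space t Y) = cocycles t Y"
  "add (cocycle_space t Y) f g = (\<lambda>x y P. f x y P + g x y P)"
  "module.smult (cocycle_space t Y) c f = (\<lambda>x y P. c * f x y P)"
  unfolding cocycle_space_def by simp_all

lemma mem_coset_of: "g \<in> coset_of t Y f \<longleftrightarrow> (\<lambda>x y P. g x y P - f x y P) \<in> coboundaries t Y"
proof -
  have "g \<in> coset_of t Y f \<longleftrightarrow> (\<exists>h\<in>coboundaries t Y. g = (\<lambda>x y P. h x y P + f x y P))"
    unfolding coset_of_def a_r_coset_def' by simp
  also have "\<dots> \<longleftrightarrow> (\<lambda>x y P. g x y P - f x y P) \<in> coboundaries t Y"
    by (auto intro: bexI[of _ "\<lambda>x y P. g x y P - f x y P"])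
  finally show ?thesis .
qed

lemma coset_of_eq_iff: "coset_of t Y f = coset_of t Y g \<longleftrightarrow> (\<lambda>x y P. f x y P - g x y P) \<in> coboundaries t Y"
proof
  assume "coset_of t Y f = coset_of t Y g"
  moreover have "f \<in> coset_of t Y f" unfolding mem_coset_of by (simp add: coboundaries_zero)
  ultimately show "(\<lambda>x y P. f x y P - g x y P) \<in> coboundaries t Y" using mem_coset_of by blast
next
  assume fg: "(\<lambda>x y P. f x y P - g x y P) \<in> coboundaries t Y"
  have "h \<in> coset_of t Y f \<longleftrightarrow> h \<in> coset_of t Y g" for h
    unfolding mem_coset_of using coboundaries_add[OF _ fg, of "\<lambda>x y P. h x y P - f x y P"]
      coboundaries_diff[OF _ fg, of "\<lambda>x y P. h x y P - g x y P"] by (auto simp: algebra_simps)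
  then show "coset_of t Y f = coset_of t Y g" by blast
qed

lemma coset_of_zero: "coset_of t Y (\<lambda>x y P. 0) = coboundaries t Y"
  using mem_coset_of[of _ t Y "\<lambda>x y P. 0"] by auto

lemma carrier_H1: "carrier (H1 t Y) = coset_of t Y ` cocycles t Y"
  unfolding H1_def quotient_module_def A_RCOSETS_def' coset_of_def by auto

lemma zero_H1: "\<zero>\<^bsub>H1 t Y\<^esub> = coset_of t Y (\<lambda>x y P. 0)"
  unfolding H1_def quotient_module_def coset_of_zero by simp

lemma add_H1: "coset_of t Y f \<oplus>\<^bsub>H1 t Y\<^esub> coset_of t Y g = coset_of t Y (\<lambda>x y P. f x y P + g x y P)"
proof -
  have "coset_of t Y f \<oplus>\<^bsub>H1 t Y\<^esub> coset_of t Y g = {(\<lambda>x y P. a x y P + b x y P) | a b. a \<in> coset_of t Y f \<and> b \<in> coset_of t Y g}"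
    unfolding H1_def quotient_module_def by (auto simp: set_add_def')
  also have "\<dots> = coset_of t Y (\<lambda>x y P. f x y P + g x y P)"
  proof (intro equalityI subsetI)
    fix h assume "h \<in> {(\<lambda>x y P. a x y P + b x y P) | a b. a \<in> coset_of t Y f \<and> b \<in> coset_of t Y g}"
    then obtain a b where ab: "h = (\<lambda>x y P. a x y P + b x y P)" "a \<in> coset_of t Y f" "b \<in> coset_of t Y g" by blast
    have "(\<lambda>x y P. h x y P - (f x y P + g x y P)) = (\<lambda>x y P. (a x y P - f x y P) + (b x y P - g x y P))"
      unfolding ab(1) by (simp add: algebra_simps)
    then show "h \<in> coset_of t Y (\<lambda>x y P. f x y P + g x y P)"
      unfolding mem_coset_of using coboundaries_add[OF ab(2)[unfolded mem_coset_of] ab(3)[unfolded mem_coset_of]] by simp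
  next
    fix h assume h: "h \<in> coset_of t Y (\<lambda>x y P. f x y P + g x y P)"
    have "(\<lambda>x y P. h x y P - g x y P) \<in> coset_of t Y f"
      using h unfolding mem_coset_of by (simp add: algebra_simps)
    moreover have "g \<in> coset_of t Y g" unfolding mem_coset_of by (simp add: coboundaries_zero)
    ultimately show "h \<in> {(\<lambda>x y P. a x y P + b x y P) | a b. a \<in> coset_of t Y f \<and> b \<in> coset_of t Y g}"
      by (intro CollectI exI[of _ "\<lambda>x y P. h x y P - g x y P"] exI[of _ g]) simp
  qed
  finally show ?thesis .
qed

lemma coset_of_self: "f \<in> coset_of t Y f"
  unfolding mem_coset_of by (simp add: coboundaries_zero)

text \<open>Scalar multiplication in \<open>quotient_module\<close> is a union over all
  representatives; they give one and the same coset, so the union collapses.\<close>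

lemma smult_H1: "c \<odot>\<^bsub>H1 t Y\<^esub> coset_of t Y f = coset_of t Y (\<lambda>x y P. c * f x y P)"
proof -
  have "c \<odot>\<^bsub>H1 t Y\<^esub> coset_of t Y f = (\<Union>g\<in>coset_of t Y f. coset_of t Y (\<lambda>x y P. c * g x y P))"
    unfolding H1_def quotient_module_def coset_of_def by simp
  also have "\<dots> = coset_of t Y (\<lambda>x y P. c * f x y P)"
  proof -
    have "coset_of t Y (\<lambda>x y P. c * g x y P) = coset_of t Y (\<lambda>x y P. c * f x y P)" if "g \<in> coset_of t Y f" for g
      using coboundaries_cmult[OF that[unfolded mem_coset_of], of c] unfolding coset_of_eq_iff by (simp add: right_diff_distrib)
    then show ?thesis using coset_of_self[of f t Y] by blast
  qed
  finally show ?thesis .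
qed

text \<open>As for scalars, the union collapses: in characteristic \<open>p\<close> the
  \<open>p\<close>-th powers of two representatives differ by the \<open>p\<close>-th power of a
  coboundary, which is a coboundary again.\<close>

lemma frobenius_coset_of:
  fixes Y :: "'k::field point set"
  assumes "prime CHAR('k)"
  shows "frobenius_H1 t Y (coset_of t Y f) = coset_of t Y (\<lambda>x y P. f x y P ^ CHAR('k))"
proof -
  have "frobenius_H1 t Y (coset_of t Y f) = (\<Union>g\<in>coset_of t Y f. coset_of t Y (\<lambda>x y P. g x y P ^ CHAR('k)))"
    unfolding frobenius_H1_def coset_of_def ..
  also have "\<dots> = coset_of t Y (\<lambda>x y P. f x y P ^ CHAR('k))"
  proof -
    have "coset_of t Y (\<lambda>x y P. g x y P ^ CHAR('k)) = coset_of t Y (\<lambda>x y P. f x y P ^ CHAR('k))"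
      if "g \<in> coset_of t Y f" for g
      using coboundaries_frobenius[OF assms that[unfolded mem_coset_of]]
      unfolding coset_of_eq_iff by (simp add: power_diff_char[OF assms])
    then show ?thesis using coset_of_self[of f t Y] by blast
  qed
  finally show ?thesis .
qed

lemma vectorspace_H1:
  fixes Y :: "'k::field point set"
  shows "vectorspace class_ring (H1 t Y)"
  unfolding vectorspace_def
proof (intro conjI class_field moduleI abelian_groupI)
  show "cring (class_ring :: 'k ring)" using class_field[where 'a = 'k] unfolding field_def domain_def by blast
  have zc: "(\<lambda>x y P. 0) \<in> cocycles t Y" using coboundaries_zero coboundaries_subset_cocycles by blast
  then show "\<zero>\<^bsub>H1 t Y\<^esub> \<in> carrier (H1 t Y)" unfolding zero_H1 carrier_H1 by blast
  fix x assume "x \<in> carrier (H1 t Y)"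
  then obtain f where f: "f \<in> cocycles t Y" "x = coset_of t Y f" unfolding carrier_H1 by blast
  show "\<zero>\<^bsub>H1 t Y\<^esub> \<oplus>\<^bsub>H1 t Y\<^esub> x = x" unfolding f(2) zero_H1 add_H1 by simp
  show "\<exists>y\<in>carrier (H1 t Y). y \<oplus>\<^bsub>H1 t Y\<^esub> x = \<zero>\<^bsub>H1 t Y\<^esub>"
  proof (rule bexI)
    show "coset_of t Y (\<lambda>x y P. - 1 * f x y P) \<oplus>\<^bsub>H1 t Y\<^esub> x = \<zero>\<^bsub>H1 t Y\<^esub>"
      unfolding f(2) add_H1 zero_H1 by simp
    show "coset_of t Y (\<lambda>x y P. - 1 * f x y P) \<in> carrier (H1 t Y)"
      unfolding carrier_H1 by (rule imageI[OF cocycles_cmult[OF f(1)]])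
  qed
  show "\<one>\<^bsub>class_ring\<^esub> \<odot>\<^bsub>H1 t Y\<^esub> x = x" unfolding f(2) smult_H1 by simp
  fix a :: 'k
  show "a \<odot>\<^bsub>H1 t Y\<^esub> x \<in> carrier (H1 t Y)"
    unfolding f(2) smult_H1 carrier_H1 using cocycles_cmult[OF f(1)] by blast
  {
    fix b :: 'k
    show "(a \<oplus>\<^bsub>class_ring\<^esub> b) \<odot>\<^bsub>H1 t Y\<^esub> x = a \<odot>\<^bsub>H1 t Y\<^esub> x \<oplus>\<^bsub>H1 t Y\<^esub> b \<odot>\<^bsub>H1 t Y\<^esub> x"
      unfolding f(2) smult_H1 add_H1 by (simp add: distrib_right)
    show "(a \<otimes>\<^bsub>class_ring\<^esub> b) \<odot>\<^bsub>H1 t Y\<^esub> x = a \<odot>\<^bsub>H1 t Y\<^esub> (b \<odot>\<^bsub>H1 t Y\<^esub> x)"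
      unfolding f(2) smult_H1 by (simp only: monoid.simps mult.assoc)
  }
  fix y assume "y \<in> carrier (H1 t Y)"
  then obtain g where g: "g \<in> cocycles t Y" "y = coset_of t Y g" unfolding carrier_H1 by blast
  show "x \<oplus>\<^bsub>H1 t Y\<^esub> y \<in> carrier (H1 t Y)"
    unfolding f(2) g(2) add_H1 carrier_H1 using cocycles_add[OF f(1) g(1)] by blast
  show "x \<oplus>\<^bsub>H1 t Y\<^esub> y = y \<oplus>\<^bsub>H1 t Y\<^esub> x" unfolding f(2) g(2) add_H1 by (simp add: add.commute)
  show "a \<odot>\<^bsub>H1 t Y\<^esub> (x \<oplus>\<^bsub>H1 t Y\<^esub> y) = a \<odot>\<^bsub>H1 t Y\<^esub> x \<oplus>\<^bsub>H1 t Y\<^esub> a \<odot>\<^bsub>H1 t Y\<^esub> y"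
    unfolding f(2) g(2) add_H1 smult_H1 by (simp add: distrib_left)
  fix z assume "z \<in> carrier (H1 t Y)"
  then obtain h where h: "h \<in> cocycles t Y" "z = coset_of t Y h" unfolding carrier_H1 by blast
  show "x \<oplus>\<^bsub>H1 t Y\<^esub> y \<oplus>\<^bsub>H1 t Y\<^esub> z = x \<oplus>\<^bsub>H1 t Y\<^esub> (y \<oplus>\<^bsub>H1 t Y\<^esub> z)"
    unfolding f(2) g(2) h(2) add_H1 by (simp add: add.assoc)
qed

text \<open>\<open>\<theta>\<close> induces a linear bijection \<open>\<Phi>\<close> from
  \<open>S\<close> to H^1 that carries \<open>F\<close> to Frobenius. The largest subspace on which
  Frobenius is bijective is then the image of \<open>core S\<close>, of the same dimension.\<close>

theorem p_rank_eq_dim_core: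
  fixes Y :: "'k::field point set" and F :: "('b \<Rightarrow> 'k) \<Rightarrow> 'b \<Rightarrow> 'k" and \<theta> :: "('b \<Rightarrow> 'k) \<Rightarrow> 'k cochain"
  assumes prime: "prime CHAR('k)" and sl: "semilinear (\<lambda>(c::'k) f b. c * f b) F CHAR('k)"
    and S: "semilinear.stable (\<lambda>(c::'k) f b. c * f b) F S"
    and coc: "\<And>v. v \<in> S \<Longrightarrow> \<theta> v \<in> cocycles t Y"
    and add: "\<And>v w. \<theta> (\<lambda>b. v b + w b) = (\<lambda>x y P. \<theta> v x y P + \<theta> w x y P)"
    and cmult: "\<And>c v. \<theta> (\<lambda>b. c * v b) = (\<lambda>x y P. c * \<theta> v x y P)"
    and surj: "\<And>f. f \<in> cocycles t Y \<Longrightarrow> \<exists>v\<in>S. (\<lambda>x y P. f x y P - \<theta> v x y P) \<in> coboundaries t Y"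
    and inj: "\<And>v. v \<in> S \<Longrightarrow> \<theta> v \<in> coboundaries t Y \<Longrightarrow> v = 0"
    and frob: "\<And>v. v \<in> S \<Longrightarrow> (\<lambda>x y P. \<theta> v x y P ^ CHAR('k) - \<theta> (F v) x y P) \<in> coboundaries t Y"
  shows "p_rank t Y = fs.dim (semilinear.core F S)"
proof -
  interpret semilinear "\<lambda>(c::'k) (f :: 'b \<Rightarrow> 'k) b. c * f b" F "CHAR('k)" by (rule sl)
  define \<Phi> where "\<Phi> = (\<lambda>v. coset_of t Y (\<theta> v))"
  note core = core_facts[OF S]
  have Ssub: "fs.subspace S" and FS: "F ` S \<subseteq> S" using S unfolding stable_def by auto
  have \<Phi>add: "\<Phi> (v + w) = \<Phi> v \<oplus>\<^bsub>H1 t Y\<^esub> \<Phi> w" for v w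
    unfolding \<Phi>_def add_H1 using add[of v w] by (simp add: plus_fun_def)
  have \<Phi>smult: "\<Phi> (\<lambda>b. c * v b) = c \<odot>\<^bsub>H1 t Y\<^esub> \<Phi> v" for c v
    unfolding \<Phi>_def smult_H1 using cmult[of c v] by simp
  have \<Phi>frob: "frobenius_H1 t Y (\<Phi> v) = \<Phi> (F v)" if "v \<in> S" for v
    unfolding \<Phi>_def frobenius_coset_of[OF prime] coset_of_eq_iff by (rule frob[OF that])
  have \<Phi>car: "\<Phi> ` S = carrier (H1 t Y)"
  proof (intro equalityI subsetI)
    fix x assume "x \<in> carrier (H1 t Y)"
    then obtain f where f: "f \<in> cocycles t Y" "x = coset_of t Y f" unfolding carrier_H1 by blast
    then obtain v where "v \<in> S" "(\<lambda>x y P. f x y P - \<theta> v x y P) \<in> coboundaries t Y" using surj by blast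
    then show "x \<in> \<Phi> ` S" unfolding f(2) \<Phi>_def using coset_of_eq_iff by blast
  qed (auto simp: carrier_H1 \<Phi>_def coc)
  have \<Phi>inj: "inj_on \<Phi> S"
  proof (rule inj_onI)
    fix v w assume vw: "v \<in> S" "w \<in> S" "\<Phi> v = \<Phi> w"
    have "\<theta> (\<lambda>b. v b + - 1 * w b) = (\<lambda>x y P. \<theta> v x y P - \<theta> w x y P)" unfolding add cmult by simp
    moreover have "(\<lambda>b. v b + - 1 * w b) = v - w" by (simp add: fun_eq_iff)
    ultimately have "\<theta> (v - w) \<in> coboundaries t Y" using vw(3) unfolding \<Phi>_def coset_of_eq_iff by simp
    then have "v - w = 0" using inj fs.subspace_diff[OF Ssub vw(1,2)] by blast
    then show "v = w" by simp
  qed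
  have \<Phi>zero: "\<Phi> 0 = \<zero>\<^bsub>H1 t Y\<^esub>"
  proof -
    have "\<theta> 0 = (\<lambda>x y P. 0)" using cmult[of 0 0] by (simp add: zero_fun_def)
    then show ?thesis unfolding \<Phi>_def zero_H1 by simp
  qed
  define W where "W = \<Phi> ` core S"
  have Wcar: "W \<subseteq> carrier (H1 t Y)" unfolding W_def using core(2) \<Phi>car by blast
  have Wsub: "subspace class_ring W (H1 t Y)"
    unfolding subspace_def submodule_def
  proof (intro conjI allI impI vectorspace_H1)
    show "module class_ring (H1 t Y)" using vectorspace_H1 unfolding vectorspace_def by blast
    show "W \<subseteq> carrier (H1 t Y)" by (rule Wcar)
    show "\<zero>\<^bsub>H1 t Y\<^esub> \<in> W" unfolding W_def \<Phi>zero[symmetric] using fs.subspace_0[OF core(1)] by blast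
    show "x \<oplus>\<^bsub>H1 t Y\<^esub> y \<in> W" if xy: "x \<in> W" "y \<in> W" for x y
    proof -
      obtain v w where vw: "v \<in> core S" "w \<in> core S" "x = \<Phi> v" "y = \<Phi> w" using xy unfolding W_def by blast
      then show ?thesis unfolding W_def using imageI[OF fs.subspace_add[OF core(1) vw(1,2)], of \<Phi>] \<Phi>add[of v w] by simp
    qed
    show "c \<odot>\<^bsub>H1 t Y\<^esub> x \<in> W" if xW: "x \<in> W" for c x
    proof -
      obtain v where v: "v \<in> core S" "x = \<Phi> v" using xW unfolding W_def by blast
      then show ?thesis unfolding W_def using imageI[OF fs.subspace_scale[OF core(1) v(1)], of \<Phi> c] \<Phi>smult[of c v] by simp
    qed
  qed
  have Wbij: "bij_betw (frobenius_H1 t Y) W W"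
  proof -
    have eq: "frobenius_H1 t Y (\<Phi> v) = \<Phi> (F v)" if "v \<in> core S" for v using \<Phi>frob core(2) that by blast
    have "frobenius_H1 t Y ` W = \<Phi> ` F ` core S" unfolding W_def image_image using eq by auto
    then have img: "frobenius_H1 t Y ` W = W" unfolding core(3) W_def .
    have "inj_on (frobenius_H1 t Y) W"
    proof (rule inj_onI)
      fix x y assume xy: "x \<in> W" "y \<in> W" "frobenius_H1 t Y x = frobenius_H1 t Y y"
      then obtain v w where vw: "v \<in> core S" "w \<in> core S" "x = \<Phi> v" "y = \<Phi> w" unfolding W_def by blast
      then have "\<Phi> (F v) = \<Phi> (F w)" using xy(3) eq by simp
      moreover have "F v \<in> S" "F w \<in> S" using vw core(2) FS by blast+
      ultimately have "F v = F w" using \<Phi>inj unfolding inj_on_def by blast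
      then have "v = w" using core(4) vw unfolding bij_betw_def inj_on_def by blast
      then show "x = y" using vw by simp
    qed
    then show ?thesis using img unfolding bij_betw_def by blast
  qed
  have great: "W' \<subseteq> W" if W': "subspace class_ring W' (H1 t Y)" "bij_betw (frobenius_H1 t Y) W' W'" for W'
  proof -
    \<comment> \<open>Pulling \<open>W'\<close> back along \<open>\<Phi>\<close> gives a subset that
      \<open>F\<close> maps onto itself, to which maximality of the core applies.\<close>
    define U where "U = {v \<in> S. \<Phi> v \<in> W'}"
    have Wc: "W' \<subseteq> carrier (H1 t Y)" using W'(1) unfolding subspace_def submodule_def by blast
    have "F ` U = U"
    proof (intro equalityI subsetI)
      fix w assume "w \<in> F ` U"
      then obtain v where v: "v \<in> S" "\<Phi> v \<in> W'" "w = F v" unfolding U_def by blast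
      have "frobenius_H1 t Y (\<Phi> v) \<in> W'" using W'(2) v(2) unfolding bij_betw_def by blast
      then show "w \<in> U" unfolding U_def using \<Phi>frob[OF v(1)] v FS by auto
    next
      fix w assume w: "w \<in> U"
      then obtain x where x: "x \<in> W'" "\<Phi> w = frobenius_H1 t Y x" using W'(2) unfolding U_def bij_betw_def by blast
      obtain v where v: "v \<in> S" "x = \<Phi> v" using x(1) Wc \<Phi>car by blast
      have "\<Phi> w = \<Phi> (F v)" using x(2) v \<Phi>frob by simp
      moreover have "F v \<in> S" "w \<in> S" using FS v(1) w unfolding U_def by blast+
      ultimately have "w = F v" using \<Phi>inj unfolding inj_on_def by blast
      then show "w \<in> F ` U" unfolding U_def using v x(1) by blast
    qed
    then have "U \<subseteq> core S" by (intro core_greatest) (auto simp: U_def)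
    moreover have "W' \<subseteq> \<Phi> ` U"
    proof
      fix x assume x: "x \<in> W'"
      then have "x \<in> \<Phi> ` S" unfolding \<Phi>car using Wc by (rule subsetD[rotated])
      then show "x \<in> \<Phi> ` U" using x unfolding U_def by auto
    qed
    ultimately show ?thesis unfolding W_def by blast
  qed
  have G: "(GREATEST W. subspace class_ring W (H1 t Y) \<and> bij_betw (frobenius_H1 t Y) W W) = W"
    by (rule Greatest_equality) (use Wsub Wbij great in auto)
  obtain A where A: "finite A" "core S \<subseteq> fs.span A" using core(2) stableE[OF S] by (metis order_trans)
  interpret V: vectorspace class_ring "fun_module (core S)" by (rule vectorspace_fun_module[OF core(1)])
  interpret H: vectorspace class_ring "H1 t Y" by (rule vectorspace_H1)
  interpret Wv: vectorspace class_ring "(H1 t Y)\<lparr>carrier := W\<rparr>" by (rule H.subspace_is_vs[OF Wsub])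
  have "\<Phi> \<in> LinearCombinations.module_hom class_ring (fun_module (core S)) ((H1 t Y)\<lparr>carrier := W\<rparr>)"
    unfolding LinearCombinations.module_hom_def using \<Phi>add \<Phi>smult by (auto simp: W_def)
  then interpret lm: linear_map class_ring "fun_module (core S)" "(H1 t Y)\<lparr>carrier := W\<rparr>" \<Phi>
    by unfold_locales
  have "V.dim = Wv.dim"
  proof (rule lm.dim_eq)
    show "V.fin_dim" by (rule dim_fun_module(1)[OF core(1) A])
    show "inj_on \<Phi> (carrier (fun_module (core S)))" using inj_on_subset[OF \<Phi>inj core(2)] by simp
    show "\<Phi> ` carrier (fun_module (core S)) = carrier ((H1 t Y)\<lparr>carrier := W\<rparr>)" by (simp add: W_def)
  qed
  then show ?thesis unfolding p_rank_def Let_def G using dim_fun_module(2)[OF core(1) A] by simp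
qed

subsection \<open>Decomposition by supports\<close>

definition supp :: "int \<times> (nat \<Rightarrow> nat) \<Rightarrow> nat set" where "supp b = {x. snd b x \<noteq> 0}"

text \<open>Indices outside the support contribute nothing to \<open>|a|\<close>, so the range of
  \<open>j\<close> for a monomial is the same on every curve on which it occurs.\<close>

lemma idx_subset_iff:
  assumes "X \<subseteq> X'" "finite X'"
  shows "b \<in> idx m X \<longleftrightarrow> b \<in> idx m X' \<and> supp b \<subseteq> X"
proof (cases "supp b \<subseteq> X")
  case True
  have "sum (snd b) X = sum (snd b) X'"
    using True assms by (intro sum.mono_neutral_left) (auto simp: supp_def)
  moreover have "snd b \<in> exps m X \<longleftrightarrow> snd b \<in> exps m X'" if "m > 0"
  proof -
    have "snd b x = 0" if "x \<notin> X" for x using True that unfolding supp_def by blast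
    then show ?thesis using assms(1) that unfolding exps_def by fastforce
  qed
  \<comment> \<open>For \<open>m = 0\<close> only \<open>a = 0\<close> could occur, and then no
    \<open>j\<close> lies strictly between \<open>- 0\<close> and 0.\<close>
  moreover have "m > 0" if "b \<in> idx m X \<or> b \<in> idx m X'"
  proof (rule ccontr)
    assume "\<not> m > 0"
    then have "snd b x = 0" for x using that unfolding idx_def exps_def by auto
    then show False using that unfolding idx_def by auto
  qed
  ultimately show ?thesis using True unfolding idx_def by (auto simp del: of_nat_sum)
next
  case False
  then show ?thesis unfolding idx_def exps_def supp_def by auto
qed

text \<open>Multiplication by \<open>p\<close> is injective modulo \<open>m\<close>, so a reduced
  exponent becomes 0 only if it was 0. This invariance of supports is what splits the
  cohomology.\<close>

lemma frob_matrix_supp: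
  assumes "coprime p m" "b \<in> idx m X" "frob_matrix p m l b' b \<noteq> 0"
  shows "supp b' = supp b"
proof -
  have "snd b' x = 0 \<longleftrightarrow> snd b x = 0" for x
  proof -
    have "snd b' x = p * snd b x mod m" using assms(3) unfolding frob_matrix_def by (auto split: if_splits)
    moreover have "p * snd b x mod m = 0 \<longleftrightarrow> m dvd snd b x"
      using assms(1) by (simp add: coprime_commute coprime_dvd_mult_right_iff flip: dvd_eq_mod_eq_0)
    moreover have "snd b x = 0 \<or> snd b x < m"
      using assms(2) unfolding idx_def exps_def by (cases "x \<in> X") auto
    then have "m dvd snd b x \<longleftrightarrow> snd b x = 0" by (auto dest: nat_dvd_not_less)
    ultimately show ?thesis by simp
  qed
  then show ?thesis unfolding supp_def by auto
qed

text \<open>All curves share the index set of the full parameter set \<open>X\<close>; a smaller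
  curve corresponds to taking for \<open>\<T>\<close> the subsets of its own parameter set.\<close>

definition supported :: "nat \<Rightarrow> nat set \<Rightarrow> nat set set \<Rightarrow> (int \<times> (nat \<Rightarrow> nat) \<Rightarrow> 'k::field) set" where
  "supported m X \<T> = {v. \<forall>b. v b \<noteq> 0 \<longrightarrow> b \<in> idx m X \<and> supp b \<in> \<T>}"

locale fermat_frobenius =
  fixes l :: "nat \<Rightarrow> 'k::alg_closed_field" and m :: nat and X :: "nat set"
  assumes prime: "prime CHAR('k)" and coprime: "coprime CHAR('k) m" and X: "finite X"
begin

abbreviation Fr :: "(int \<times> (nat \<Rightarrow> nat) \<Rightarrow> 'k) \<Rightarrow> int \<times> (nat \<Rightarrow> nat) \<Rightarrow> 'k" where
  "Fr \<equiv> frob_coords CHAR('k) m l (idx m X)"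

sublocale semilinear "\<lambda>(c::'k) (f :: int \<times> (nat \<Rightarrow> nat) \<Rightarrow> 'k) b. c * f b" Fr "CHAR('k)"
proof
  fix v w :: "int \<times> (nat \<Rightarrow> nat) \<Rightarrow> 'k" and c :: 'k
  show "Fr (v + w) = Fr v + Fr w"
    by (intro ext) (simp add: frob_coords_def plus_fun_def freshmans_dream[OF prime refl] distrib_left sum.distrib)
  show "Fr (\<lambda>b. c * v b) = (\<lambda>b. c ^ CHAR('k) * Fr v b)"
    by (intro ext) (simp add: frob_coords_def power_mult_distrib sum_distrib_left mult.left_commute)
  show "\<exists>d. d ^ CHAR('k) = c" using nth_root_exists[OF prime_gt_0_nat[OF prime]] by blast
qed

lemma supported_stable: "stable (supported m X \<T> :: (int \<times> (nat \<Rightarrow> nat) \<Rightarrow> 'k) set)"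
  unfolding stable_def
proof (intro conjI exI)
  show "fs.subspace (supported m X \<T> :: (int \<times> (nat \<Rightarrow> nat) \<Rightarrow> 'k) set)"
    unfolding fs.subspace_def supported_def by (auto simp: plus_fun_def) (metis add_0)+
  show "Fr ` supported m X \<T> \<subseteq> supported m X \<T>"
  proof
    fix w assume "w \<in> Fr ` supported m X \<T>"
    then obtain v where v: "v \<in> supported m X \<T>" "w = Fr v" by blast
    show "w \<in> supported m X \<T>" unfolding supported_def
    proof (intro CollectI allI impI)
      fix b' assume "w b' \<noteq> 0"
      then have b': "b' \<in> idx m X" and "(\<Sum>b\<in>idx m X. frob_matrix CHAR('k) m l b' b * v b ^ CHAR('k)) \<noteq> 0"
        unfolding v(2) frob_coords_def by (auto split: if_splits)
      then obtain b where b: "b \<in> idx m X" "frob_matrix CHAR('k) m l b' b * v b ^ CHAR('k) \<noteq> 0"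
        by (meson sum.not_neutral_contains_not_neutral)
      then have nz: "frob_matrix CHAR('k) m l b' b \<noteq> 0" "v b \<noteq> 0"
        using prime_gt_0_nat[OF prime] by (auto simp: power_0_left)
      have "supp b' = supp b" by (rule frob_matrix_supp[OF coprime b(1) nz(1)])
      moreover have "supp b \<in> \<T>" using nz(2) v(1) unfolding supported_def by blast
      ultimately show "b' \<in> idx m X \<and> supp b' \<in> \<T>" using b' by simp
    qed
  qed
  let ?E = "(\<lambda>b b'. if b' = b then 1 else 0 :: 'k) ` idx m X"
  show "finite ?E" using finite_idx[OF X] by blast
  show "supported m X \<T> \<subseteq> fs.span ?E"
  proof
    fix v :: "int \<times> (nat \<Rightarrow> nat) \<Rightarrow> 'k" assume v: "v \<in> supported m X \<T>"
    have "v = (\<Sum>b\<in>idx m X. (\<lambda>b'. v b * (if b' = b then 1 else 0)))"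
    proof
      fix b'
      have "(\<Sum>b\<in>idx m X. v b * (if b' = b then 1 else 0)) = (\<Sum>b\<in>idx m X. if b = b' then v b else 0)"
        by (intro sum.cong) auto
      also have "\<dots> = v b'"
      proof -
        have "v b' = 0" if "b' \<notin> idx m X" using v that unfolding supported_def by blast
        then show ?thesis using finite_idx[OF X, of m] by auto
      qed
      finally show "v b' = (\<Sum>b\<in>idx m X. (\<lambda>b'. v b * (if b' = b then 1 else 0))) b'" by (simp add: sum_fun_apply)
    qed
    also have "\<dots> \<in> fs.span ?E" by (intro fs.span_sum fs.span_scale fs.span_base) blast
    finally show "v \<in> fs.span ?E" .
  qed
qed

definition sigma :: "nat set \<Rightarrow> nat" where
  "sigma T = fs.dim (core (supported m X {T}))"

lemma dim_core_zero:
  assumes "supported m X \<T> \<subseteq> {0 :: int \<times> (nat \<Rightarrow> nat) \<Rightarrow> 'k}" shows "fs.dim (core (supported m X \<T>)) = 0"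
proof -
  have "core (supported m X \<T>) \<subseteq> fs.span {}" using core_facts(2)[OF supported_stable] assms by auto
  then have "fs.dim (core (supported m X \<T>)) \<le> card ({} :: (int \<times> (nat \<Rightarrow> nat) \<Rightarrow> 'k) set)"
    by (rule fs.dim_le_card) simp
  then show ?thesis by simp
qed

text \<open>With \<open>a = 0\<close> the interval for \<open>j\<close> is empty; this is the
  vanishing of H^1 of the projective line.\<close>

lemma sigma_empty: "sigma {} = 0"
  unfolding sigma_def
proof (rule dim_core_zero)
  show "supported m X {{}} \<subseteq> {0 :: int \<times> (nat \<Rightarrow> nat) \<Rightarrow> 'k}"
  proof
    fix v :: "int \<times> (nat \<Rightarrow> nat) \<Rightarrow> 'k" assume v: "v \<in> supported m X {{}}"
    have "v b = 0" for b
    proof (rule ccontr)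
      assume "v b \<noteq> 0"
      then have "b \<in> idx m X" "supp b = {}" using v unfolding supported_def by blast+
      then show False unfolding idx_def supp_def by auto
    qed
    then show "v \<in> {0}" by auto
  qed
qed

text \<open>The vectors for one support and those for the remaining supports form complementary
  stable subspaces, so their cores add up.\<close>

lemma dim_core_supported:
  assumes "finite \<T>"
  shows "fs.dim (core (supported m X \<T> :: (int \<times> (nat \<Rightarrow> nat) \<Rightarrow> 'k) set)) = (\<Sum>T\<in>\<T>. sigma T)"
  using assms
proof (induction \<T> rule: finite_induct)
  case empty
  have "supported m X {} \<subseteq> {0 :: int \<times> (nat \<Rightarrow> nat) \<Rightarrow> 'k}" unfolding supported_def by auto
  then show ?case using dim_core_zero by simp
next
  case (insert T \<T>)
  let ?S = "\<lambda>\<T>. supported m X \<T> :: (int \<times> (nat \<Rightarrow> nat) \<Rightarrow> 'k) set"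
  have "fs.dim (core (?S (insert T \<T>))) = fs.dim (core (?S {T})) + fs.dim (core (?S \<T>))"
  proof (rule core_direct_sum[OF supported_stable supported_stable supported_stable])
    show "?S {T} \<inter> ?S \<T> = {0}" using insert.hyps(2) unfolding supported_def by (auto simp: fun_eq_iff)
    show "?S (insert T \<T>) = {x + y | x y. x \<in> ?S {T} \<and> y \<in> ?S \<T>}"
    proof (intro equalityI subsetI)
      fix v assume v: "v \<in> ?S (insert T \<T>)"
      have "v = (\<lambda>b. if supp b = T then v b else 0) + (\<lambda>b. if supp b = T then 0 else v b)"
        by (auto simp: fun_eq_iff)
      moreover have "(\<lambda>b. if supp b = T then v b else 0) \<in> ?S {T}" "(\<lambda>b. if supp b = T then 0 else v b) \<in> ?S \<T>"
        using v unfolding supported_def by auto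
      ultimately show "v \<in> {x + y | x y. x \<in> ?S {T} \<and> y \<in> ?S \<T>}" by blast
    next
      fix v assume "v \<in> {x + y | x y. x \<in> ?S {T} \<and> y \<in> ?S \<T>}"
      then obtain x y where xy: "x \<in> ?S {T}" "y \<in> ?S \<T>" "v = x + y" by blast
      have "x b \<noteq> 0 \<or> y b \<noteq> 0" if "v b \<noteq> 0" for b using that unfolding xy(3) by auto
      then show "v \<in> ?S (insert T \<T>)" using xy(1,2) unfolding supported_def by blast
    qed
  qed
  then show ?case using insert by (simp add: sigma_def)
qed

text \<open>The coordinates of the smaller curve are those of the ambient space with support inside
  \<open>set js\<close>, and on them \<open>Fr\<close> agrees with the Frobenius of that curve,
  because \<open>frob_matrix\<close> refers to the common parameters \<open>l\<close> and to no
  particular curve.\<close>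

theorem p_rank_gen_fermat:
  assumes js: "distinct js" "set js \<subseteq> X"
  shows "p_rank (Suc (length js)) (gen_fermat m (map l js)) = (\<Sum>T\<in>Pow (set js). sigma T)"
proof -
  have "of_nat m \<noteq> (0::'k)"
  proof
    assume "of_nat m = (0::'k)"
    then have "CHAR('k) dvd m" by (simp add: of_nat_eq_0_iff_char_dvd)
    then have "CHAR('k) = 1" using coprime by (metis coprime_absorb_left nat_dvd_1_iff_1)
    then show False using prime by simp
  qed
  then interpret C: fermat_curve l m js using js(1) by unfold_locales
  let ?S = "supported m X (Pow (set js)) :: (int \<times> (nat \<Rightarrow> nat) \<Rightarrow> 'k) set"
  have S: "v \<in> ?S \<longleftrightarrow> (\<forall>b. b \<notin> idx m (set js) \<longrightarrow> v b = 0)" for v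
    unfolding supported_def idx_subset_iff[OF js(2) X] by auto
  have Fr: "Fr v = frob_coords CHAR('k) m l (idx m (set js)) v" if v: "v \<in> ?S" for v
  proof
    fix b'
    have "Fr v \<in> ?S" using supported_stable v unfolding stable_def by blast
    then have out: "Fr v b' = 0" if "b' \<notin> idx m (set js)" using that S by blast
    have "(\<Sum>b\<in>idx m X. frob_matrix CHAR('k) m l b' b * v b ^ CHAR('k)) =
      (\<Sum>b\<in>idx m (set js). frob_matrix CHAR('k) m l b' b * v b ^ CHAR('k))"
      using v S[of v] finite_idx[OF X, of m] idx_subset_iff[OF js(2) X] prime_gt_0_nat[OF prime]
      by (intro sum.mono_neutral_right) (auto simp: power_0_left)
    then show "Fr v b' = frob_coords CHAR('k) m l (idx m (set js)) v b'"
      using out idx_subset_iff[OF js(2) X] unfolding frob_coords_def by auto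
  qed
  have "p_rank (Suc (length js)) (gen_fermat m (map l js)) = fs.dim (core ?S)"
  proof (rule p_rank_eq_dim_core[OF prime semilinear_axioms supported_stable, where \<theta> = "\<lambda>v. C.theta (C.rep v)"])
    show "C.theta (C.rep v) \<in> cocycles (Suc (length js)) (gen_fermat m (map l js))" for v
      by (rule C.theta_rep_cocycle)
    show "\<exists>v\<in>?S. (\<lambda>x y P. f x y P - C.theta (C.rep v) x y P) \<in> coboundaries (Suc (length js)) (gen_fermat m (map l js))"
      if "f \<in> cocycles (Suc (length js)) (gen_fermat m (map l js))" for f
      using C.theta_rep_surj[OF that] S by blast
    show "v = 0" if "v \<in> ?S" "C.theta (C.rep v) \<in> coboundaries (Suc (length js)) (gen_fermat m (map l js))" for v
      using C.theta_rep_inj[OF _ that(2)] that(1) S[of v] by (auto simp: fun_eq_iff)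
    show "(\<lambda>x y P. C.theta (C.rep v) x y P ^ CHAR('k) - C.theta (C.rep (Fr v)) x y P)
      \<in> coboundaries (Suc (length js)) (gen_fermat m (map l js))" if "v \<in> ?S" for v
      unfolding Fr[OF that] by (rule C.theta_rep_frobenius[OF prime])
  qed (rule C.theta_rep_add, rule C.theta_rep_cmult)
  then show ?thesis using dim_core_supported[of "Pow (set js)"] by simp
qed

end

section \<open>Alternating sums over nonempty proper subsets\<close>

subsection \<open>Inclusion-exclusion\<close>

text \<open>The theorem numbers curves by increasing index lists; the combinatorics is done with
  subsets.\<close>

lemma sum_strict_sorted_lists:
  fixes g :: "nat set \<Rightarrow> int"
  assumes "finite X"
  shows "(\<Sum>js | length js = k \<and> sorted_wrt (<) js \<and> set js \<subseteq> X. g (set js)) = (\<Sum>J | J \<subseteq> X \<and> card J = k. g J)"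
proof (rule sum.reindex_bij_betw)
  show "bij_betw set {js. length js = k \<and> sorted_wrt (<) js \<and> set js \<subseteq> X} {J. J \<subseteq> X \<and> card J = k}"
  proof (rule bij_betw_byWitness[where f' = sorted_list_of_set])
    show "\<forall>js\<in>{js. length js = k \<and> sorted_wrt (<) js \<and> set js \<subseteq> X}. sorted_list_of_set (set js) = js"
      by (auto simp: strict_sorted_iff sorted_list_of_set.idem_if_sorted_distinct)
    show "\<forall>J\<in>{J. J \<subseteq> X \<and> card J = k}. set (sorted_list_of_set J) = J"
    proof
      fix J assume "J \<in> {J. J \<subseteq> X \<and> card J = k}"
      then have "finite J" using assms finite_subset by blast
      then show "set (sorted_list_of_set J) = J" by simp
    qed
    show "set ` {js. length js = k \<and> sorted_wrt (<) js \<and> set js \<subseteq> X} \<subseteq> {J. J \<subseteq> X \<and> card J = k}"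
      by (auto simp: strict_sorted_iff distinct_card)
    show "sorted_list_of_set ` {J. J \<subseteq> X \<and> card J = k} \<subseteq> {js. length js = k \<and> sorted_wrt (<) js \<and> set js \<subseteq> X}"
    proof
      fix js assume "js \<in> sorted_list_of_set ` {J. J \<subseteq> X \<and> card J = k}"
      then obtain J where J: "J \<subseteq> X" "card J = k" "js = sorted_list_of_set J" by blast
      then have "finite J" using assms finite_subset by blast
      then show "js \<in> {js. length js = k \<and> sorted_wrt (<) js \<and> set js \<subseteq> X}" using J by simp
    qed
  qed
qed

text \<open>After exchanging the sums, \<open>\<sigma> T\<close> is weighted by an alternating count
  of the sets \<open>J\<close> with \<open>T \<subseteq> J \<subset> X\<close>. For nonempty proper
  \<open>T\<close> the count over all \<open>J\<close> up to \<open>X\<close> cancels, so omitting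
  \<open>J = X\<close> leaves the weight \<open>(- 1) ^ card X\<close>, which is at most 1. For
  \<open>T = X\<close> there is no \<open>J\<close>.\<close>

lemma alternating_sum_proper_subsets_le:
  fixes \<sigma> :: "nat set \<Rightarrow> nat"
  assumes X: "finite X" "card X = n - 1" "n \<ge> 2" and empty: "\<sigma> {} = 0"
  shows "(\<Sum>t = 2..n - 1. (- 1) ^ t * (\<Sum>J | J \<subseteq> X \<and> card J = t - 1. \<Sum>T\<in>Pow J. int (\<sigma> T))) \<le> (\<Sum>T\<in>Pow X. int (\<sigma> T))"
proof -
  \<comment> \<open>As \<open>t\<close> runs from 2 to \<open>n - 1\<close>,
    \<open>card J = t - 1\<close> runs from 1 to \<open>n - 2\<close>, which is one less than
    \<open>card X\<close>: these are the nonempty proper subsets.\<close>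
  define \<J> where "\<J> = {J. J \<subseteq> X \<and> 1 \<le> card J \<and> card J \<le> n - 2}"
  have fin: "finite \<J>" unfolding \<J>_def using X(1) by simp
  have "(\<Sum>t = 2..n - 1. (- 1) ^ t * (\<Sum>J | J \<subseteq> X \<and> card J = t - 1. \<Sum>T\<in>Pow J. int (\<sigma> T))) =
    (\<Sum>t = 2..n - 1. \<Sum>J | J \<in> \<J> \<and> card J + 1 = t. (- 1) ^ (card J + 1) * (\<Sum>T\<in>Pow J. int (\<sigma> T)))"
  proof (rule sum.cong[OF refl])
    fix t assume t: "t \<in> {2..n - 1}"
    then have "{J. J \<subseteq> X \<and> card J = t - 1} = {J. J \<in> \<J> \<and> card J + 1 = t}" unfolding \<J>_def by auto
    then show "(- 1) ^ t * (\<Sum>J | J \<subseteq> X \<and> card J = t - 1. \<Sum>T\<in>Pow J. int (\<sigma> T)) =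
      (\<Sum>J | J \<in> \<J> \<and> card J + 1 = t. (- 1) ^ (card J + 1) * (\<Sum>T\<in>Pow J. int (\<sigma> T)))"
      unfolding sum_distrib_left by (intro sum.cong) auto
  qed
  also have "\<dots> = (\<Sum>J\<in>\<J>. (- 1) ^ (card J + 1) * (\<Sum>T\<in>Pow J. int (\<sigma> T)))"
    by (rule sum.group[OF fin]) (auto simp: \<J>_def)
  also have "\<dots> = (\<Sum>J\<in>\<J>. \<Sum>T\<in>Pow X. if T \<subseteq> J then (- 1) ^ (card J + 1) * int (\<sigma> T) else 0)"
  proof (rule sum.cong[OF refl])
    fix J assume "J \<in> \<J>"
    then have "J \<subseteq> X" unfolding \<J>_def by blast
    then have eq: "Pow J = {T \<in> Pow X. T \<subseteq> J}" by blast
    show "(- 1) ^ (card J + 1) * (\<Sum>T\<in>Pow J. int (\<sigma> T)) =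
      (\<Sum>T\<in>Pow X. if T \<subseteq> J then (- 1) ^ (card J + 1) * int (\<sigma> T) else 0)"
      unfolding sum_distrib_left eq by (rule sum.inter_filter) (simp add: X(1))
  qed
  also have "\<dots> = (\<Sum>T\<in>Pow X. \<Sum>J\<in>\<J>. if T \<subseteq> J then (- 1) ^ (card J + 1) * int (\<sigma> T) else 0)"
    by (rule sum.swap)
  also have "\<dots> \<le> (\<Sum>T\<in>Pow X. int (\<sigma> T))"
  proof (rule sum_mono)
    fix T assume T: "T \<in> Pow X"
    have eq: "(\<Sum>J\<in>\<J>. if T \<subseteq> J then (- 1) ^ (card J + 1) * int (\<sigma> T) else 0) =
      (\<Sum>J\<in>{J \<in> \<J>. T \<subseteq> J}. (- 1) ^ (card J + 1)) * int (\<sigma> T)"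
      unfolding sum_distrib_right by (rule sum.inter_filter[OF fin, symmetric])
    consider "T = {}" | "T = X" | "T \<noteq> {}" "T \<subset> X" using T by blast
    then show "(\<Sum>J\<in>\<J>. if T \<subseteq> J then (- 1) ^ (card J + 1) * int (\<sigma> T) else 0) \<le> int (\<sigma> T)"
    proof cases
      case 1
      then show ?thesis unfolding eq using empty by simp
    next
      case 2
      have none: "{J \<in> \<J>. T \<subseteq> J} = {}" using 2 X unfolding \<J>_def by auto
      show ?thesis unfolding eq none by simp
    next
      case 3
      let ?A = "{J. J \<subseteq> X \<and> T \<subseteq> J}"
      have finA: "finite ?A" using X(1) by (simp add: finite_subset[of _ "Pow X"] Collect_mono Pow_def)
      have "{J \<in> \<J>. T \<subseteq> J} = ?A - {X}"
      proof (intro equalityI subsetI)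
        fix J assume J: "J \<in> ?A - {X}"
        then have "card J < card X" using psubset_card_mono[OF X(1)] by auto
        moreover have "J \<noteq> {}" "finite J" using J 3(1) X(1) finite_subset by auto
        ultimately show "J \<in> {J \<in> \<J>. T \<subseteq> J}" using J X(2) unfolding \<J>_def
          by (auto simp: Suc_le_eq card_gt_0_iff)
      next
        fix J assume "J \<in> {J \<in> \<J>. T \<subseteq> J}"
        then show "J \<in> ?A - {X}" using X unfolding \<J>_def by auto
      qed
      moreover have "(\<Sum>J\<in>?A. (- 1) ^ card J) = (0::int)"
        using card_subsupersets_even_odd[OF X(1) 3(2)] finA
        by (intro sum_alternating_cancels) (simp_all add: conj_assoc)
      then have "(\<Sum>J\<in>?A - {X}. (- 1) ^ card J) = - ((- 1) ^ card X :: int)"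
        using finA 3(2) by (simp add: sum_diff1)
      ultimately have "(\<Sum>J\<in>{J \<in> \<J>. T \<subseteq> J}. (- 1) ^ (card J + 1)) = ((- 1) ^ card X :: int)"
        by (simp add: sum_negf)
      \<comment> \<open>The weight is 1 for even \<open>card X\<close> and \<open>- 1\<close> for
        odd \<open>card X\<close>; in the second case the bound is strict as soon as
        \<open>\<sigma> T > 0\<close>.\<close>
      also have "\<dots> \<le> 1" by (cases "even (card X)") auto
      finally show ?thesis unfolding eq using mult_right_mono[of _ 1 "int (\<sigma> T)"] by simp
    qed
  qed
  finally show ?thesis .
qed

theorem theorem16:
  fixes l :: "nat \<Rightarrow> 'k::alg_closed_field" and m n :: nat
  assumes "CHAR('k) = 2"
    and "odd m" and "m \<ge> 3"
    and "n \<ge> 2"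
    and "inj_on l {0..n - 2}" and "\<forall>i\<in>{0..n - 2}. l i \<noteq> 0"
  shows "int (p_rank n (gen_fermat m (map l [0..<n - 1]))) \<ge>
    (\<Sum>t = 2..n - 1. (-1) ^ t *
      (\<Sum>js | length js = t - 1 \<and> sorted_wrt (<) js \<and> set js \<subseteq> {0..n - 2}.
        int (p_rank t (gen_fermat m (map l js)))))"
proof -
  \<comment> \<open>Oddness of \<open>m\<close> is its coprimality to the characteristic 2. The
    parameter set is that of the full curve, so every smaller curve lives inside this one
    interpretation.\<close>
  interpret fermat_frobenius l m "{0..n - 2}"
    by unfold_locales (use assms(1,2) in auto)
  have rank: "int (p_rank t (gen_fermat m (map l js))) = (\<Sum>T\<in>Pow (set js). int (sigma T))"
    if "length js = t - 1" "t \<ge> 1" "distinct js" "set js \<subseteq> {0..n - 2}" for t js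
  proof -
    have "t = Suc (length js)" using that by simp
    then show ?thesis using p_rank_gen_fermat[OF that(3,4)] by simp
  qed
  have set_eq: "set [0..<n - 1] = {0..n - 2}" using assms(4) by auto
  have "(\<Sum>t = 2..n - 1. (-1) ^ t *
      (\<Sum>js | length js = t - 1 \<and> sorted_wrt (<) js \<and> set js \<subseteq> {0..n - 2}. int (p_rank t (gen_fermat m (map l js))))) =
    (\<Sum>t = 2..n - 1. (-1) ^ t * (\<Sum>J | J \<subseteq> {0..n - 2} \<and> card J = t - 1. \<Sum>T\<in>Pow J. int (sigma T)))"
  proof (rule sum.cong[OF refl])
    fix t assume t: "t \<in> {2..n - 1}"
    have "(\<Sum>js | length js = t - 1 \<and> sorted_wrt (<) js \<and> set js \<subseteq> {0..n - 2}. int (p_rank t (gen_fermat m (map l js)))) =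
      (\<Sum>js | length js = t - 1 \<and> sorted_wrt (<) js \<and> set js \<subseteq> {0..n - 2}. \<Sum>T\<in>Pow (set js). int (sigma T))"
      using t by (intro sum.cong refl rank) (auto simp: strict_sorted_iff)
    also have "\<dots> = (\<Sum>J | J \<subseteq> {0..n - 2} \<and> card J = t - 1. \<Sum>T\<in>Pow J. int (sigma T))"
      by (rule sum_strict_sorted_lists) simp
    finally show "(-1) ^ t * (\<Sum>js | length js = t - 1 \<and> sorted_wrt (<) js \<and> set js \<subseteq> {0..n - 2}. int (p_rank t (gen_fermat m (map l js)))) =
      (-1) ^ t * (\<Sum>J | J \<subseteq> {0..n - 2} \<and> card J = t - 1. \<Sum>T\<in>Pow J. int (sigma T))" by simp
  qed
  also have "\<dots> \<le> (\<Sum>T\<in>Pow {0..n - 2}. int (sigma T))"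
    using assms(4) by (intro alternating_sum_proper_subsets_le sigma_empty) auto
  also have "\<dots> = int (p_rank n (gen_fermat m (map l [0..<n - 1])))"
    using rank[of "[0..<n - 1]" n] assms(4) set_eq by simp
  finally show ?thesis .
qed

end
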